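(* Assume that under $\mathbb P$ the associated random walk has $\mathbb E[X]=0$ and that the distribution of $X$ under $\mathbb P$ is nonlattice and belongs to the domain of attraction of a two-sided stable law with index $\alpha\in(1,2]$ (full setting, norming sequence $c_n$, measures $\mathbb P^+_x$, $\mathbb P^-=\mathbb P^-_0$, function $U$ and constant $K$ as in the context). Fix $0<\delta<1$ and write $\delta n$ for $\lfloor\delta n\rfloor$. Let $W_n:=w_n(F_1,\dots,F_{\delta n})$ and $T_n:=t_n(F_1,\dots,F_{\delta n})$, $n\in\mathbb N$, be random variables with values in Euclidean (or Polish) spaces $\mathcal W$ and $\mathcal T$ respectively, such that, as $n\to\infty$, $$W_n\to W_\infty\quad\mathbb P^+_x\text{-a.s. for all }x\ge0,\qquad T_n\to T_\infty\quad\mathbb P^-\text{-a.s.},$$ for some $\mathcal W$-valued random variable $W_\infty$ and some $\mathcal T$-valued random variable $T_\infty$. Denote $\tilde T_n:=t_n(F_n,F_{n-1},\dots,F_{n-\delta n+1})$. Let, further, $\varphi:\mathcal W\times\mathcal T\times(-\infty,0]\to\mathbb R$ be a continuous function such that $$\sup_{(u,v,z)\in\mathcal W\times\mathcal T\times(-\infty,0]}|\varphi(u,v,z)|e^{-\theta z}<\infty$$ for some $\theta>0$. Then $$\lim_{n\to\infty}nc_n\,\mathbb E[\varphi(W_n,\tilde T_n,S_n);\,\tau(n)=n]=K\iiint_{\mathcal W\times\mathcal T\times[0,\infty)}\varphi(u,v,-z)\,\mathbb P^+_z(W_\infty\in du)\,\mathbb P^-(T_\infty\in dv)\,U(z)\,dz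 .$$
   Context: Environment. $F$ is a random probability measure on $\mathbb N_0$ (random element of the Polish space $\Delta$ of such measures with the total variation metric), and $F_1,F_2,\dots$ are i.i.d. copies of $F$ under $\mathbf P$. Put $m(F)=\sum_{j\ge1}jF(\{j\})$, $X=\log m(F)$, $X_n=\log m(F_n)$, $S_n=S_0+X_1+\dots+X_n$. Standing assumptions: the generating function of $F$ is geometric with probability 1, i.e. $\sum_jF(\{j\})s^j=\frac1{1+e^X(1-s)}$; $-\infty<\mathbf E[X]<0$; and there is $\varkappa\in(0,1]$ with $\mathbf E[Xe^{\varkappa X}]=0$ ($\varkappa=1$: intermediate subcritical; $\varkappa=\beta<1$: weakly subcritical). Measure $\mathbb P$. With $\gamma=\mathbf E[e^{\varkappa X}]$, $\mathbb P$ is defined by $\mathbb E[\psi(F_1,\dots,F_n)]=\gamma^{-n}\mathbf E[\psi(F_1,\dots,F_n)e^{\varkappa(X_1+\dots+X_n)}]$ for all $n$ and bounded measurable $\psi$; under $\mathbb P$ the $F_n$ are i.i.d. and $\mathbb E[X]=0$. Write $\mathbb P_x$, $\mathbb E_x$ when $S_0=x$ (the environment having the same law as under $\mathbb P$); $\mathbb P=\mathbb P_0$. The domain-of-attraction assumption means that there is an increasing positive sequence $c_n=n^{1/\alpha}l_1(n)$, $l_1$ slowly varying, fixed from now on, such that $S_n/c_n$ converges in distribution under $\mathbb P$ to the two-sided (not concentrated on a half-line) stable law of index $\alpha$. Nonlattice means not concentrated on any $a+h\mathbb Z$, $h>0$. Notation. $M_n=\max(S_1,\dots,S_n)$, $L_n=\min(S_0,S_1,\dots,S_n)$,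 and $\tau(n)=\min\{0\le k\le n:S_k=L_n\}$ is the moment of the first minimum on $[0,n]$; $\mathbb E[\,\cdot\,;A]=\mathbb E[\,\cdot\,I_A]$. $$U(x)=1+\sum_{n\ge1}\mathbb P(S_n\ge-x,\,M_n<0)\ (x\ge0),\quad U(x)=0\ (x<0),$$ $$V(x)=1+\sum_{n\ge1}\mathbb P(S_n<-x,\,L_n\ge0)\ (x\le0),\quad V(x)=0\ (x>0).$$ It is known that $\mathbb E[U(x+X);x+X\ge0]=U(x)$ for $x\ge0$ and $\mathbb E[V(x+X);x+X<0]=V(x)$ for $x\le0$. Hence there are probability measures $\mathbb P^+_x$ ($x\ge0$) and $\mathbb P^-_x$ ($x\le0$) on the environment sequences (with $S_0=x$) determined by $$\mathbb E^+_x[O_n]=\frac1{U(x)}\mathbb E_x[O_nU(S_n);L_n\ge0],\qquad \mathbb E^-_x[O_n]=\frac1{V(x)}\mathbb E_x[O_nV(S_n);M_n<0]$$ for all $n$ and all bounded random variables $O_n$ that are measurable functions of $F_1,\dots,F_n$. Write $\mathbb P^\pm=\mathbb P^\pm_0$. Constant $K$. It is known that if $\mathbb E[X]=0$ and the distribution of $X$ under $\mathbb P$ is nonlattice and belongs to the domain of attraction of a two-sided stable law with index $\alpha\in(1,2]$, with norming sequence $c_n$, then there is a constant $K>0$, independent of $\theta$ and $x$, such that for each $\theta>0$, as $n\to\infty$, $$\mathbb E_x[e^{-\theta S_n};L_n\ge0]\sim\frac{K}{nc_n}\,U(x)\int_{-\infty}^0e^{\theta z}V(z)\,dz\quad(x\ge0),\qquad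 \mathbb E[e^{\theta S_n};\tau(n)=n]\sim\frac{K}{nc_n}\int_0^\infty e^{-\theta z}U(z)\,dz;$$ this is the constant $K$ in the claim. *)

theory Defs
  imports "HOL-Probability.Probability" "HOL-Library.Landau_Symbols"
begin

section \<open>Environments\<close>

definition tv_dist :: "nat pmf \<Rightarrow> nat pmf \<Rightarrow> real" where
  "tv_dist p q = (SUP A. \<bar>measure_pmf.prob p A - measure_pmf.prob q A\<bar>)"

lemma tv_dist_bdd:
  fixes p q :: "nat pmf"
  shows "bdd_above (range (\<lambda>A. \<bar>measure_pmf.prob p A - measure_pmf.prob q A\<bar>))"
proof (rule bdd_aboveI2)
  fix A :: "nat set"
  show "\<bar>measure_pmf.prob p A - measure_pmf.prob q A\<bar> \<le> 1"
    using measure_pmf.prob_le_1[of p A] measure_pmf.prob_le_1[of q A]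
      measure_nonneg[of "measure_pmf p" A] measure_nonneg[of "measure_pmf q" A]
    by linarith
qed

lemma tv_dist_upper: "\<bar>measure_pmf.prob p A - measure_pmf.prob q A\<bar> \<le> tv_dist p q"
  unfolding tv_dist_def by (rule cSUP_upper[OF _ tv_dist_bdd]) simp

lemma Metric_space_tv_dist: "Metric_space UNIV tv_dist"
proof
  fix p q r :: "nat pmf"
  show "0 \<le> tv_dist p q"
    using tv_dist_upper[of p "{}" q] by simp
  show "tv_dist p q = tv_dist q p"
    unfolding tv_dist_def by (simp add: abs_minus_commute)
  show "tv_dist p q = 0 \<longleftrightarrow> p = q"
  proof
    assume "tv_dist p q = 0"
    hence "pmf p j = pmf q j" for j
      using tv_dist_upper[of p "{j}" q] by (simp add: measure_pmf_single)
    thus "p = q" by (rule pmf_eqI)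
  qed (simp add: tv_dist_def)
  show "tv_dist p r \<le> tv_dist p q + tv_dist q r"
    unfolding tv_dist_def[of p r]
  proof (rule cSUP_least)
    fix A :: "nat set"
    show "\<bar>measure_pmf.prob p A - measure_pmf.prob r A\<bar> \<le> tv_dist p q + tv_dist q r"
      using tv_dist_upper[of p A q] tv_dist_upper[of q A r] by linarith
  qed simp
qed

text \<open>The space of probability measures on the nonnegative integers, with the Borel
  sigma-algebra of the total variation metric.\<close>

definition env :: "nat pmf measure" where
  "env = sigma UNIV {A. openin (Metric_space.mtopology UNIV tv_dist) A}"

definition env_vec :: "nat \<Rightarrow> (nat \<Rightarrow> nat pmf) measure" where
  "env_vec n = (\<Pi>\<^sub>M i\<in>{..<n}. env)"

text \<open>An environment sequence \<open>\<omega>\<close> is indexed from 0: the environment \<open>F\<^sub>n\<close> (\<open>n \<ge> 1\<close>)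
  is \<open>\<omega> (n - 1)\<close>.\<close>

definition env_seq :: "(nat \<Rightarrow> nat pmf) measure" where
  "env_seq = (\<Pi>\<^sub>M i\<in>UNIV. env)"

text \<open>The vectors \<open>(F\<^sub>1, \<dots>, F\<^sub>k)\<close> and \<open>(F\<^sub>n, F\<^sub>n\<^sub>-\<^sub>1, \<dots>, F\<^sub>n\<^sub>-\<^sub>k\<^sub>+\<^sub>1)\<close>, for \<open>k \<le> n\<close>.\<close>

definition first_envs :: "nat \<Rightarrow> (nat \<Rightarrow> nat pmf) \<Rightarrow> nat \<Rightarrow> nat pmf" where
  "first_envs k \<omega> = (\<lambda>i\<in>{..<k}. \<omega> i)"

definition last_envs_rev :: "nat \<Rightarrow> nat \<Rightarrow> (nat \<Rightarrow> nat pmf) \<Rightarrow> nat \<Rightarrow> nat pmf" where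
  "last_envs_rev n k \<omega> = (\<lambda>i\<in>{..<k}. \<omega> (n - 1 - i))"

definition env_mean :: "nat pmf \<Rightarrow> real" where
  "env_mean p = (\<Sum>j. real (Suc j) * pmf p (Suc j))"

definition log_mean :: "nat pmf \<Rightarrow> real" where
  "log_mean p = ln (env_mean p)"

definition geometric_gf :: "nat pmf \<Rightarrow> bool" where
  "geometric_gf p \<longleftrightarrow>
     (\<forall>s\<in>{0..1}. (\<Sum>j. pmf p j * s ^ j) = 1 / (1 + exp (log_mean p) * (1 - s)))"


section \<open>The associated random walk\<close>

text \<open>The argument \<open>x\<close> is the starting point \<open>S\<^sub>0\<close>; the law of the environment sequence does
  not depend on it.\<close>

definition walk :: "real \<Rightarrow> (nat \<Rightarrow> nat pmf) \<Rightarrow> nat \<Rightarrow> real" where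
  "walk x \<omega> n = x + (\<Sum>i<n. log_mean (\<omega> i))"

definition walk_max :: "real \<Rightarrow> (nat \<Rightarrow> nat pmf) \<Rightarrow> nat \<Rightarrow> real" where
  "walk_max x \<omega> n = Max (walk x \<omega> ` {1..n})"

definition walk_min :: "real \<Rightarrow> (nat \<Rightarrow> nat pmf) \<Rightarrow> nat \<Rightarrow> real" where
  "walk_min x \<omega> n = Min (walk x \<omega> ` {0..n})"

definition first_min :: "real \<Rightarrow> (nat \<Rightarrow> nat pmf) \<Rightarrow> nat \<Rightarrow> nat" where
  "first_min x \<omega> n = Min {k \<in> {0..n}. walk x \<omega> k = walk_min x \<omega> n}"


section \<open>Changes of measure\<close>

text \<open>\<open>Q\<close> is the original law of a single environment and \<open>P\<close> the exponentially tilted law of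
  the environment sequence.\<close>

definition tilted_law :: "nat pmf measure \<Rightarrow> real \<Rightarrow> (nat \<Rightarrow> nat pmf) measure \<Rightarrow> bool" where
  "tilted_law Q \<kappa> P \<longleftrightarrow>
     prob_space P \<and> sets P = sets env_seq \<and>
     (\<forall>n. \<forall>\<psi> \<in> borel_measurable (env_vec n). bounded (\<psi> ` space (env_vec n)) \<longrightarrow>
        (\<integral>\<omega>. \<psi> (first_envs n \<omega>) \<partial>P) =
          (\<integral>\<omega>. \<psi> (first_envs n \<omega>) * exp (\<kappa> * (\<Sum>i<n. log_mean (\<omega> i))) \<partial>(\<Pi>\<^sub>M i\<in>UNIV. Q))
            / (\<integral>p. exp (\<kappa> * log_mean p) \<partial>Q) ^ n)"

definition renewal_U :: "(nat \<Rightarrow> nat pmf) measure \<Rightarrow> real \<Rightarrow> real" where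
  "renewal_U P x = (if x \<ge> 0
     then 1 + (\<Sum>k. measure P {\<omega> \<in> space P. walk 0 \<omega> (Suc k) \<ge> - x \<and> walk_max 0 \<omega> (Suc k) < 0})
     else 0)"

definition renewal_V :: "(nat \<Rightarrow> nat pmf) measure \<Rightarrow> real \<Rightarrow> real" where
  "renewal_V P x = (if x \<le> 0
     then 1 + (\<Sum>k. measure P {\<omega> \<in> space P. walk 0 \<omega> (Suc k) < - x \<and> walk_min 0 \<omega> (Suc k) \<ge> 0})
     else 0)"

definition plus_law :: "(nat \<Rightarrow> nat pmf) measure \<Rightarrow> real \<Rightarrow> (nat \<Rightarrow> nat pmf) measure \<Rightarrow> bool" where
  "plus_law P x R \<longleftrightarrow>
     prob_space R \<and> sets R = sets env_seq \<and>
     (\<forall>n. \<forall>\<psi> \<in> borel_measurable (env_vec n). bounded (\<psi> ` space (env_vec n)) \<longrightarrow>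
        (\<integral>\<omega>. \<psi> (first_envs n \<omega>) \<partial>R) =
          1 / renewal_U P x * (\<integral>\<omega>. \<psi> (first_envs n \<omega>) * renewal_U P (walk x \<omega> n)
                             * indicator {\<omega>. walk_min x \<omega> n \<ge> 0} \<omega> \<partial>P))"

text \<open>Here \<open>n \<ge> 1\<close>, since the maximum is over the times \<open>1, \<dots>, n\<close>.\<close>

definition minus_law :: "(nat \<Rightarrow> nat pmf) measure \<Rightarrow> real \<Rightarrow> (nat \<Rightarrow> nat pmf) measure \<Rightarrow> bool" where
  "minus_law P x R \<longleftrightarrow>
     prob_space R \<and> sets R = sets env_seq \<and>
     (\<forall>n\<ge>1. \<forall>\<psi> \<in> borel_measurable (env_vec n). bounded (\<psi> ` space (env_vec n)) \<longrightarrow>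
        (\<integral>\<omega>. \<psi> (first_envs n \<omega>) \<partial>R) =
          1 / renewal_V P x * (\<integral>\<omega>. \<psi> (first_envs n \<omega>) * renewal_V P (walk x \<omega> n)
                             * indicator {\<omega>. walk_max x \<omega> n < 0} \<omega> \<partial>P))"


section \<open>Domain of attraction\<close>

definition nonlattice :: "real measure \<Rightarrow> bool" where
  "nonlattice D \<longleftrightarrow> (\<forall>a h. h > 0 \<longrightarrow> \<not> (AE y in D. \<exists>k::int. y = a + h * of_int k))"

definition slowly_varying :: "(real \<Rightarrow> real) \<Rightarrow> bool" where
  "slowly_varying l \<longleftrightarrow>
     l \<in> borel_measurable borel \<and> eventually (\<lambda>x. l x > 0) at_top \<and>
     (\<forall>r>0. ((\<lambda>x. l (r * x) / l x) \<longlongrightarrow> 1) at_top)"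

text \<open>A nondegenerate law is stable with index \<open>\<alpha>\<close> if the sum of \<open>n\<close> independent copies of \<open>Y\<close>
  is distributed as \<open>n\<^bsup>1/\<alpha>\<^esup> Y + d\<close> for some constant \<open>d\<close> depending on \<open>n\<close>.\<close>

definition stable_law :: "real \<Rightarrow> real measure \<Rightarrow> bool" where
  "stable_law \<alpha> \<mu> \<longleftrightarrow>
     real_distribution \<mu> \<and> \<not> (\<exists>a. AE y in \<mu>. y = a) \<and>
     (\<forall>n\<ge>1. \<exists>d. distr (\<Pi>\<^sub>M i\<in>{..<n}. \<mu>) borel (\<lambda>y. \<Sum>i<n. y i) =
                distr \<mu> borel (\<lambda>y. real n powr (1 / \<alpha>) * y + d))"

definition two_sided :: "real measure \<Rightarrow> bool" where
  "two_sided \<mu> \<longleftrightarrow> (\<forall>a. \<not> (AE y in \<mu>. y \<ge> a) \<and> \<not> (AE y in \<mu>. y \<le> a))"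

definition norming_seq :: "real \<Rightarrow> (nat \<Rightarrow> real) \<Rightarrow> bool" where
  "norming_seq \<alpha> c \<longleftrightarrow>
     mono_on {1..} c \<and> (\<forall>n\<ge>1. c n > 0) \<and>
     (\<exists>l. slowly_varying l \<and> (\<forall>n\<ge>1. c n = real n powr (1 / \<alpha>) * l (real n)))"

definition attracted_to_stable ::
    "(nat \<Rightarrow> nat pmf) measure \<Rightarrow> real \<Rightarrow> (nat \<Rightarrow> real) \<Rightarrow> bool" where
  "attracted_to_stable P \<alpha> c \<longleftrightarrow>
     norming_seq \<alpha> c \<and>
     (\<exists>\<mu>. stable_law \<alpha> \<mu> \<and> two_sided \<mu> \<and>
          weak_conv_m (\<lambda>n. distr P borel (\<lambda>\<omega>. walk 0 \<omega> n / c n)) \<mu>)"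


section \<open>The constant in the local limit asymptotics\<close>

definition asymptotic_constant ::
    "(nat \<Rightarrow> nat pmf) measure \<Rightarrow> (nat \<Rightarrow> real) \<Rightarrow> real \<Rightarrow> bool" where
  "asymptotic_constant P c K \<longleftrightarrow> K > 0 \<and>
     (\<forall>\<theta>>0.
        (\<forall>x\<ge>0.
          (\<lambda>n. \<integral>\<omega>. exp (- \<theta> * walk x \<omega> n) * indicator {\<omega>. walk_min x \<omega> n \<ge> 0} \<omega> \<partial>P)
            \<sim>[sequentially]
          (\<lambda>n. K / (real n * c n) * renewal_U P x * (LINT z:{..0}|lborel. exp (\<theta> * z) * renewal_V P z))) \<and>
        (\<lambda>n. \<integral>\<omega>. exp (\<theta> * walk 0 \<omega> n) * indicator {\<omega>. first_min 0 \<omega> n = n} \<omega> \<partial>P)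
            \<sim>[sequentially]
          (\<lambda>n. K / (real n * c n) * (LINT z:{0..}|lborel. exp (- \<theta> * z) * renewal_U P z)))"

end

theory Submission
  imports Defs
begin

text \<open>
  It suffices to bound the lower limit from below for every continuous \<open>\<phi> \<ge> 0\<close> dominated by
  \<open>C e\<^bsup>\<theta>z\<^esup>\<close>: applied to \<open>C e\<^bsup>\<theta>z\<^esup> + \<phi>\<close> and \<open>C e\<^bsup>\<theta>z\<^esup> - \<phi>\<close>, whose sum has a known limit, this gives
  convergence.

  For functionals of a fixed number \<open>\<rho>\<close> of environments at both ends, the lower bound follows from
  Fatou's lemma. Reverse time and condition on the last \<open>\<rho>\<close> environments; the remaining walk has to
  stay below a barrier \<open>y\<close>. Lowering the barrier to a level \<open>\<eta> \<in> (y - \<epsilon>, y)\<close> and averaging over \<open>\<eta>\<close> yields,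
  after the substitution \<open>z = \<eta> - S\<^sub>m\<close> and another time reversal, a walk started from Lebesgue measure
  on \<open>[0,\<infinity>)\<close>, staying nonnegative and ending in \<open>(y - \<epsilon>, y)\<close>. Its asymptotics are the assumed
  ones, in their vague form, which follows from the Laplace transforms by polynomial approximation.

  Passing from \<open>\<rho>\<close> to \<open>\<delta>n\<close> environments requires that the law of the first (or last) \<open>\<delta>n\<close> environments under the
  conditioning has bounded density with respect to the laws conditioned to stay nonnegative (or negative). This
  is the bound \<open>P(M\<^sub>m < y, y - S\<^sub>m \<in> [b, b + 1)) \<le> C V(-y) U(b + 1) / (m c\<^sub>m)\<close>, obtained by cutting the
  path into three blocks: decomposing at the extrema gives the renewal functions for the outer blocks
  and, from \<open>\<Sum>\<^sub>k P(M\<^sub>k < 0) P(L\<^bsub>n-k\<^esub> \<ge> 0) = 1\<close>, the factor \<open>1 / m\<close>; the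
  middle block contributes \<open>1 / c\<^sub>m\<close> through an estimate of its characteristic function.
\<close>

section \<open>Splitting and reversing the walk\<close>

definition rev_seq :: "nat \<Rightarrow> (nat \<Rightarrow> 'a) \<Rightarrow> nat \<Rightarrow> 'a" where
  "rev_seq n \<omega> = (\<lambda>i. if i < n then \<omega> (n - 1 - i) else \<omega> i)"

lemma walk_0 [simp]: "walk x \<omega> 0 = x"
  by (simp add: walk_def)

lemma walk_start: "walk x \<omega> n = x + walk 0 \<omega> n"
  by (simp add: walk_def)

lemma walk_Suc: "walk x \<omega> (Suc n) = walk x \<omega> n + log_mean (\<omega> n)"
  by (simp add: walk_def)

lemma walk_comb_seq_le: "k \<le> i \<Longrightarrow> walk x (comb_seq i \<omega> \<omega>') k = walk x \<omega> k"
  unfolding walk_def by (intro arg_cong2[where f="(+)"] sum.cong) (auto simp: comb_seq_def)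

lemma walk_comb_seq_add: "walk x (comb_seq i \<omega> \<omega>') (i + j) = walk x \<omega> i + walk 0 \<omega>' j"
proof (induction j)
  case 0
  then show ?case by (simp add: walk_comb_seq_le)
next
  case (Suc j)
  then show ?case by (simp add: walk_Suc comb_seq_def)
qed

lemma walk_rev_seq: "k \<le> n \<Longrightarrow> walk x (rev_seq n \<omega>) k = x + walk 0 \<omega> n - walk 0 \<omega> (n - k)"
proof (induction k)
  case (Suc k)
  then have "n - k = Suc (n - Suc k)" by auto
  with Suc show ?case by (simp add: walk_Suc rev_seq_def)
qed simp

lemma first_envs_comb_seq: "k \<le> i \<Longrightarrow> first_envs k (comb_seq i \<omega> \<omega>') = first_envs k \<omega>"
  by (auto simp: first_envs_def comb_seq_def restrict_def)

lemma first_envs_rev_seq: "k \<le> n \<Longrightarrow> first_envs k (rev_seq n \<omega>) = last_envs_rev n k \<omega>"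
  by (auto simp: first_envs_def last_envs_rev_def rev_seq_def restrict_def)

lemma last_envs_rev_rev_seq: "k \<le> n \<Longrightarrow> last_envs_rev n k (rev_seq n \<omega>) = first_envs k \<omega>"
  by (auto simp: first_envs_def last_envs_rev_def rev_seq_def restrict_def)

lemma last_envs_rev_comb_seq:
  "k \<le> j \<Longrightarrow> last_envs_rev (i + j) k (comb_seq i \<omega> \<omega>') = last_envs_rev j k \<omega>'"
  by (auto simp: last_envs_rev_def comb_seq_def restrict_def fun_eq_iff)

lemma walk_min_nonneg_iff: "walk_min x \<omega> n \<ge> 0 \<longleftrightarrow> (\<forall>i\<le>n. walk x \<omega> i \<ge> 0)"
  unfolding walk_min_def by (subst Min_ge_iff) auto

lemma walk_max_neg_iff: "n \<ge> 1 \<Longrightarrow> walk_max x \<omega> n < 0 \<longleftrightarrow> (\<forall>i\<in>{1..n}. walk x \<omega> i < 0)"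
  unfolding walk_max_def by (subst Max_less_iff) auto

lemma first_min_eq_iff: "first_min x \<omega> n = n \<longleftrightarrow> (\<forall>i<n. walk x \<omega> n < walk x \<omega> i)"
proof -
  let ?A = "{k \<in> {0..n}. walk x \<omega> k = walk_min x \<omega> n}"
  have fin: "finite ?A" by simp
  have "walk_min x \<omega> n \<in> walk x \<omega> ` {0..n}"
    unfolding walk_min_def by (rule Min_in) auto
  then have ne: "?A \<noteq> {}" by auto
  have le: "walk_min x \<omega> n \<le> walk x \<omega> i" if "i \<le> n" for i
    unfolding walk_min_def using that by (intro Min_le) auto
  show ?thesis
  proof
    assume *: "first_min x \<omega> n = n"
    have "n \<in> ?A" using Min_in[OF fin ne] * by (simp add: first_min_def)
    moreover have "i \<notin> ?A" if "i < n" for i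
      using Min_le[OF fin, of i] that * unfolding first_min_def by linarith
    ultimately show "\<forall>i<n. walk x \<omega> n < walk x \<omega> i"
      using le by (force simp: order_less_le)
  next
    assume *: "\<forall>i<n. walk x \<omega> n < walk x \<omega> i"
    have "?A \<subseteq> {n}"
    proof
      fix j assume "j \<in> ?A"
      then show "j \<in> {n}" using * le[of n] by (cases "j < n") force+
    qed
    with ne have "?A = {n}" by blast
    then show "first_min x \<omega> n = n" by (simp add: first_min_def)
  qed
qed

locale iid_env = sequence_space N for N :: "nat pmf measure" +
  assumes sets_N: "sets N = sets env"
    and log_mean_meas [measurable]: "log_mean \<in> borel_measurable N"
begin

abbreviation "P \<equiv> S"

lemma sets_P: "sets P = sets env_seq"
  unfolding env_seq_def by (intro sets_PiM_cong) (auto simp: sets_N)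

lemma space_N [simp]: "space N = UNIV"
  using sets_eq_imp_space_eq[OF sets_N] by (simp add: env_def space_measure_of_conv)

lemma space_P [simp]: "space P = UNIV"
  by (simp add: space_PiM)

lemma walk_meas [measurable]: "(\<lambda>\<omega>. walk x \<omega> n) \<in> borel_measurable P"
  unfolding walk_def by measurable

lemma walk_meas_pair [measurable]:
  "f \<in> borel_measurable M \<Longrightarrow> g \<in> measurable M P \<Longrightarrow> (\<lambda>a. walk (f a) (g a) n) \<in> borel_measurable M"
  using measurable_compose[OF _ walk_meas[of 0 n], of g M] by (subst walk_start) measurable

lemma sets_env_vec: "sets (env_vec k) = sets (PiM {..<k} (\<lambda>_. N))"
  unfolding env_vec_def by (intro sets_PiM_cong) (auto simp: sets_N)

lemma first_envs_meas [measurable]: "first_envs k \<in> measurable P (env_vec k)"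
proof -
  have "(\<lambda>\<omega>. \<lambda>i\<in>{..<k}. \<omega> i) \<in> measurable P (PiM {..<k} (\<lambda>_. N))"
    by measurable
  then show ?thesis
    unfolding first_envs_def[abs_def]
    by (subst measurable_cong_sets[OF refl sets_env_vec])
qed

lemma last_envs_rev_meas [measurable]: "last_envs_rev n k \<in> measurable P (env_vec k)"
proof -
  have "(\<lambda>\<omega>. \<lambda>i\<in>{..<k}. \<omega> (n - 1 - i)) \<in> measurable P (PiM {..<k} (\<lambda>_. N))"
    by measurable
  then show ?thesis
    unfolding last_envs_rev_def[abs_def]
    by (subst measurable_cong_sets[OF refl sets_env_vec])
qed

lemma rev_seq_meas [measurable]: "rev_seq n \<in> measurable P P"
  unfolding rev_seq_def[abs_def] by (rule measurable_PiM_single') auto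

lemma distr_rev_seq: "distr P P (rev_seq n) = P"
proof -
  define f where "f i = (if i < n then n - 1 - i else i)" for i
  have "distr P (PiM UNIV (\<lambda>i. N)) (\<lambda>\<omega>. \<lambda>i\<in>UNIV. \<omega> (f i)) = PiM UNIV (\<lambda>i. N)"
    by (rule distr_PiM_reindex[of UNIV "\<lambda>_. N" f UNIV])
       (auto simp: inj_on_def f_def M.prob_space_axioms split: if_splits)
  moreover have "(rev_seq n :: (nat \<Rightarrow> nat pmf) \<Rightarrow> _) = (\<lambda>\<omega>. \<lambda>i\<in>UNIV. \<omega> (f i))"
    by (auto simp: rev_seq_def fun_eq_iff f_def)
  ultimately show ?thesis by simp
qed

lemma nn_integral_rev_seq:
  assumes [measurable]: "f \<in> borel_measurable P"
  shows "(\<integral>\<^sup>+\<omega>. f (rev_seq n \<omega>) \<partial>P) = (\<integral>\<^sup>+\<omega>. f \<omega> \<partial>P)"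
  by (subst (2) distr_rev_seq[of n, symmetric], subst nn_integral_distr) auto

lemma nn_integral_split:
  assumes [measurable]: "f \<in> borel_measurable P"
  shows "(\<integral>\<^sup>+\<omega>. f \<omega> \<partial>P) = (\<integral>\<^sup>+\<omega>. (\<integral>\<^sup>+\<omega>'. f (comb_seq i \<omega> \<omega>') \<partial>P) \<partial>P)"
proof -
  have "(\<integral>\<^sup>+\<omega>. f \<omega> \<partial>P) = (\<integral>\<^sup>+p. f (case p of (\<omega>, \<omega>') \<Rightarrow> comb_seq i \<omega> \<omega>') \<partial>(P \<Otimes>\<^sub>M P))"
    by (subst PiM_comb_seq[of i, symmetric], subst nn_integral_distr) (auto simp: measurable_comb_seq)
  also have "\<dots> = (\<integral>\<^sup>+\<omega>. (\<integral>\<^sup>+\<omega>'. f (comb_seq i \<omega> \<omega>') \<partial>P) \<partial>P)"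
    by (subst P.nn_integral_fst[symmetric]) (auto simp: split_beta' measurable_comb_seq)
  finally show ?thesis .
qed

lemma nn_integral_prob_eq: 
  assumes [measurable]: "Measurable.pred P A"
  shows "(\<integral>\<^sup>+\<omega>. (if A \<omega> then 1 else 0) \<partial>P) = ennreal (measure P {\<omega>. A \<omega>})"
proof -
  have [measurable]: "{\<omega>. A \<omega>} \<in> sets P" using assms by (simp add: pred_def)
  have "(\<integral>\<^sup>+\<omega>. (if A \<omega> then 1 else 0) \<partial>P) = (\<integral>\<^sup>+\<omega>. indicator {\<omega>. A \<omega>} \<omega> \<partial>P)"
    by (intro nn_integral_cong) (auto simp: indicator_def)
  also have "\<dots> = emeasure P {\<omega>. A \<omega>}" by (rule nn_integral_indicator) measurable
  finally show ?thesis by (simp add: P.emeasure_eq_measure)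
qed

end

section \<open>Decomposition at extrema\<close>

lemma record_exists:
  fixes s :: "nat \<Rightarrow> real"
  assumes R: "\<And>a b. R a \<Longrightarrow> R b \<Longrightarrow> R (a + b)"
    and nR: "\<And>a b. \<not> R a \<Longrightarrow> \<not> R b \<Longrightarrow> \<not> R (a + b)"
  shows "\<exists>k\<le>n. (\<forall>i<k. R (s k - s i)) \<and> (\<forall>i\<in>{k<..n}. \<not> R (s i - s k))"
proof (induction n)
  case (Suc n)
  then obtain k where k: "k \<le> n" "\<forall>i<k. R (s k - s i)" "\<forall>i\<in>{k<..n}. \<not> R (s i - s k)"
    by blast
  show ?case
  proof (cases "R (s (Suc n) - s k)")
    case True
    have "R (s (Suc n) - s i)" if "i < Suc n" for i
    proof -
      have "i < k \<or> i = k \<or> i \<in> {k<..n}" using that by auto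
      then consider "i < k" | "i = k" | "i \<in> {k<..n}" by blast
      then show ?thesis
      proof cases
        case 1
        then show ?thesis using R[OF True, of "s k - s i"] k by auto
      next
        case 3
        then show ?thesis using nR[of "s (Suc n) - s i" "s i - s k"] k True by auto
      qed (use True in simp)
    qed
    then show ?thesis by (intro exI[of _ "Suc n"]) auto
  next
    case False
    then show ?thesis using k by (intro exI[of _ k]) (auto simp: le_Suc_eq)
  qed
qed auto

context iid_env
begin

lemma pred_sets: "Measurable.pred P A \<Longrightarrow> {\<omega>. A \<omega>} \<in> sets P"
  by (simp add: pred_def)

lemma prob_split_eq:
  assumes [measurable]: "Measurable.pred P A" "Measurable.pred P B" "Measurable.pred P C"
    and iff: "\<And>\<omega> \<omega>'. C (comb_seq i \<omega> \<omega>') \<longleftrightarrow> A \<omega> \<and> B \<omega>'"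
  shows "measure P {\<omega>. C \<omega>} = measure P {\<omega>. A \<omega>} * measure P {\<omega>. B \<omega>}"
proof -
  have "ennreal (measure P {\<omega>. C \<omega>}) = (\<integral>\<^sup>+\<omega>. (if C \<omega> then 1 else 0) \<partial>P)"
    by (simp add: nn_integral_prob_eq)
  also have "\<dots> = (\<integral>\<^sup>+\<omega>. (\<integral>\<^sup>+\<omega>'. (if C (comb_seq i \<omega> \<omega>') then 1 else 0) \<partial>P) \<partial>P)"
    by (rule nn_integral_split) measurable
  also have "\<dots> = (\<integral>\<^sup>+\<omega>. (\<integral>\<^sup>+\<omega>'. (if A \<omega> then 1 else 0) * (if B \<omega>' then 1 else 0) \<partial>P) \<partial>P)"
    by (intro nn_integral_cong) (auto simp: iff)
  also have "\<dots> = (\<integral>\<^sup>+\<omega>. (if A \<omega> then 1 else 0) * ennreal (measure P {\<omega>. B \<omega>}) \<partial>P)"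
    by (subst nn_integral_cmult) (auto simp: nn_integral_prob_eq)
  also have "\<dots> = ennreal (measure P {\<omega>. A \<omega>}) * ennreal (measure P {\<omega>. B \<omega>})"
    by (subst nn_integral_multc) (auto simp: nn_integral_prob_eq)
  finally show ?thesis by (simp add: ennreal_mult[symmetric])
qed

lemma prob_split_le:
  assumes [measurable]: "Measurable.pred P A" "Measurable.pred P B" "Measurable.pred P C"
    and imp: "\<And>\<omega> \<omega>'. A \<omega> \<Longrightarrow> B \<omega>' \<Longrightarrow> C (comb_seq i \<omega> \<omega>')"
  shows "measure P {\<omega>. A \<omega>} * measure P {\<omega>. B \<omega>} \<le> measure P {\<omega>. C \<omega>}"
proof -
  have "ennreal (measure P {\<omega>. A \<omega>}) * ennreal (measure P {\<omega>. B \<omega>}) 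
    = (\<integral>\<^sup>+\<omega>. (if A \<omega> then 1 else 0) * ennreal (measure P {\<omega>. B \<omega>}) \<partial>P)"
    by (subst nn_integral_multc) (auto simp: nn_integral_prob_eq)
  also have "\<dots> = (\<integral>\<^sup>+\<omega>. (\<integral>\<^sup>+\<omega>'. (if A \<omega> then 1 else 0) * (if B \<omega>' then 1 else 0) \<partial>P) \<partial>P)"
    by (subst nn_integral_cmult) (auto simp: nn_integral_prob_eq)
  also have "\<dots> \<le> (\<integral>\<^sup>+\<omega>. (\<integral>\<^sup>+\<omega>'. (if C (comb_seq i \<omega> \<omega>') then 1 else 0) \<partial>P) \<partial>P)"
    by (intro nn_integral_mono) (auto simp: imp)
  also have "\<dots> = (\<integral>\<^sup>+\<omega>. (if C \<omega> then 1 else 0) \<partial>P)"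
    by (rule nn_integral_split[symmetric]) measurable
  also have "\<dots> = ennreal (measure P {\<omega>. C \<omega>})"
    by (simp add: nn_integral_prob_eq)
  finally show ?thesis by (simp add: ennreal_mult[symmetric])
qed

lemma prob_rev_seq:
  assumes [measurable]: "Measurable.pred P A"
  shows "measure P {\<omega>. A (rev_seq n \<omega>)} = measure P {\<omega>. A \<omega>}"
proof -
  have "ennreal (measure P {\<omega>. A (rev_seq n \<omega>)}) = ennreal (measure P {\<omega>. A \<omega>})"
    using nn_integral_rev_seq[of "\<lambda>\<omega>. if A \<omega> then 1 else 0" n] by (simp add: nn_integral_prob_eq)
  then show ?thesis by simp
qed

text \<open>Decomposition at the moment of the first minimum (\<open>R\<close> is \<open>< 0\<close>) or of the last
  maximum (\<open>R\<close> is \<open>\<ge> 0\<close>); the part before that moment is read backwards.\<close>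

lemma record_decomposition:
  fixes R B :: "real \<Rightarrow> bool"
  assumes R: "\<And>a b. R a \<Longrightarrow> R b \<Longrightarrow> R (a + b)"
    and nR: "\<And>a b. \<not> R a \<Longrightarrow> \<not> R b \<Longrightarrow> \<not> R (a + b)"
    and [measurable]: "Measurable.pred borel R" "Measurable.pred borel B"
  shows "(\<Sum>k\<le>n. measure P {\<omega>. B (walk 0 \<omega> k) \<and> (\<forall>i\<in>{1..k}. R (walk 0 \<omega> i))}
            * measure P {\<omega>. \<forall>i\<in>{1..n-k}. \<not> R (walk 0 \<omega> i)})
       = measure P {\<omega>. \<exists>k\<le>n. (\<forall>i<k. R (walk 0 \<omega> k - walk 0 \<omega> i))
            \<and> (\<forall>i\<in>{k<..n}. \<not> R (walk 0 \<omega> i - walk 0 \<omega> k)) \<and> B (walk 0 \<omega> k)}"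
proof -
  define E where "E k = {\<omega>. (\<forall>i<k. R (walk 0 \<omega> k - walk 0 \<omega> i))
            \<and> (\<forall>i\<in>{k<..n}. \<not> R (walk 0 \<omega> i - walk 0 \<omega> k)) \<and> B (walk 0 \<omega> k)}" for k
  have E_sets: "E k \<in> sets P" for k
    unfolding E_def by (intro pred_sets) measurable
  have disj: "disjoint_family_on E {..n}"
  proof (unfold disjoint_family_on_def, intro ballI impI)
    have *: False if "k < l" "l \<le> n" "\<omega> \<in> E k" "\<omega> \<in> E l" for k l \<omega>
      using that by (auto simp: E_def)
    show "E k \<inter> E l = {}" if "k \<in> {..n}" "l \<in> {..n}" "k \<noteq> l" for k l
      using that *[of k l] *[of l k] by (cases k l rule: linorder_cases) auto
  qed
  have E: "measure P (E k) = measure P {\<omega>. B (walk 0 \<omega> k) \<and> (\<forall>i\<in>{1..k}. R (walk 0 \<omega> i))}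
            * measure P {\<omega>. \<forall>i\<in>{1..n-k}. \<not> R (walk 0 \<omega> i)}" if k: "k \<le> n" for k
  proof -
    have "measure P {\<omega>. B (walk 0 (rev_seq k \<omega>) k) \<and> (\<forall>i\<in>{1..k}. R (walk 0 (rev_seq k \<omega>) i))}
       = measure P {\<omega>. B (walk 0 \<omega> k) \<and> (\<forall>i\<in>{1..k}. R (walk 0 \<omega> i))}"
      by (rule prob_rev_seq) measurable
    moreover have "(B (walk 0 (rev_seq k \<omega>) k) \<and> (\<forall>i\<in>{1..k}. R (walk 0 (rev_seq k \<omega>) i)))
       \<longleftrightarrow> (\<forall>i<k. R (walk 0 \<omega> k - walk 0 \<omega> i)) \<and> B (walk 0 \<omega> k)" (is "?l \<longleftrightarrow> ?r") for \<omega>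
    proof -
      have "(\<forall>i\<in>{1..k}. R (walk 0 \<omega> k - walk 0 \<omega> (k - i))) \<longleftrightarrow> (\<forall>i<k. R (walk 0 \<omega> k - walk 0 \<omega> i))"
      proof safe
        fix i assume *: "\<forall>i\<in>{1..k}. R (walk 0 \<omega> k - walk 0 \<omega> (k - i))" and "i < k"
        then show "R (walk 0 \<omega> k - walk 0 \<omega> i)"
          using *[THEN bspec, of "k - i"] by simp
      qed auto
      then show ?thesis by (auto simp: walk_rev_seq)
    qed
    moreover have "measure P (E k) = measure P {\<omega>. (\<forall>i<k. R (walk 0 \<omega> k - walk 0 \<omega> i)) \<and> B (walk 0 \<omega> k)}
       * measure P {\<omega>. \<forall>i\<in>{1..n-k}. \<not> R (walk 0 \<omega> i)}"
      unfolding E_def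
    proof (rule prob_split_eq[where i=k])
      fix \<omega> \<omega>' :: "nat \<Rightarrow> nat pmf"
      have "(\<forall>i\<in>{k<..n}. \<not> R (walk 0 (comb_seq k \<omega> \<omega>') i - walk 0 \<omega> k))
        \<longleftrightarrow> (\<forall>i\<in>{1..n-k}. \<not> R (walk 0 \<omega>' i))" (is "?l \<longleftrightarrow> ?r")
      proof
        assume l: ?l
        show ?r
        proof
          fix i assume "i \<in> {1..n-k}"
          then have "k + i \<in> {k<..n}" using k by auto
          from l[THEN bspec, OF this] show "\<not> R (walk 0 \<omega>' i)"
            by (simp add: walk_comb_seq_add)
        qed
      next
        assume r: ?r
        show ?l
        proof
          fix i assume "i \<in> {k<..n}"
          then have "i = k + (i - k)" "i - k \<in> {1..n-k}" by auto
          then show "\<not> R (walk 0 (comb_seq k \<omega> \<omega>') i - walk 0 \<omega> k)"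
            using r walk_comb_seq_add[of 0 k \<omega> \<omega>' "i - k"] by auto
        qed
      qed
      then show "((\<forall>i<k. R (walk 0 (comb_seq k \<omega> \<omega>') k - walk 0 (comb_seq k \<omega> \<omega>') i)) \<and>
        (\<forall>i\<in>{k<..n}. \<not> R (walk 0 (comb_seq k \<omega> \<omega>') i - walk 0 (comb_seq k \<omega> \<omega>') k)) \<and> B (walk 0 (comb_seq k \<omega> \<omega>') k))
        \<longleftrightarrow> ((\<forall>i<k. R (walk 0 \<omega> k - walk 0 \<omega> i)) \<and> B (walk 0 \<omega> k)) \<and> (\<forall>i\<in>{1..n-k}. \<not> R (walk 0 \<omega>' i))"
        by (auto simp: walk_comb_seq_le)
    qed measurable
    ultimately show ?thesis by simp
  qed
  have "(\<Sum>k\<le>n. measure P (E k)) = measure P (\<Union>k\<in>{..n}. E k)"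
    by (rule P.finite_measure_finite_Union[symmetric]) (use E_sets disj in auto)
  also have "(\<Union>k\<in>{..n}. E k) = {\<omega>. \<exists>k\<le>n. (\<forall>i<k. R (walk 0 \<omega> k - walk 0 \<omega> i))
            \<and> (\<forall>i\<in>{k<..n}. \<not> R (walk 0 \<omega> i - walk 0 \<omega> k)) \<and> B (walk 0 \<omega> k)}"
    by (auto simp: E_def)
  finally show ?thesis using E by simp
qed

definition stay_nonneg :: "real \<Rightarrow> nat \<Rightarrow> real" where
  "stay_nonneg x n = measure P {\<omega>. \<forall>i\<in>{1..n}. walk x \<omega> i \<ge> 0}"

definition stay_neg :: "real \<Rightarrow> nat \<Rightarrow> real" where
  "stay_neg x n = measure P {\<omega>. \<forall>i\<in>{1..n}. walk x \<omega> i < 0}"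

definition U_term :: "real \<Rightarrow> nat \<Rightarrow> real" where
  "U_term x k = measure P {\<omega>. walk 0 \<omega> k \<ge> - x \<and> (\<forall>i\<in>{1..k}. walk 0 \<omega> i < 0)}"

definition V_term :: "real \<Rightarrow> nat \<Rightarrow> real" where
  "V_term x k = measure P {\<omega>. walk 0 \<omega> k < - x \<and> (\<forall>i\<in>{1..k}. walk 0 \<omega> i \<ge> 0)}"

lemma stay_nonneg_decomposition:
  assumes "x \<ge> 0"
  shows "(\<Sum>k\<le>n. U_term x k * stay_nonneg 0 (n - k)) = stay_nonneg x n"
proof -
  have "(\<exists>k\<le>n. (\<forall>i<k. walk 0 \<omega> k - walk 0 \<omega> i < 0) \<and> (\<forall>i\<in>{k<..n}. \<not> walk 0 \<omega> i - walk 0 \<omega> k < 0)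
         \<and> walk 0 \<omega> k \<ge> - x) \<longleftrightarrow> (\<forall>i\<in>{1..n}. walk x \<omega> i \<ge> 0)" (is "?l \<longleftrightarrow> ?r") for \<omega>
  proof
    assume ?l
    then obtain k where k: "k \<le> n" "\<forall>i<k. walk 0 \<omega> k - walk 0 \<omega> i < 0"
      "\<forall>i\<in>{k<..n}. \<not> walk 0 \<omega> i - walk 0 \<omega> k < 0" "walk 0 \<omega> k \<ge> - x" by blast
    have "walk 0 \<omega> i \<ge> walk 0 \<omega> k" if "i \<le> n" for i
      using k(2)[rule_format, of i] k(3)[rule_format, of i] that by (cases i k rule: linorder_cases) auto
    then have "walk x \<omega> i \<ge> 0" if "i \<le> n" for i
      using k(4) that walk_start[of x \<omega> i] by (smt (verit))
    then show ?r by simp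
  next
    assume ?r
    moreover obtain k where k: "k \<le> n" "\<forall>i<k. walk 0 \<omega> k - walk 0 \<omega> i < 0"
      "\<forall>i\<in>{k<..n}. \<not> walk 0 \<omega> i - walk 0 \<omega> k < 0" 
      using record_exists[of "\<lambda>d. d < 0" n "walk 0 \<omega>"] by auto
    moreover have "walk 0 \<omega> k \<ge> - x"
    proof (cases "k = 0")
      case False
      with \<open>?r\<close> k(1) have "0 \<le> walk x \<omega> k" by auto
      then show ?thesis by (simp add: walk_start[of x])
    qed (use assms in simp)
    ultimately show ?l by blast
  qed
  then show ?thesis
    using record_decomposition[of "\<lambda>d. d < 0" "\<lambda>s. s \<ge> - x" n]
    by (simp add: U_term_def stay_nonneg_def not_less)
qed

lemma stay_neg_decomposition:
  assumes "x < 0"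
  shows "(\<Sum>k\<le>n. V_term x k * stay_neg 0 (n - k)) = stay_neg x n"
proof -
  have "(\<exists>k\<le>n. (\<forall>i<k. walk 0 \<omega> k - walk 0 \<omega> i \<ge> 0) \<and> (\<forall>i\<in>{k<..n}. \<not> walk 0 \<omega> i - walk 0 \<omega> k \<ge> 0)
         \<and> walk 0 \<omega> k < - x) \<longleftrightarrow> (\<forall>i\<in>{1..n}. walk x \<omega> i < 0)" (is "?l \<longleftrightarrow> ?r") for \<omega>
  proof
    assume ?l
    then obtain k where k: "k \<le> n" "\<forall>i<k. walk 0 \<omega> k - walk 0 \<omega> i \<ge> 0"
      "\<forall>i\<in>{k<..n}. \<not> walk 0 \<omega> i - walk 0 \<omega> k \<ge> 0" "walk 0 \<omega> k < - x" by blast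
    have "walk 0 \<omega> i \<le> walk 0 \<omega> k" if "i \<le> n" for i
      using k(2)[rule_format, of i] k(3)[rule_format, of i] that by (cases i k rule: linorder_cases) auto
    then have "walk x \<omega> i < 0" if "i \<le> n" for i
      using k(4) that walk_start[of x \<omega> i] by (smt (verit))
    then show ?r by simp
  next
    assume ?r
    moreover obtain k where k: "k \<le> n" "\<forall>i<k. walk 0 \<omega> k - walk 0 \<omega> i \<ge> 0"
      "\<forall>i\<in>{k<..n}. \<not> walk 0 \<omega> i - walk 0 \<omega> k \<ge> 0" 
      using record_exists[of "\<lambda>d. d \<ge> 0" n "walk 0 \<omega>"] by auto
    moreover have "walk 0 \<omega> k < - x"
    proof (cases "k = 0")
      case False
      with \<open>?r\<close> k(1) have "walk x \<omega> k < 0" by auto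
      then show ?thesis by (simp add: walk_start[of x])
    qed (use assms in simp)
    ultimately show ?l by blast
  qed
  then show ?thesis
    using record_decomposition[of "\<lambda>d. d \<ge> 0" "\<lambda>s. s < - x" n]
    by (simp add: V_term_def stay_neg_def not_le)
qed

lemma first_min_decomposition: "(\<Sum>k\<le>n. stay_neg 0 k * stay_nonneg 0 (n - k)) = 1"
proof -
  have "\<exists>k\<le>n. (\<forall>i<k. walk 0 \<omega> k < walk 0 \<omega> i) \<and> (\<forall>i\<in>{k<..n}. walk 0 \<omega> k \<le> walk 0 \<omega> i)" for \<omega>
    using record_exists[of "\<lambda>d. d < 0" n "walk 0 \<omega>"] by (auto simp: not_less)
  then show ?thesis
    using record_decomposition[of "\<lambda>d. d < 0" "\<lambda>s. True" n] P.prob_space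
    by (simp add: stay_neg_def stay_nonneg_def not_less)
qed

lemma stay_nonneg_antimono: "m \<le> n \<Longrightarrow> stay_nonneg x n \<le> stay_nonneg x m"
  unfolding stay_nonneg_def by (rule P.finite_measure_mono) (auto intro!: pred_sets, measurable)

lemma stay_neg_antimono: "m \<le> n \<Longrightarrow> stay_neg x n \<le> stay_neg x m"
  unfolding stay_neg_def by (rule P.finite_measure_mono) (auto intro!: pred_sets, measurable)

lemma sum_stay_mult_le:
  "(\<Sum>i\<le>n. stay_neg 0 i) * (\<Sum>j\<le>n. stay_nonneg 0 j) \<le> 2 * real n + 1"
proof -
  have "(\<Sum>i\<le>n. stay_neg 0 i) * (\<Sum>j\<le>n. stay_nonneg 0 j)
     = (\<Sum>(i,j)\<in>{..n}\<times>{..n}. stay_neg 0 i * stay_nonneg 0 j)"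
    by (simp add: sum_product sum.cartesian_product)
  also have "\<dots> \<le> (\<Sum>(i,j)\<in>{(i,j). i + j \<le> 2 * n}. stay_neg 0 i * stay_nonneg 0 j)"
  proof (rule sum_mono2)
    show "finite {(i, j). i + j \<le> 2 * n}"
      by (rule finite_subset[of _ "{..2*n} \<times> {..2*n}"]) auto
  qed (auto simp: stay_neg_def stay_nonneg_def)
  also have "\<dots> = (\<Sum>k\<le>2*n. \<Sum>i\<le>k. stay_neg 0 i * stay_nonneg 0 (k - i))"
    by (rule sum.triangle_reindex_eq)
  also have "\<dots> = 2 * real n + 1"
    by (simp add: first_min_decomposition)
  finally show ?thesis .
qed

lemma convolution_average_bound:
  fixes a p r :: "nat \<Rightarrow> real"
  assumes conv: "\<And>m. m \<le> n \<Longrightarrow> (\<Sum>k\<le>m. a k * p (m - k)) = r m"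
    and "\<And>m. m \<le> n \<Longrightarrow> r n \<le> r m" "\<And>k. 0 \<le> a k" "\<And>k. 0 \<le> p k"
  shows "(real n + 1) * r n \<le> (\<Sum>k\<le>n. a k) * (\<Sum>j\<le>n. p j)"
proof -
  have "(real n + 1) * r n = (\<Sum>m\<le>n. r n)" by simp
  also have "\<dots> \<le> (\<Sum>m\<le>n. r m)" using assms by (intro sum_mono) auto
  also have "\<dots> = (\<Sum>m\<le>n. \<Sum>k\<le>m. a k * p (m - k))" using conv by simp
  also have "\<dots> = (\<Sum>(i,j)\<in>{(i,j). i + j \<le> n}. a i * p j)"
    by (rule sum.triangle_reindex_eq[symmetric])
  also have "\<dots> \<le> (\<Sum>(i,j)\<in>{..n}\<times>{..n}. a i * p j)"
    by (rule sum_mono2) (use assms in auto)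
  also have "\<dots> = (\<Sum>k\<le>n. a k) * (\<Sum>j\<le>n. p j)"
    by (simp add: sum_product sum.cartesian_product)
  finally show ?thesis .
qed

end

locale oscillating_env = iid_env +
  assumes pos: "measure N {p. log_mean p > 0} > 0"
    and neg: "measure N {p. log_mean p < 0} > 0"
begin

lemma prob_all_first:
  assumes "A \<in> sets N"
  shows "measure P {\<omega>. \<forall>i<m. \<omega> i \<in> A} = measure N A ^ m"
proof -
  have "{\<omega>. \<forall>i<m. \<omega> i \<in> A} = prod_emb UNIV (\<lambda>_. N) {..<m} (PiE {..<m} (\<lambda>_. A))"
    by (auto simp: prod_emb_def PiE_def Pi_def)
  then show ?thesis using assms by (simp add: measure_PiM_emb)
qed

lemma jump_up: "\<exists>e>0. measure N {p. log_mean p \<ge> e} > 0"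
proof (rule ccontr)
  assume "\<not> ?thesis"
  then have *: "measure N {p. log_mean p \<ge> e} = 0" if "e > 0" for e
    using that by (metis zero_less_measure_iff)
  have "emeasure N (\<Union>n. {p. log_mean p \<ge> 1 / Suc n}) = 0"
  proof (rule emeasure_UN_eq_0)
    show "emeasure N {p. log_mean p \<ge> 1 / Suc n} = 0" for n
      using *[of "1 / Suc n"] by (simp add: M.emeasure_eq_measure)
    have "{p \<in> space N. log_mean p \<ge> 1 / Suc n} \<in> sets N" for n by measurable
    then show "range (\<lambda>n. {p. log_mean p \<ge> 1 / Suc n}) \<subseteq> sets N" by auto
  qed
  also have "(\<Union>n. {p. log_mean p \<ge> 1 / Suc n}) = {p. log_mean p > 0}"
  proof safe
    fix p assume "0 < log_mean p"
    then obtain n where "inverse (real (Suc n)) < log_mean p" using reals_Archimedean by blast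
    then show "p \<in> (\<Union>n. {p. log_mean p \<ge> 1 / Suc n})" by (auto simp: inverse_eq_divide intro!: exI[of _ n])
  qed (auto intro: less_le_trans[rotated])
  finally show False using pos by (simp add: M.emeasure_eq_measure)
qed

lemma jump_down: "\<exists>e>0. measure N {p. log_mean p \<le> - e} > 0"
proof (rule ccontr)
  assume "\<not> ?thesis"
  then have *: "measure N {p. log_mean p \<le> - e} = 0" if "e > 0" for e
    using that by (metis zero_less_measure_iff)
  have "emeasure N (\<Union>n. {p. log_mean p \<le> - (1 / Suc n)}) = 0"
  proof (rule emeasure_UN_eq_0)
    show "emeasure N {p. log_mean p \<le> - (1 / Suc n)} = 0" for n
      using *[of "1 / Suc n"] by (simp add: M.emeasure_eq_measure)
    have "{p \<in> space N. log_mean p \<le> - (1 / Suc n)} \<in> sets N" for n by measurable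
    then show "range (\<lambda>n. {p. log_mean p \<le> - (1 / Suc n)}) \<subseteq> sets N" by auto
  qed
  also have "(\<Union>n. {p. log_mean p \<le> - (1 / Suc n)}) = {p. log_mean p < 0}"
  proof safe
    fix p assume "log_mean p < 0"
    then obtain n where "inverse (real (Suc n)) < - log_mean p" using reals_Archimedean[of "- log_mean p"] by auto
    then show "p \<in> (\<Union>n. {p. log_mean p \<le> - (1 / Suc n)})" by (auto simp: inverse_eq_divide intro!: exI[of _ n])
  next
    fix p n assume "log_mean p \<le> - (1 / Suc n)"
    moreover have "- (1 / real (Suc n)) < 0" by simp
    ultimately show "log_mean p < 0" by linarith
  qed
  finally show False using neg by (simp add: M.emeasure_eq_measure)
qed

lemma climb:
  "\<exists>m \<eta>. \<eta> > 0 \<and> (\<forall>n. \<eta> * stay_nonneg x n \<le> stay_nonneg 0 (m + n))"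
proof -
  obtain e where e: "e > 0" "measure N {p. log_mean p \<ge> e} > 0" using jump_up by blast
  obtain m :: nat where m: "x \<le> m * e" using ex_less_of_nat_mult[OF e(1), of x] by (auto intro: less_imp_le)
  let ?A = "{p. log_mean p \<ge> e}"
  have "{p \<in> space N. log_mean p \<ge> e} \<in> sets N" by measurable
  then have A[measurable]: "?A \<in> sets N" by simp
  have up: "walk 0 \<omega> j \<ge> j * e" if "\<forall>i<m. \<omega> i \<in> ?A" "j \<le> m" for \<omega> j
  proof -
    have "(\<Sum>i<j. e) \<le> (\<Sum>i<j. log_mean (\<omega> i))" using that by (intro sum_mono) auto
    then show ?thesis by (simp add: walk_def)
  qed
  have "measure N ?A ^ m * stay_nonneg x n \<le> stay_nonneg 0 (m + n)" for n
    unfolding prob_all_first[OF A, symmetric] stay_nonneg_def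
  proof (rule prob_split_le[where i=m])
    fix \<omega> \<omega>' assume *: "\<forall>i<m. \<omega> i \<in> ?A" "\<forall>i\<in>{1..n}. 0 \<le> walk x \<omega>' i"
    show "\<forall>i\<in>{1..m + n}. 0 \<le> walk 0 (comb_seq m \<omega> \<omega>') i"
    proof
      fix i assume i: "i \<in> {1..m+n}"
      show "0 \<le> walk 0 (comb_seq m \<omega> \<omega>') i"
      proof (cases "i \<le> m")
        case True
        then have "walk 0 \<omega> i \<ge> i * e" using up * by blast
        moreover have "i * e \<ge> 0" using e by simp
        ultimately show ?thesis using True by (simp add: walk_comb_seq_le)
      next
        case False
        then obtain j where j: "i = m + j" "j \<in> {1..n}" using i by (intro that[of "i - m"]) auto
        have "walk 0 \<omega> m \<ge> x" using up[OF *(1), of m] m by simp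
        moreover have "0 \<le> walk x \<omega>' j" using *(2) j by blast
        ultimately show ?thesis by (simp add: j walk_comb_seq_add walk_start[of x])
      qed
    qed
  qed measurable
  then show ?thesis using e(2) by (intro exI[of _ m] exI[of _ "measure N ?A ^ m"]) auto
qed

lemma descend:
  "\<exists>m \<eta>. \<eta> > 0 \<and> (\<forall>n. \<eta> * stay_neg x n \<le> stay_neg 0 (m + n))"
proof -
  obtain e where e: "e > 0" "measure N {p. log_mean p \<le> - e} > 0" using jump_down by blast
  obtain m :: nat where m: "- x \<le> m * e" using ex_less_of_nat_mult[OF e(1), of "- x"] by (auto intro: less_imp_le)
  let ?A = "{p. log_mean p \<le> - e}"
  have "{p \<in> space N. log_mean p \<le> - e} \<in> sets N" by measurable
  then have A[measurable]: "?A \<in> sets N" by simp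
  have up: "walk 0 \<omega> j \<le> - (j * e)" if "\<forall>i<m. \<omega> i \<in> ?A" "j \<le> m" for \<omega> j
  proof -
    have "(\<Sum>i<j. - e) \<ge> (\<Sum>i<j. log_mean (\<omega> i))" using that by (intro sum_mono) auto
    then show ?thesis by (simp add: walk_def)
  qed
  have "measure N ?A ^ m * stay_neg x n \<le> stay_neg 0 (m + n)" for n
    unfolding prob_all_first[OF A, symmetric] stay_neg_def
  proof (rule prob_split_le[where i=m])
    fix \<omega> \<omega>' assume *: "\<forall>i<m. \<omega> i \<in> ?A" "\<forall>i\<in>{1..n}. walk x \<omega>' i < 0"
    show "\<forall>i\<in>{1..m + n}. walk 0 (comb_seq m \<omega> \<omega>') i < 0"
    proof
      fix i assume i: "i \<in> {1..m+n}"
      show "walk 0 (comb_seq m \<omega> \<omega>') i < 0"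
      proof (cases "i \<le> m")
        case True
        then have "walk 0 \<omega> i \<le> - (i * e)" using up * by blast
        moreover have "i * e > 0" using e i by simp
        ultimately show ?thesis using True by (simp add: walk_comb_seq_le)
      next
        case False
        then obtain j where j: "i = m + j" "j \<in> {1..n}" using i by (intro that[of "i - m"]) auto
        have "walk 0 \<omega> m \<le> x" using up[OF *(1), of m] m by simp
        moreover have "walk x \<omega>' j < 0" using *(2) j by blast
        ultimately show ?thesis by (simp add: j walk_comb_seq_add walk_start[of x])
      qed
    qed
  qed measurable
  then show ?thesis using e(2) by (intro exI[of _ m] exI[of _ "measure N ?A ^ m"]) auto
qed

lemma stay_nonneg_pos: "stay_nonneg 0 n > 0"
proof -
  obtain e where e: "e > 0" "measure N {p. log_mean p \<ge> e} > 0" using jump_up by blast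
  let ?A = "{p. log_mean p \<ge> e}"
  have "{p \<in> space N. log_mean p \<ge> e} \<in> sets N" by measurable
  then have A[measurable]: "?A \<in> sets N" by simp
  have "0 < measure P {\<omega>. \<forall>i<n. \<omega> i \<in> ?A}" using prob_all_first[OF A, of n] e by simp
  also have "\<dots> \<le> stay_nonneg 0 n"
    unfolding stay_nonneg_def
  proof (rule P.finite_measure_mono)
    show "{\<omega>. \<forall>i<n. \<omega> i \<in> ?A} \<subseteq> {\<omega>. \<forall>i\<in>{1..n}. 0 \<le> walk 0 \<omega> i}"
      using e by (auto simp: walk_def intro!: sum_nonneg dest: spec intro: order_trans[of 0 e])
  qed (intro pred_sets, measurable)
  finally show ?thesis .
qed

lemma stay_neg_pos: "stay_neg 0 n > 0"
proof -
  let ?A = "{p. log_mean p < 0}"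
  have "{p \<in> space N. log_mean p < 0} \<in> sets N" by measurable
  then have A[measurable]: "?A \<in> sets N" by simp
  have "0 < measure P {\<omega>. \<forall>i<n. \<omega> i \<in> ?A}" using prob_all_first[OF A, of n] neg by simp
  also have "\<dots> \<le> stay_neg 0 n"
    unfolding stay_neg_def
  proof (rule P.finite_measure_mono)
    show "{\<omega>. \<forall>i<n. \<omega> i \<in> ?A} \<subseteq> {\<omega>. \<forall>i\<in>{1..n}. walk 0 \<omega> i < 0}"
    proof safe
      fix \<omega> i assume "\<forall>i<n. \<omega> i \<in> ?A" "i \<in> {1..n}"
      then have "(\<Sum>j<i. log_mean (\<omega> j)) < (\<Sum>j<i. 0)" by (intro sum_strict_mono) (auto simp: lessThan_empty_iff)
      then show "walk 0 \<omega> i < 0" by (simp add: walk_def)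
    qed
  qed (intro pred_sets, measurable)
  finally show ?thesis .
qed

lemma U_term_bounded:
  assumes x: "x \<ge> 0"
  shows "\<exists>C. \<forall>n. (\<Sum>k\<le>n. U_term x k) \<le> C"
proof -
  obtain m \<eta> where \<eta>: "\<eta> > 0" "\<And>n. \<eta> * stay_nonneg x n \<le> stay_nonneg 0 (m + n)"
    using climb by blast
  have "(\<Sum>k\<le>n. U_term x k) \<le> 1 / \<eta>" for n
  proof -
    have "(\<Sum>k\<le>n. U_term x k) * stay_nonneg 0 (m + n) = (\<Sum>k\<le>n. U_term x k * stay_nonneg 0 (m + n))"
      by (simp add: sum_distrib_right)
    also have "\<dots> \<le> (\<Sum>k\<le>n. U_term x k * stay_nonneg 0 (m + n - k))"
      by (intro sum_mono mult_left_mono stay_nonneg_antimono) (auto simp: U_term_def)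
    also have "\<dots> \<le> (\<Sum>k\<le>m+n. U_term x k * stay_nonneg 0 (m + n - k))"
      by (intro sum_mono2) (auto simp: U_term_def stay_nonneg_def)
    also have "\<dots> = stay_nonneg x (m + n)" by (rule stay_nonneg_decomposition[OF x])
    also have "\<dots> \<le> stay_nonneg x n" by (rule stay_nonneg_antimono) simp
    also have "\<dots> \<le> (1 / \<eta>) * stay_nonneg 0 (m + n)" using \<eta>(1) \<eta>(2)[of n] by (simp add: field_simps)
    finally show ?thesis using stay_nonneg_pos[of "m + n"] mult_le_cancel_right_pos by blast
  qed
  then show ?thesis by blast
qed

lemma V_term_bounded:
  assumes x: "x < 0"
  shows "\<exists>C. \<forall>n. (\<Sum>k\<le>n. V_term x k) \<le> C"
proof -
  obtain m \<eta> where \<eta>: "\<eta> > 0" "\<And>n. \<eta> * stay_neg x n \<le> stay_neg 0 (m + n)"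
    using descend by blast
  have "(\<Sum>k\<le>n. V_term x k) \<le> 1 / \<eta>" for n
  proof -
    have "(\<Sum>k\<le>n. V_term x k) * stay_neg 0 (m + n) = (\<Sum>k\<le>n. V_term x k * stay_neg 0 (m + n))"
      by (simp add: sum_distrib_right)
    also have "\<dots> \<le> (\<Sum>k\<le>n. V_term x k * stay_neg 0 (m + n - k))"
      by (intro sum_mono mult_left_mono stay_neg_antimono) (auto simp: V_term_def)
    also have "\<dots> \<le> (\<Sum>k\<le>m+n. V_term x k * stay_neg 0 (m + n - k))"
      by (intro sum_mono2) (auto simp: V_term_def stay_neg_def)
    also have "\<dots> = stay_neg x (m + n)" by (rule stay_neg_decomposition[OF x])
    also have "\<dots> \<le> stay_neg x n" by (rule stay_neg_antimono) simp
    also have "\<dots> \<le> (1 / \<eta>) * stay_neg 0 (m + n)" using \<eta>(1) \<eta>(2)[of n] by (simp add: field_simps)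
    finally show ?thesis using stay_neg_pos[of "m + n"] mult_le_cancel_right_pos by blast
  qed
  then show ?thesis by blast
qed

end

section \<open>Concentration of the walk\<close>

lemma norming_seq_ratio:
  assumes c: "norming_seq \<alpha> c" and p: "p \<ge> 1" and q: "q \<ge> 1"
  shows "(\<lambda>k. c (k * p) / c (k * q)) \<longlonglongrightarrow> (real p / real q) powr (1 / \<alpha>)"
proof -
  from c obtain l where l: "slowly_varying l" "\<And>n. n \<ge> 1 \<Longrightarrow> c n = real n powr (1 / \<alpha>) * l (real n)"
    unfolding norming_seq_def by blast
  have "real p / real q > 0" using p q by simp
  then have "((\<lambda>x. l (real p / real q * x) / l x) \<longlongrightarrow> 1) at_top"
    using l(1) unfolding slowly_varying_def by blast
  moreover have "filterlim (\<lambda>k. real (k * q)) at_top sequentially"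
    by (rule filterlim_compose[OF filterlim_real_sequentially])
       (use q in \<open>auto intro!: filterlim_at_top_mono[OF filterlim_ident]\<close>)
  ultimately have "(\<lambda>k. l (real p / real q * real (k * q)) / l (real (k * q))) \<longlonglongrightarrow> 1"
    by (rule filterlim_compose)
  then have lim: "(\<lambda>k. (real p / real q) powr (1 / \<alpha>) * (l (real p / real q * real (k * q)) / l (real (k * q))))
      \<longlonglongrightarrow> (real p / real q) powr (1 / \<alpha>) * 1"
    by (intro tendsto_intros)
  have ev: "eventually (\<lambda>k. (real p / real q) powr (1 / \<alpha>) * (l (real p / real q * real (k * q)) / l (real (k * q)))
      = c (k * p) / c (k * q)) sequentially"
    using eventually_ge_at_top[of 1]
  proof eventually_elim
    case (elim k)
    have e: "real p / real q * real (k * q) = real (k * p)" using q by simp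
    have "c (k * p) / c (k * q) = (real (k * p) / real (k * q)) powr (1 / \<alpha>) * (l (real (k * p)) / l (real (k * q)))"
      using elim p q by (subst (1 2) l(2)) (auto simp: powr_divide powr_mult)
    also have "real (k * p) / real (k * q) = real p / real q" using elim by simp
    finally show ?case unfolding e by simp
  qed
  show ?thesis using Lim_transform_eventually[OF lim ev] by (simp only: mult_1_right)
qed

lemma norming_seq_pos: "norming_seq \<alpha> c \<Longrightarrow> n \<ge> 1 \<Longrightarrow> c n > 0"
  by (simp add: norming_seq_def)

lemma norming_seq_mono: "norming_seq \<alpha> c \<Longrightarrow> 1 \<le> m \<Longrightarrow> m \<le> n \<Longrightarrow> c m \<le> c n"
  by (auto simp: norming_seq_def mono_on_def)

lemma norming_seq_double:
  assumes c: "norming_seq \<alpha> c" and \<alpha>: "1 < \<alpha>"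
  shows "\<exists>r>1. \<exists>n0\<ge>1. \<forall>n\<ge>n0. c (2 * n) \<le> 2 * c n \<and> r * c n \<le> c (2 * n)"
proof -
  define L where "L = (2::real) powr (1 / \<alpha>)"
  have L: "1 < L" "L < 2"
  proof -
    show "1 < L" unfolding L_def using \<alpha> powr_less_mono[of 0 "1 / \<alpha>" 2] by simp
    have "L < 2 powr 1" unfolding L_def using \<alpha> by (intro powr_less_mono) auto
    then show "L < 2" by simp
  qed
  have lim: "(\<lambda>k. c (k * 2) / c (k * 1)) \<longlonglongrightarrow> L"
    using norming_seq_ratio[OF c, of 2 1] by (simp add: L_def)
  obtain r where r: "1 < r" "r < L" using dense L by blast
  have "eventually (\<lambda>n. n \<ge> 1 \<and> c (n * 2) / c (n * 1) < 2 \<and> c (n * 2) / c (n * 1) > r) sequentially"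
    using order_tendstoD(2)[OF lim L(2)] order_tendstoD(1)[OF lim r(2)] eventually_ge_at_top[of 1]
    by eventually_elim auto
  then obtain n0 where n0: "\<And>n. n \<ge> n0 \<Longrightarrow> n \<ge> 1 \<and> c (n * 2) / c (n * 1) < 2 \<and> c (n * 2) / c (n * 1) > r"
    unfolding eventually_sequentially by blast
  have "c (2 * n) \<le> 2 * c n \<and> r * c n \<le> c (2 * n)" if "n \<ge> max n0 1" for n
    using n0[of n] that norming_seq_pos[OF c, of n] by (auto simp: field_simps mult.commute)
  with r show ?thesis by (intro exI[of _ r] conjI exI[of _ "max n0 1"]) auto
qed

lemma norming_seq_at_top:
  assumes c: "norming_seq \<alpha> c" and \<alpha>: "1 < \<alpha>"
  shows "filterlim c at_top sequentially"
  unfolding filterlim_at_top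
proof
  fix Z :: real
  obtain r n0 where r: "r > 1" "n0 \<ge> 1" "\<And>n. n \<ge> n0 \<Longrightarrow> r * c n \<le> c (2 * n)"
    using norming_seq_double[OF assms] by blast
  have pow: "r ^ j * c n0 \<le> c (2 ^ j * n0)" for j
  proof (induction j)
    case (Suc j)
    have "r ^ Suc j * c n0 \<le> r * c (2 ^ j * n0)" using Suc r by simp
    also have "\<dots> \<le> c (2 * (2 ^ j * n0))" by (rule r(3)) simp
    finally show ?case by (simp add: mult.assoc)
  qed simp
  obtain j where "Z / c n0 < r ^ j" using real_arch_pow[OF r(1)] by blast
  then have "Z \<le> c (2 ^ j * n0)"
    using pow[of j] norming_seq_pos[OF c r(2)] by (simp add: field_simps)
  then have "Z \<le> c n" if "n \<ge> 2 ^ j * n0" for n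
    using norming_seq_mono[OF c, of "2 ^ j * n0" n] that r(2) by (simp add: Suc_le_eq)
  then show "eventually (\<lambda>n. Z \<le> c n) sequentially" unfolding eventually_sequentially by blast
qed

lemma norming_seq_shift:
  assumes c: "norming_seq \<alpha> c" and \<alpha>: "1 < \<alpha>"
  shows "(\<lambda>n. c (n + d) / c n) \<longlonglongrightarrow> 1"
proof (rule order_tendstoI)
  fix a :: real assume a: "a < 1"
  show "eventually (\<lambda>n. a < c (n + d) / c n) sequentially"
    using eventually_ge_at_top[of 1]
  proof eventually_elim
    case (elim n)
    then have "1 \<le> c (n + d) / c n"
      using norming_seq_mono[OF c, of n "n + d"] norming_seq_pos[OF c, of n] by simp
    with a show ?case by simp
  qed
next
  fix a :: real assume a: "1 < a"
  have "(\<lambda>q. (1 + 1 / real (Suc q)) powr (1 / \<alpha>)) \<longlonglongrightarrow> (1 + 0) powr (1 / \<alpha>)"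
    by (intro tendsto_intros LIMSEQ_inverse_real_of_nat[unfolded inverse_eq_divide]) auto
  then have "eventually (\<lambda>q. (1 + 1 / real (Suc q)) powr (1 / \<alpha>) < a) sequentially"
    using a by (intro order_tendstoD(2)[where y = "(1 + 0) powr (1 / \<alpha>)"]) auto
  then obtain q' where q': "(1 + 1 / real (Suc q')) powr (1 / \<alpha>) < a"
    by (auto simp: eventually_sequentially)
  define q where "q = Suc q'"
  have q: "q \<ge> 1" "(real (q + 1) / real q) powr (1 / \<alpha>) < a"
    using q' by (auto simp: q_def field_simps)
  have "eventually (\<lambda>k. c (k * (q + 1)) / c (k * q) < a) sequentially"
    using norming_seq_ratio[OF c _ q(1), of "q + 1"] q(2) by (intro order_tendstoD(2)) auto
  then obtain k0 where k0: "\<And>k. k \<ge> k0 \<Longrightarrow> c (k * (q + 1)) / c (k * q) < a"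
    by (auto simp: eventually_sequentially)
  have "c (n + d) / c n < a" if n: "n \<ge> q * (max k0 (q + d) + 1)" for n
  proof -
    define k where "k = n div q"
    have k: "k \<ge> max k0 (q + d) + 1" using n q(1) by (simp add: k_def less_eq_div_iff_mult_less_eq mult.commute)
    have kq: "k * q \<le> n" "n < k * q + q"
      using div_mult_mod_eq[of n q] mod_less_divisor[of q n] q(1) unfolding k_def by linarith+
    have kq1: "1 \<le> k * q" using k q by (simp add: Suc_le_eq)
    have le1: "c (k * q) \<le> c n" using kq kq1 by (intro norming_seq_mono[OF c])
    have "n + d \<le> k * (q + 1)" using kq k by (simp add: algebra_simps)
    then have le2: "c (n + d) \<le> c (k * (q + 1))"
      using kq kq1 by (intro norming_seq_mono[OF c]) linarith+
    have p: "c (k * q) > 0" using kq1 by (rule norming_seq_pos[OF c])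
    have "c (n + d) / c n \<le> c (k * (q + 1)) / c n"
      using le2 le1 p by (intro divide_right_mono) auto
    also have "\<dots> \<le> c (k * (q + 1)) / c (k * q)"
      using le1 p norming_seq_pos[OF c, of "k * (q + 1)"] kq1 by (intro divide_left_mono) auto
    also have "\<dots> < a" using k by (intro k0) auto
    finally show ?thesis .
  qed
  then show "eventually (\<lambda>n. c (n + d) / c n < a) sequentially"
    unfolding eventually_sequentially by blast
qed

lemma norming_seq_linear_growth:
  assumes c: "norming_seq \<alpha> c" and \<alpha>: "1 < \<alpha>"
  shows "\<exists>n0\<ge>1. \<forall>n\<ge>n0. \<forall>m\<ge>n. c m \<le> 2 * (real m / real n) * c n"
proof -
  obtain n0 where n0: "n0 \<ge> 1" "\<And>n. n \<ge> n0 \<Longrightarrow> c (2 * n) \<le> 2 * c n"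
    using norming_seq_double[OF assms] by blast
  have pow: "c (2 ^ j * n) \<le> 2 ^ j * c n" if "n \<ge> n0" for j n
  proof (induction j)
    case (Suc j)
    have "2 ^ j * n \<ge> n" by simp
    then have "c (2 * (2 ^ j * n)) \<le> 2 * c (2 ^ j * n)" using that by (intro n0(2)) linarith
    also have "\<dots> \<le> 2 * (2 ^ j * c n)" using Suc by simp
    finally show ?case by (simp add: mult.assoc)
  qed simp
  have "c m \<le> 2 * (real m / real n) * c n" if n: "n \<ge> n0" and m: "m \<ge> n" for n m
  proof -
    define j where "j = (LEAST j. m < 2 ^ j * n)"
    have ex: "\<exists>j. m < 2 ^ j * n"
    proof
      have "m < 2 ^ m" by simp
      also have "\<dots> \<le> 2 ^ m * n" using n n0 by simp
      finally show "m < 2 ^ m * n" .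
    qed
    have j: "m < 2 ^ j * n" unfolding j_def by (rule LeastI_ex[OF ex])
    have "j \<noteq> 0" using j m by (intro notI) simp
    then obtain i where i: "j = Suc i" using not0_implies_Suc by blast
    have "\<not> m < 2 ^ i * n" using not_less_Least[of i "\<lambda>j. m < 2 ^ j * n"] i by (simp add: j_def)
    then have "2 ^ i * n \<le> m" by simp
    then have "real (2 ^ i * n) \<le> real m" by (rule of_nat_mono)
    then have r: "2 ^ i \<le> real m / real n" using n n0 by (simp add: field_simps)
    have "c m \<le> c (2 ^ j * n)" using j n n0 m by (intro norming_seq_mono[OF c]) auto
    also have "\<dots> \<le> 2 ^ j * c n" by (rule pow[OF n])
    also have "\<dots> = 2 * 2 ^ i * c n" by (simp add: i)
    also have "\<dots> \<le> 2 * (real m / real n) * c n"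
      using r norming_seq_pos[OF c, of n] n n0 by (intro mult_right_mono mult_left_mono) auto
    finally show ?thesis .
  qed
  with n0(1) show ?thesis by blast
qed


lemma integral_exp_abs_le:
  fixes A \<epsilon> t :: real
  assumes A: "A > 0" and t: "0 \<le> t" "t \<le> \<epsilon>"
  shows "(\<integral>s. exp (- A * \<bar>t - s\<bar>) \<partial>restrict_space lborel {0..\<epsilon>}) \<le> 2 / A"
proof -
  have 1: "(\<integral>s. indicator {0..t} s *\<^sub>R exp (- A * (t - s)) \<partial>lborel) = exp (- A * (t - t)) / A - exp (- A * (t - 0)) / A"
    by (rule integral_FTC_Icc[where F="\<lambda>s. exp (- A * (t - s)) / A"])
       (use A t in \<open>auto intro!: derivative_eq_intros continuous_intros simp: has_real_derivative_iff_has_vector_derivative[symmetric]\<close>)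
  have 2: "(\<integral>s. indicator {t..\<epsilon>} s *\<^sub>R exp (- A * (s - t)) \<partial>lborel) = - exp (- A * (\<epsilon> - t)) / A - - exp (- A * (t - t)) / A"
    by (rule integral_FTC_Icc[where F="\<lambda>s. - exp (- A * (s - t)) / A"])
       (use A t in \<open>auto intro!: derivative_eq_intros continuous_intros simp: has_real_derivative_iff_has_vector_derivative[symmetric]\<close>)
  have i1: "integrable lborel (\<lambda>s. indicator {0..t} s *\<^sub>R exp (- A * (t - s)))"
    by (intro borel_integrable_compact continuous_intros) auto
  have i2: "integrable lborel (\<lambda>s. indicator {t..\<epsilon>} s *\<^sub>R exp (- A * (s - t)))"
    by (intro borel_integrable_compact continuous_intros) auto
  have i3: "integrable lborel (\<lambda>s. indicator {0..\<epsilon>} s *\<^sub>R exp (- A * \<bar>t - s\<bar>))"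
    by (intro borel_integrable_compact continuous_intros) auto
  have "(\<integral>s. exp (- A * \<bar>t - s\<bar>) \<partial>restrict_space lborel {0..\<epsilon>}) = (\<integral>s. indicator {0..\<epsilon>} s *\<^sub>R exp (- A * \<bar>t - s\<bar>) \<partial>lborel)"
    by (subst integral_restrict_space) auto
  also have "\<dots> \<le> (\<integral>s. indicator {0..t} s *\<^sub>R exp (- A * (t - s)) + indicator {t..\<epsilon>} s *\<^sub>R exp (- A * (s - t)) \<partial>lborel)"
    by (intro integral_mono i3 Bochner_Integration.integrable_add i1 i2) (auto simp: indicator_def)
  also have "\<dots> = (exp (- A * (t - t)) / A - exp (- A * (t - 0)) / A) + (- exp (- A * (\<epsilon> - t)) / A - - exp (- A * (t - t)) / A)"
    using 1 2 i1 i2 by (subst Bochner_Integration.integral_add) auto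
  also have "\<dots> \<le> 2 / A" using A by (simp add: field_simps)
  finally show ?thesis .
qed

lemma concentration_char:
  fixes \<mu> :: "real measure"
  assumes "real_distribution \<mu>" and \<epsilon>: "0 < \<epsilon>" "\<epsilon> \<le> 1" and A: "A > 0" and D: "D \<ge> 0"
    and char: "\<And>u. \<bar>u\<bar> \<le> \<epsilon> \<Longrightarrow> cmod (char \<mu> u) \<le> D * exp (- A * \<bar>u\<bar>)"
  shows "measure \<mu> {y..y+1} \<le> 4 * D / (\<epsilon> * A)"
proof -
  interpret \<mu>: real_distribution \<mu> by fact
  define L where "L = restrict_space lborel {0..\<epsilon>}"
  have space_L: "space L = {0..\<epsilon>}" by (simp add: L_def space_restrict_space)
  have mL: "measure L (space L) = \<epsilon>"
    using \<epsilon> by (simp add: L_def space_restrict_space measure_restrict_space)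
  interpret L: finite_measure L
    by (rule finite_measureI) (use \<epsilon> in \<open>simp add: L_def space_restrict_space emeasure_restrict_space\<close>)
  have idL: "(\<lambda>x. x) \<in> borel_measurable L"
    unfolding L_def by (intro measurable_restrict_space1) simp
  note [measurable] = idL
  interpret LL: finite_measure "L \<Otimes>\<^sub>M L" by (intro finite_measure_pair_measure) unfold_locales
  interpret LLp: pair_sigma_finite L L ..
  interpret LM: finite_measure "(L \<Otimes>\<^sub>M L) \<Otimes>\<^sub>M \<mu>" by (intro finite_measure_pair_measure) unfold_locales
  interpret LMp: pair_sigma_finite "L \<Otimes>\<^sub>M L" \<mu> ..
  have [measurable]: "fst \<in> borel_measurable (L \<Otimes>\<^sub>M L)" "snd \<in> borel_measurable (L \<Otimes>\<^sub>M L)"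
    using measurable_compose[OF measurable_fst idL] measurable_compose[OF measurable_snd idL] by auto
  define k where "k x = (\<integral>p. cos ((fst p - snd p) * x) \<partial>(L \<Otimes>\<^sub>M L))" for x
  have k_iter: "k x = (\<integral>t. (\<integral>s. cos ((t - s) * x) \<partial>L) \<partial>L)" for x
    unfolding k_def
    by (subst LLp.integral_fst'[symmetric])
       (auto intro!: LL.integrable_const_bound[where B=1])
  have k_nonneg: "k x \<ge> 0" for x
  proof -
    have ic: "integrable L (\<lambda>t. cos (t * x))" "integrable L (\<lambda>t. sin (t * x))"
      by (auto intro!: L.integrable_const_bound[where B=1])
    have "k x = (\<integral>t. (\<integral>s. cos (t * x) * cos (s * x) + sin (t * x) * sin (s * x) \<partial>L) \<partial>L)"
      unfolding k_iter by (simp add: left_diff_distrib cos_diff)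
    also have "\<dots> = (\<integral>t. cos (t * x) * (\<integral>s. cos (s * x) \<partial>L) + sin (t * x) * (\<integral>s. sin (s * x) \<partial>L) \<partial>L)"
      using ic by simp
    also have "\<dots> = (\<integral>s. cos (s * x) \<partial>L) * (\<integral>s. cos (s * x) \<partial>L) + (\<integral>s. sin (s * x) \<partial>L) * (\<integral>s. sin (s * x) \<partial>L)"
      using ic by simp
    finally show ?thesis by simp
  qed
  have cos_half: "cos v \<ge> 1/2" if "\<bar>v\<bar> \<le> 1" for v :: real
  proof -
    have "1/2 = cos (pi/3)" by (simp add: cos_60)
    also have "\<dots> \<le> cos \<bar>v\<bar>" using that pi_gt3 by (intro cos_monotone_0_pi_le) auto
    finally show ?thesis by simp
  qed
  have mLL: "measure (L \<Otimes>\<^sub>M L) (space (L \<Otimes>\<^sub>M L)) = \<epsilon> * \<epsilon>"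
    unfolding space_pair_measure
    by (simp add: measure_def L.emeasure_pair_measure_Times enn2real_mult mL[unfolded measure_def])
  have k_lower: "k x \<ge> \<epsilon> * \<epsilon> / 2" if x: "\<bar>x\<bar> \<le> 1" for x
  proof -
    have "\<epsilon> * \<epsilon> / 2 = (\<integral>p. 1/2 \<partial>(L \<Otimes>\<^sub>M L))" using mLL by simp
    also have "\<dots> \<le> k x" unfolding k_def
    proof (rule integral_mono)
      fix p assume "p \<in> space (L \<Otimes>\<^sub>M L)"
      then have "\<bar>fst p - snd p\<bar> \<le> 1" using \<epsilon> by (auto simp: space_pair_measure space_L)
      then have "\<bar>(fst p - snd p) * x\<bar> \<le> 1" unfolding abs_mult using x by (intro mult_le_one) auto
      then show "1/2 \<le> cos ((fst p - snd p) * x)" by (rule cos_half)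
    qed (auto intro!: LL.integrable_const_bound[where B=1])
    finally show ?thesis .
  qed
  have k_meas: "(\<lambda>z. k (z - y)) \<in> borel_measurable \<mu>"
    unfolding k_def by measurable
  have k_int: "integrable \<mu> (\<lambda>z. k (z - y))"
  proof (rule \<mu>.integrable_const_bound[where B="\<epsilon> * \<epsilon>"])
    have "\<bar>k x\<bar> \<le> (\<integral>p. 1 \<partial>(L \<Otimes>\<^sub>M L))" for x unfolding k_def
      by (rule integral_abs_bound[THEN order_trans], rule integral_mono)
         (auto intro!: LL.integrable_const_bound[where B=1])
    then show "AE z in \<mu>. norm (k (z - y)) \<le> \<epsilon> * \<epsilon>" using mLL by simp
  qed (rule k_meas)
  have cos_char: "\<bar>\<integral>z. cos (u * (z - y)) \<partial>\<mu>\<bar> \<le> cmod (char \<mu> u)" for u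
  proof -
    have "iexp (- (u * y)) * char \<mu> u = (\<integral>z. iexp (- (u * y)) * iexp (u * z) \<partial>\<mu>)"
      unfolding char_def by simp
    also have "\<dots> = (\<integral>z. iexp (u * (z - y)) \<partial>\<mu>)"
      by (intro Bochner_Integration.integral_cong) (auto simp: exp_add[symmetric] algebra_simps)
    finally have "Re (iexp (- (u * y)) * char \<mu> u) = (\<integral>z. Re (iexp (u * (z - y))) \<partial>\<mu>)"
      by (subst integral_Re) (auto intro!: \<mu>.integrable_iexp)
    also have "\<dots> = (\<integral>z. cos (u * (z - y)) \<partial>\<mu>)" by (simp add: Re_exp)
    finally have "\<bar>\<integral>z. cos (u * (z - y)) \<partial>\<mu>\<bar> \<le> cmod (iexp (- (u * y)) * char \<mu> u)"
      using abs_Re_le_cmod by metis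
    also have "\<dots> = cmod (char \<mu> u)" by (simp add: norm_mult)
    finally show ?thesis .
  qed
  have iD: "integrable (L \<Otimes>\<^sub>M L) (\<lambda>p. D * exp (- A * \<bar>fst p - snd p\<bar>))"
  proof (rule LL.integrable_const_bound[where B=D])
    show "AE p in L \<Otimes>\<^sub>M L. norm (D * exp (- A * \<bar>fst p - snd p\<bar>)) \<le> D"
    proof (rule AE_I2)
      fix p
      have "D * exp (- A * \<bar>fst p - snd p\<bar>) \<le> D * 1" using A D by (intro mult_left_mono) auto
      then show "norm (D * exp (- A * \<bar>fst p - snd p\<bar>)) \<le> D" using D by (simp add: abs_mult)
    qed
  qed measurable
  have "\<epsilon> * \<epsilon> / 2 * measure \<mu> {y..y+1} = (\<integral>z. \<epsilon> * \<epsilon> / 2 * indicator {y..y+1} z \<partial>\<mu>)"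
    by simp
  also have "\<dots> \<le> (\<integral>z. k (z - y) \<partial>\<mu>)"
  proof (rule integral_mono[OF _ k_int])
    show "integrable \<mu> (\<lambda>z. \<epsilon> * \<epsilon> / 2 * indicator {y..y+1} z)"
      by (intro integrable_mult_right integrable_real_indicator) (auto simp: \<mu>.emeasure_eq_measure)
    show "\<epsilon> * \<epsilon> / 2 * indicator {y..y+1} z \<le> k (z - y)" for z
      using k_lower[of "z - y"] k_nonneg[of "z - y"] by (auto simp: indicator_def)
  qed
  also have "\<dots> = (\<integral>p. (\<integral>z. cos ((fst p - snd p) * (z - y)) \<partial>\<mu>) \<partial>(L \<Otimes>\<^sub>M L))"
    unfolding k_def
    by (rule LMp.Fubini_integral)
       (auto intro!: LM.integrable_const_bound[where B=1] simp: split_beta')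
  also have "\<dots> \<le> (\<integral>p. D * exp (- A * \<bar>fst p - snd p\<bar>) \<partial>(L \<Otimes>\<^sub>M L))"
  proof (rule integral_mono)
    show "integrable (L \<Otimes>\<^sub>M L) (\<lambda>p. \<integral>z. cos ((fst p - snd p) * (z - y)) \<partial>\<mu>)"
    proof (rule LL.integrable_const_bound[where B=1])
      show "AE p in L \<Otimes>\<^sub>M L. norm (\<integral>z. cos ((fst p - snd p) * (z - y)) \<partial>\<mu>) \<le> 1"
        using cos_char \<mu>.cmod_char_le_1 by (auto intro: order_trans)
    qed measurable
    show "integrable (L \<Otimes>\<^sub>M L) (\<lambda>p. D * exp (- A * \<bar>fst p - snd p\<bar>))"
      by (rule iD)
    fix p assume "p \<in> space (L \<Otimes>\<^sub>M L)"
    then have "\<bar>fst p - snd p\<bar> \<le> \<epsilon>" by (auto simp: space_pair_measure space_L)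
    then show "(\<integral>z. cos ((fst p - snd p) * (z - y)) \<partial>\<mu>) \<le> D * exp (- A * \<bar>fst p - snd p\<bar>)"
      using cos_char[of "fst p - snd p"] char[of "fst p - snd p"] by linarith
  qed
  also have "\<dots> = (\<integral>t. (\<integral>s. D * exp (- A * \<bar>t - s\<bar>) \<partial>L) \<partial>L)"
    by (subst LLp.integral_fst'[OF iD, symmetric]) simp
  also have "\<dots> \<le> (\<integral>t. D * (2 / A) \<partial>L)"
  proof (rule integral_mono_AE')
    show "AE t in L. (\<integral>s. D * exp (- A * \<bar>t - s\<bar>) \<partial>L) \<le> D * (2 / A)"
    proof (rule AE_I2)
      fix t assume "t \<in> space L"
      then have "(\<integral>s. exp (- A * \<bar>t - s\<bar>) \<partial>L) \<le> 2 / A"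
        unfolding L_def using A by (intro integral_exp_abs_le) (auto simp: space_restrict_space)
      then have "D * (\<integral>s. exp (- A * \<bar>t - s\<bar>) \<partial>L) \<le> D * (2 / A)" using D by (rule mult_left_mono)
      then show "(\<integral>s. D * exp (- A * \<bar>t - s\<bar>) \<partial>L) \<le> D * (2 / A)" by simp
    qed
    show "AE t in L. 0 \<le> D * (2 / A)" using A D by simp
  qed simp
  also have "\<dots> = 2 * D * \<epsilon> / A" by (simp add: mL)
  finally have "\<epsilon> * (\<epsilon> * A * measure \<mu> {y..y+1}) \<le> \<epsilon> * (4 * D)" using A by (simp add: field_simps)
  then have "\<epsilon> * A * measure \<mu> {y..y+1} \<le> 4 * D" using \<epsilon> by simp
  then show ?thesis using A \<epsilon> by (simp add: field_simps)
qed


lemma cmod_iexp_diff_le: "cmod (iexp a - iexp b) \<le> min 2 \<bar>a - b\<bar>"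
proof -
  have "cmod (iexp a - iexp b) = cmod (iexp b * (iexp (a - b) - 1))"
    by (intro arg_cong[where f=cmod]) (simp add: algebra_simps exp_diff exp_add exp_minus)
  also have "\<dots> = cmod (iexp (a - b) - 1)" by (simp add: norm_mult)
  also have "\<dots> \<le> \<bar>a - b\<bar>" using iexp_approx1[of "a - b" 0] by simp
  finally have 1: "cmod (iexp a - iexp b) \<le> \<bar>a - b\<bar>" .
  have "cmod (iexp a - iexp b) \<le> cmod (iexp a) + cmod (iexp b)" by (rule norm_triangle_ineq4)
  also have "\<dots> = 2" by simp
  finally show ?thesis using 1 by simp
qed

lemma weak_conv_char_uniform:
  assumes M: "\<And>n. real_distribution (M n)" and M': "real_distribution M'" and wc: "weak_conv_m M M'"
    and b: "b > 0" and e: "e > 0"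
  shows "\<exists>n0. \<forall>n\<ge>n0. \<forall>t. \<bar>t\<bar> \<le> b \<longrightarrow> cmod (char (M n) t - char M' t) < e"
proof -
  obtain \<Omega> :: "real measure" and Yn Y where \<Omega>: "prob_space \<Omega>" and
      Yn[measurable]: "\<And>n::nat. Yn n \<in> borel_measurable \<Omega>" and dn: "\<And>n. distr \<Omega> borel (Yn n) = M n"
      and Y[measurable]: "Y \<in> borel_measurable \<Omega>" and d: "distr \<Omega> borel Y = M'"
      and lim: "\<And>x. x \<in> space \<Omega> \<Longrightarrow> (\<lambda>n. Yn n x) \<longlonglongrightarrow> Y x"
    using Skorohod[OF M M' wc] by force
  interpret prob_space \<Omega> by fact
  have "(\<lambda>n. \<integral>x. min 2 (b * \<bar>Yn n x - Y x\<bar>) \<partial>\<Omega>) \<longlonglongrightarrow> (\<integral>x. 0 \<partial>\<Omega>)"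
  proof (rule integral_dominated_convergence[where w="\<lambda>_. 2"])
    show "AE x in \<Omega>. (\<lambda>n. min 2 (b * \<bar>Yn n x - Y x\<bar>)) \<longlonglongrightarrow> 0"
    proof (rule AE_I2)
      fix x assume "x \<in> space \<Omega>"
      from lim[OF this] have "(\<lambda>n. min 2 (b * \<bar>Yn n x - Y x\<bar>)) \<longlonglongrightarrow> min 2 (b * \<bar>Y x - Y x\<bar>)"
        by (intro tendsto_intros)
      then show "(\<lambda>n. min 2 (b * \<bar>Yn n x - Y x\<bar>)) \<longlonglongrightarrow> 0" by simp
    qed
  qed (use b in auto)
  then have "eventually (\<lambda>n. (\<integral>x. min 2 (b * \<bar>Yn n x - Y x\<bar>) \<partial>\<Omega>) < e) sequentially"
    using e by (intro order_tendstoD(2)[where y="\<integral>x. 0 \<partial>\<Omega>"]) auto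
  then obtain n0 where n0: "\<And>n. n \<ge> n0 \<Longrightarrow> (\<integral>x. min 2 (b * \<bar>Yn n x - Y x\<bar>) \<partial>\<Omega>) < e"
    unfolding eventually_sequentially by blast
  have "cmod (char (M n) t - char M' t) < e" if "n \<ge> n0" "\<bar>t\<bar> \<le> b" for n t
  proof -
    have i: "integrable \<Omega> (\<lambda>x. iexp (t * Yn n x))" "integrable \<Omega> (\<lambda>x. iexp (t * Y x))"
      by (auto intro!: integrable_const_bound[where B=1])
    have "char (M n) t - char M' t = (\<integral>x. iexp (t * Yn n x) - iexp (t * Y x) \<partial>\<Omega>)"
      unfolding dn[symmetric] d[symmetric] char_def using i by (simp add: integral_distr)
    also have "cmod \<dots> \<le> (\<integral>x. min 2 (b * \<bar>Yn n x - Y x\<bar>) \<partial>\<Omega>)"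
    proof (rule integral_norm_bound[THEN order_trans], rule integral_mono)
      show "integrable \<Omega> (\<lambda>x. min 2 (b * \<bar>Yn n x - Y x\<bar>))"
        by (rule integrable_const_bound[where B=2]) (use b in auto)
      show "cmod (iexp (t * Yn n x) - iexp (t * Y x)) \<le> min 2 (b * \<bar>Yn n x - Y x\<bar>)" for x
      proof -
        have "\<bar>t * Yn n x - t * Y x\<bar> = \<bar>t\<bar> * \<bar>Yn n x - Y x\<bar>"
          by (simp add: right_diff_distrib[symmetric] abs_mult)
        also have "\<dots> \<le> b * \<bar>Yn n x - Y x\<bar>" using that by (intro mult_right_mono) auto
        finally show ?thesis using cmod_iexp_diff_le[of "t * Yn n x" "t * Y x"] by simp
      qed
      show "integrable \<Omega> (\<lambda>x. cmod (iexp (t * Yn n x) - iexp (t * Y x)))"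
        using i by (intro integrable_norm Bochner_Integration.integrable_diff)
    qed
    also have "\<dots> < e" by (rule n0) fact
    finally show ?thesis .
  qed
  then show ?thesis by blast
qed

lemma nondegenerate_char_less_1:
  assumes "real_distribution \<mu>" and nd: "\<not> (\<exists>a. AE y in \<mu>. y = a)"
  shows "\<exists>t>0. cmod (char \<mu> t) < 1"
proof (rule ccontr)
  interpret real_distribution \<mu> by fact
  assume "\<not> ?thesis"
  then have 1: "cmod (char \<mu> t) = 1" if "t > 0" for t
    using that cmod_char_le_1[of t] by (meson antisym not_less)
  have "\<exists>a. AE y in \<mu>. cos (t * y - a) = 1" if t: "t > 0" for t
  proof -
    obtain a where a: "char \<mu> t = exp (\<i> * complex_of_real a)" using 1[OF t] complex_norm_eq_1_exp by metis
    have int: "integrable \<mu> (\<lambda>y. iexp (t * y))" by (auto intro!: integrable_const_bound[where B=1])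
    have ic: "integrable \<mu> (\<lambda>y. 1 - cos (t * y - a))" by (auto intro!: integrable_const_bound[where B=2])
    have "1 = iexp (- a) * char \<mu> t" by (simp add: a exp_minus)
    also have "\<dots> = (\<integral>y. iexp (- a) * iexp (t * y) \<partial>\<mu>)" unfolding char_def by simp
    also have "\<dots> = (\<integral>y. iexp (t * y - a) \<partial>\<mu>)"
      by (intro Bochner_Integration.integral_cong) (auto simp: exp_add[symmetric] algebra_simps)
    finally have "Re 1 = Re (\<integral>y. iexp (t * y - a) \<partial>\<mu>)" by simp
    also have "\<dots> = (\<integral>y. Re (iexp (t * y - a)) \<partial>\<mu>)"
      by (subst integral_Re) (auto intro!: integrable_const_bound[where B=1])
    also have "\<dots> = (\<integral>y. cos (t * y - a) \<partial>\<mu>)" by (simp add: Re_exp)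
    finally have "(\<integral>y. 1 - cos (t * y - a) \<partial>\<mu>) = 0"
      by (subst Bochner_Integration.integral_diff) (auto intro!: integrable_const_bound[where B=1] simp: prob_space simp del: space_eq_univ)
    then have "AE y in \<mu>. 1 - cos (t * y - a) = 0"
      by (subst integral_nonneg_eq_0_iff_AE[OF ic, symmetric]) auto
    then show ?thesis by auto
  qed
  then have "\<exists>a. AE y in \<mu>. cos (1 / real (Suc n) * y - a) = 1" for n
    by (metis of_nat_0_less_iff zero_less_Suc zero_less_divide_1_iff)
  then obtain a where a: "\<And>n. AE y in \<mu>. cos (1 / real (Suc n) * y - a n) = 1" by metis
  then have all: "AE y in \<mu>. \<forall>n. cos (1 / real (Suc n) * y - a n) = 1" by (simp add: AE_all_countable)
  have "\<exists>y. \<forall>n. cos (1 / real (Suc n) * y - a n) = 1"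
  proof (rule ccontr)
    assume *: "\<not> ?thesis"
    have "AE y in \<mu>. False" using all by (rule eventually_mono) (use * in blast)
    then show False by (simp only: AE_False)
  qed
  then obtain y0 where y0: "\<And>n. cos (1 / real (Suc n) * y0 - a n) = 1" by blast
  have "y = y0" if y: "\<forall>n. cos (1 / real (Suc n) * y - a n) = 1" for y
  proof -
    obtain n where n: "\<bar>y - y0\<bar> / (2 * pi) < real (Suc n)" using reals_Archimedean2 less_trans[OF _ of_nat_less_iff[THEN iffD2, OF lessI]] by blast
    obtain i where i: "1 / real (Suc n) * y - a n = real_of_int i * 2 * pi" using y cos_one_2pi_int by blast
    obtain j where j: "1 / real (Suc n) * y0 - a n = real_of_int j * 2 * pi" using y0 cos_one_2pi_int by blast
    have e: "(y - y0) / real (Suc n) = real_of_int (i - j) * (2 * pi)"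
      using i j by (simp add: field_simps)
    then have "\<bar>real_of_int (i - j)\<bar> * (2 * pi) = \<bar>y - y0\<bar> / real (Suc n)" by (metis abs_divide abs_mult abs_of_nat abs_of_pos pi_gt_zero zero_less_mult_iff zero_less_numeral)
    also have "\<dots> < 1 * (2 * pi)" using n by (simp add: field_simps)
    finally have "\<bar>real_of_int (i - j)\<bar> < 1" using mult_less_cancel_right_pos[of "2 * pi"] by auto
    then have "i - j = 0" by linarith
    with e show ?thesis by simp
  qed
  then have "AE y in \<mu>. y = y0" using all by auto
  with nd show False by blast
qed

context iid_env
begin

definition walk_char :: "nat \<Rightarrow> real \<Rightarrow> complex" where
  "walk_char n t = (\<integral>\<omega>. iexp (t * walk 0 \<omega> n) \<partial>P)"

lemma walk_char_Suc: "walk_char (Suc n) t = walk_char n t * walk_char 1 t"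
proof -
  interpret PP: pair_prob_space P P ..
  have "walk_char (Suc n) t = (\<integral>p. iexp (t * walk 0 (case p of (\<omega>, \<omega>') \<Rightarrow> comb_seq n \<omega> \<omega>') (Suc n)) \<partial>(P \<Otimes>\<^sub>M P))"
    unfolding walk_char_def
    by (subst PiM_comb_seq[of n, symmetric], subst integral_distr) (auto simp: measurable_comb_seq)
  also have "\<dots> = (\<integral>p. iexp (t * walk 0 (fst p) n) * iexp (t * walk 0 (snd p) 1) \<partial>(P \<Otimes>\<^sub>M P))"
    using walk_comb_seq_add[of 0 n _ _ 1]
    by (intro Bochner_Integration.integral_cong) (auto simp: exp_add[symmetric] algebra_simps)
  also have "\<dots> = (\<integral>\<omega>. (\<integral>\<omega>'. iexp (t * walk 0 \<omega> n) * iexp (t * walk 0 \<omega>' 1) \<partial>P) \<partial>P)"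
    by (subst PP.integral_fst'[symmetric]) (auto intro!: PP.integrable_const_bound[where B=1] simp: norm_mult)
  also have "\<dots> = walk_char n t * walk_char 1 t"
    unfolding walk_char_def by simp
  finally show ?thesis .
qed

lemma walk_char_eq: "walk_char n t = walk_char 1 t ^ n"
proof (induction n)
  case 0
  then show ?case using P.prob_space by (simp add: walk_char_def)
next
  case (Suc n)
  then show ?case using walk_char_Suc[of n t] by simp
qed

lemma cmod_walk_char_le_1: "cmod (walk_char n t) \<le> 1"
proof -
  have "cmod (walk_char n t) \<le> (\<integral>\<omega>. cmod (iexp (t * walk 0 \<omega> n)) \<partial>P)"
    unfolding walk_char_def by (rule integral_norm_bound)
  also have "\<dots> = 1" using P.prob_space by simp
  finally show ?thesis .
qed

lemma cmod_walk_char_minus: "cmod (walk_char n (- t)) = cmod (walk_char n t)"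
proof -
  have "walk_char n (- t) = cnj (walk_char n t)"
    unfolding walk_char_def by (subst Bochner_Integration.integral_cnj[symmetric]) (simp add: exp_cnj)
  then show ?thesis by simp
qed

lemma concentration:
  assumes c: "norming_seq \<alpha> c" and \<alpha>: "1 < \<alpha>"
    and \<mu>: "real_distribution \<mu>" "\<not> (\<exists>a. AE y in \<mu>. y = a)"
    and wc: "weak_conv_m (\<lambda>n. distr P borel (\<lambda>\<omega>. walk 0 \<omega> n / c n)) \<mu>"
  shows "\<exists>C>0. \<forall>n\<ge>1. \<forall>y. measure P {\<omega>. walk 0 \<omega> n \<in> {y..y+1}} \<le> C / c n"
proof -
  interpret \<mu>: real_distribution \<mu> by fact
  have rd: "real_distribution (distr P borel f)" if "f \<in> borel_measurable P" for f
    using P.real_distribution_distr[OF that] by simp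
  obtain t0 where t0: "t0 > 0" "cmod (char \<mu> t0) < 1" using nondegenerate_char_less_1[OF \<mu>] by blast
  obtain \<rho>0 where \<rho>0: "cmod (char \<mu> t0) < \<rho>0" "\<rho>0 < 1" using dense t0(2) by blast
  obtain \<rho> where \<rho>: "\<rho>0 < \<rho>" "\<rho> < 1" using dense \<rho>0(2) by blast
  have \<rho>_pos: "\<rho> > 0" using \<rho> \<rho>0 norm_ge_zero[of "char \<mu> t0"] by linarith
  have "isCont (\<lambda>t. cmod (char \<mu> t)) t0" using \<mu>.isCont_char by (intro continuous_intros)
  then have "eventually (\<lambda>t. cmod (char \<mu> t) < \<rho>0) (at t0)"
    using \<rho>0(1) by (simp add: isCont_def order_tendstoD)
  then obtain d where d: "d > 0" "\<And>t. dist t t0 < d \<Longrightarrow> cmod (char \<mu> t) < \<rho>0"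
    using \<rho>0(1) unfolding eventually_at by (metis UNIV_I)
  define a where "a = t0"
  define b where "b = t0 + d / 2"
  have ab: "0 < a" "a < b" using t0 d by (auto simp: a_def b_def)
  have lt: "cmod (char \<mu> t) < \<rho>0" if "a \<le> t" "t \<le> b" for t
    using that d by (intro d(2)) (auto simp: a_def b_def dist_real_def)
  have "\<exists>n0. \<forall>n\<ge>n0. \<forall>t. \<bar>t\<bar> \<le> b \<longrightarrow> cmod (char (distr P borel (\<lambda>\<omega>. walk 0 \<omega> n / c n)) t - char \<mu> t) < \<rho> - \<rho>0"
    using ab \<rho> by (intro weak_conv_char_uniform wc \<mu> rd) auto
  then obtain n0 where n0: "\<And>n t. n \<ge> n0 \<Longrightarrow> \<bar>t\<bar> \<le> b \<Longrightarrow>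
      cmod (char (distr P borel (\<lambda>\<omega>. walk 0 \<omega> n / c n)) t - char \<mu> t) < \<rho> - \<rho>0" by blast
  have small: "cmod (walk_char 1 u) ^ n \<le> \<rho>" if "n \<ge> n0" "n \<ge> 1" "a \<le> u * c n" "u * c n \<le> b" for n u
  proof -
    have cn: "c n > 0" using norming_seq_pos[OF c] that by auto
    have "char (distr P borel (\<lambda>\<omega>. walk 0 \<omega> n / c n)) (u * c n) = walk_char n u"
      unfolding char_def walk_char_def using cn by (simp add: integral_distr)
    moreover have "\<bar>u * c n\<bar> \<le> b" using that ab by auto
    ultimately have "cmod (walk_char n u - char \<mu> (u * c n)) < \<rho> - \<rho>0" using n0[OF that(1)] by metis
    then have "cmod (walk_char n u) < \<rho>"
      using lt[OF that(3,4)] norm_triangle_sub[of "walk_char n u" "char \<mu> (u * c n)"] by linarith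
    then show ?thesis by (simp add: walk_char_eq[of n] norm_power)
  qed
  obtain n1 where n1: "n1 \<ge> 1" "\<And>n m. n \<ge> n1 \<Longrightarrow> m \<ge> n \<Longrightarrow> c m \<le> 2 * (real m / real n) * c n"
    using norming_seq_linear_growth[OF c \<alpha>] by blast
  have "eventually (\<lambda>n. c (n + 1) / c n < b / a) sequentially"
    using ab by (intro order_tendstoD(2)[OF norming_seq_shift[OF c \<alpha>]]) (auto simp: field_simps)
  then obtain n2 where n2: "\<And>n. n \<ge> n2 \<Longrightarrow> c (n + 1) / c n < b / a"
    unfolding eventually_sequentially by blast
  define k where "k = max n0 (max n1 n2)"
  have k: "k \<ge> n0" "k \<ge> n1" "k \<ge> n2" "k \<ge> 1" using n1 by (auto simp: k_def)
  define \<epsilon> where "\<epsilon> = min 1 (a / c k)"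
  have \<epsilon>: "0 < \<epsilon>" "\<epsilon> \<le> 1" "\<epsilon> * c k \<le> a"
    using ab norming_seq_pos[OF c k(4)] by (auto simp: \<epsilon>_def min_def field_simps)
  define A where "A = - ln \<rho> / (2 * b)"
  have A: "A > 0" using \<rho> \<rho>_pos ab by (auto simp: A_def intro!: divide_neg_pos)
  have bound: "cmod (walk_char n u) \<le> 1 / \<rho> * exp (- (A * c n) * u)" if n: "n \<ge> 1" and u: "0 < u" "u \<le> \<epsilon>" for n u
  proof -
    have "eventually (\<lambda>m. a / u \<le> c m) sequentially"
      using norming_seq_at_top[OF c \<alpha>] by (auto simp: filterlim_at_top)
    then obtain m0 where m0: "\<And>m. m \<ge> m0 \<Longrightarrow> a / u \<le> c m" unfolding eventually_sequentially by blast
    define m where "m = (LEAST m. m \<ge> k \<and> a \<le> u * c m)"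
    have ex: "max m0 k \<ge> k \<and> a \<le> u * c (max m0 k)" using m0[of "max m0 k"] u by (simp add: field_simps)
    have m: "m \<ge> k" "a \<le> u * c m"
      using LeastI[of "\<lambda>m. m \<ge> k \<and> a \<le> u * c m", OF ex] by (auto simp: m_def)
    have cm: "c m > 0" using m k by (intro norming_seq_pos[OF c]) auto
    have "u * c m \<le> b"
    proof (cases "m = k")
      case True
      then have "u * c m \<le> \<epsilon> * c k" using u cm by (intro mult_mono) auto
      then show ?thesis using \<epsilon> ab by linarith
    next
      case False
      then obtain j where j: "m = j + 1" "j \<ge> k" using m by (metis add.commute le_neq_implies_less less_imp_Suc_add plus_1_eq_Suc le_add1 add_Suc_right)
      have "\<not> (j \<ge> k \<and> a \<le> u * c j)" unfolding m_def[symmetric] using j not_less_Least[of j "\<lambda>m. m \<ge> k \<and> a \<le> u * c m"] by (auto simp: m_def)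
      then have uj: "u * c j < a" using j by auto
      have cj: "c j > 0" using j k by (intro norming_seq_pos[OF c]) auto
      have "c m \<le> b / a * c j" using n2[of j] j k cj by (simp add: field_simps)
      then have "u * c m \<le> u * (b / a * c j)" using u by (intro mult_left_mono) auto
      then have "u * c m \<le> b / a * (u * c j)" by (simp add: mult_ac)
      also have "\<dots> \<le> b / a * a" using uj ab by (intro mult_left_mono) auto
      finally show ?thesis using ab by simp
    qed
    then have le: "cmod (walk_char 1 u) ^ m \<le> \<rho>" using m k by (intro small) auto
    have m1: "m \<ge> 1" using m k by auto
    let ?\<phi> = "cmod (walk_char 1 u)"
    show ?thesis
    proof (cases "?\<phi> = 0")
      case True
      then have "cmod (walk_char n u) = 0" using n by (simp add: walk_char_eq[of n] norm_power)
      moreover have "0 \<le> 1 / \<rho> * exp (- (A * c n) * u)" using \<rho>_pos by simp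
      ultimately show ?thesis by linarith
    next
      case False
      then have \<phi>: "?\<phi> > 0" by simp
      have "real m * ln ?\<phi> \<le> ln \<rho>" using le \<phi> \<rho>_pos by (simp add: ln_realpow[symmetric])
      then have lnphi: "ln ?\<phi> \<le> ln \<rho> / real m" using m1 by (simp add: field_simps)
      have ratio: "u * c n / (2 * b) - 1 \<le> real n / real m"
      proof (cases "m \<le> n")
        case True
        have "c n \<le> 2 * (real n / real m) * c m" using True m k by (intro n1) auto
        then have "u * c n \<le> u * (2 * (real n / real m) * c m)" using u by (intro mult_left_mono) auto
        then have "u * c n \<le> 2 * (real n / real m) * (u * c m)" by (simp add: mult_ac)
        also have "\<dots> \<le> 2 * (real n / real m) * b" using \<open>u * c m \<le> b\<close> by (intro mult_left_mono) auto
        finally show ?thesis using ab by (simp add: field_simps)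
      next
        case False
        then have "u * c n \<le> u * c m" using u n norming_seq_mono[OF c, of n m] by (intro mult_left_mono) auto
        then have "u * c n / (2 * b) \<le> 1" using \<open>u * c m \<le> b\<close> ab by (simp add: field_simps)
        moreover have "0 \<le> real n / real m" by simp
        ultimately show ?thesis by linarith
      qed
      have "real n * ln ?\<phi> \<le> real n * (ln \<rho> / real m)" using lnphi by (intro mult_left_mono) auto
      also have "\<dots> = ln \<rho> * (real n / real m)" by simp
      also have "\<dots> \<le> ln \<rho> * (u * c n / (2 * b) - 1)"
        using ratio \<rho> \<rho>_pos by (intro mult_left_mono_neg) auto
      also have "\<dots> = - ln \<rho> + - (A * c n) * u" by (simp add: A_def algebra_simps)
      finally have "exp (real n * ln ?\<phi>) \<le> exp (- ln \<rho> + - (A * c n) * u)" by simp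
      also have "\<dots> = 1 / \<rho> * exp (- (A * c n) * u)" unfolding exp_add using \<rho>_pos by (simp add: exp_minus inverse_eq_divide)
      also have "exp (real n * ln ?\<phi>) = cmod (walk_char n u)" using \<phi> 
        by (simp add: walk_char_eq[of n] norm_power exp_of_nat_mult)
      finally show ?thesis .
    qed
  qed
  define C where "C = 4 * (1 / \<rho>) / (\<epsilon> * A)"
  have "measure P {\<omega>. walk 0 \<omega> n \<in> {y..y+1}} \<le> C / c n" if n: "n \<ge> 1" for n y
  proof -
    have cn: "c n > 0" using n by (rule norming_seq_pos[OF c])
    let ?D = "distr P borel (\<lambda>\<omega>. walk 0 \<omega> n)"
    have "measure ?D {y..y+1} \<le> 4 * (1 / \<rho>) / (\<epsilon> * (A * c n))"
    proof (rule concentration_char)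
      fix u :: real assume u: "\<bar>u\<bar> \<le> \<epsilon>"
      have "char ?D u = walk_char n u" unfolding char_def walk_char_def by (simp add: integral_distr)
      moreover have "cmod (walk_char n u) = cmod (walk_char n \<bar>u\<bar>)"
        by (cases "u \<ge> 0") (auto simp: cmod_walk_char_minus abs_if)
      moreover have "cmod (walk_char n \<bar>u\<bar>) \<le> 1 / \<rho> * exp (- (A * c n) * \<bar>u\<bar>)"
      proof (cases "u = 0")
        case True
        have "1 \<le> 1 / \<rho>" using \<rho> \<rho>_pos by simp
        then show ?thesis using True cmod_walk_char_le_1[of n 0] by simp
      qed (use bound[OF n, of "\<bar>u\<bar>"] u in auto)
      ultimately show "cmod (char ?D u) \<le> 1 / \<rho> * exp (- (A * c n) * \<bar>u\<bar>)" by simp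
    qed (use \<epsilon> A cn \<rho>_pos in \<open>auto intro!: rd\<close>)
    also have "measure ?D {y..y+1} = measure P {\<omega>. walk 0 \<omega> n \<in> {y..y+1}}"
      by (subst measure_distr) (auto simp: vimage_def)
    finally show ?thesis by (simp add: C_def)
  qed
  moreover have "C > 0" using \<rho>_pos \<epsilon> A by (simp add: C_def)
  ultimately show ?thesis by blast
qed

end

section \<open>Renewal functions and local bounds\<close>

lemma strict_min_rev_seq:
  "(\<forall>i\<in>{1..n}. walk 0 (rev_seq n \<omega>) i < 0) \<longleftrightarrow> (\<forall>i<n. walk 0 \<omega> n < walk 0 \<omega> i)"
proof safe
  fix i assume *: "\<forall>i\<in>{1..n}. walk 0 (rev_seq n \<omega>) i < 0" and "i < n"
  then show "walk 0 \<omega> n < walk 0 \<omega> i"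
    using *[THEN bspec, of "n - i"] by (simp add: walk_rev_seq)
qed (auto simp: walk_rev_seq)

context iid_env
begin

lemma nn_prob_cmult:
  "Measurable.pred P A \<Longrightarrow> (\<integral>\<^sup>+\<omega>. a * (if A \<omega> then 1 else 0) \<partial>P) = a * ennreal (measure P {\<omega>. A \<omega>})"
  by (simp add: nn_integral_cmult nn_integral_prob_eq)

lemma nn_prob_multc:
  "Measurable.pred P A \<Longrightarrow> (\<integral>\<^sup>+\<omega>. (if A \<omega> then 1 else 0) * d \<partial>P) = ennreal (measure P {\<omega>. A \<omega>}) * d"
  by (simp add: nn_integral_multc nn_integral_prob_eq)

end

context oscillating_env
begin

abbreviation "U \<equiv> renewal_U P"
abbreviation "V \<equiv> renewal_V P"

lemma U_term_nonneg: "0 \<le> U_term x k"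
  by (simp add: U_term_def)

lemma V_term_nonneg: "0 \<le> V_term x k"
  by (simp add: V_term_def)

lemma U_summable: "x \<ge> 0 \<Longrightarrow> summable (U_term x)"
  using U_term_bounded[of x] U_term_nonneg
  by (auto simp: lessThan_Suc_atMost[symmetric] intro!: bounded_imp_summable)

lemma V_summable: "x < 0 \<Longrightarrow> summable (V_term x)"
  using V_term_bounded[of x] V_term_nonneg
  by (auto simp: lessThan_Suc_atMost[symmetric] intro!: bounded_imp_summable)

lemma U_term_0: "x \<ge> 0 \<Longrightarrow> U_term x 0 = 1"
  using P.prob_space by (simp add: U_term_def)

lemma V_term_0: "x < 0 \<Longrightarrow> V_term x 0 = 1"
  using P.prob_space by (simp add: V_term_def)

lemma U_eq: "x \<ge> 0 \<Longrightarrow> U x = (\<Sum>k. U_term x k)"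
proof -
  assume x: "x \<ge> 0"
  have "measure P {\<omega> \<in> space P. walk 0 \<omega> (Suc k) \<ge> - x \<and> walk_max 0 \<omega> (Suc k) < 0} = U_term x (Suc k)" for k
    by (simp add: U_term_def walk_max_neg_iff)
  then show ?thesis
    using suminf_split_head[OF U_summable[OF x]] x U_term_0[OF x] by (simp add: renewal_U_def)
qed

lemma walk_min_zero_nonneg_iff: "walk_min 0 \<omega> n \<ge> 0 \<longleftrightarrow> (\<forall>i\<in>{1..n}. walk 0 \<omega> i \<ge> 0)"
  unfolding walk_min_nonneg_iff
proof safe
  fix i assume "\<forall>i\<in>{1..n}. walk 0 \<omega> i \<ge> 0" "i \<le> n"
  then show "0 \<le> walk 0 \<omega> i" by (cases "i = 0") auto
qed auto

lemma V_eq: "x < 0 \<Longrightarrow> V x = (\<Sum>k. V_term x k)"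
proof -
  assume x: "x < 0"
  have "measure P {\<omega> \<in> space P. walk 0 \<omega> (Suc k) < - x \<and> walk_min 0 \<omega> (Suc k) \<ge> 0} = V_term x (Suc k)" for k
    by (simp add: V_term_def walk_min_zero_nonneg_iff)
  then show ?thesis
    using suminf_split_head[OF V_summable[OF x]] x V_term_0[OF x] by (simp add: renewal_V_def)
qed

lemma V_0: "V 0 = 1"
proof -
  have "{\<omega> \<in> space P. walk 0 \<omega> (Suc k) < - 0 \<and> walk_min 0 \<omega> (Suc k) \<ge> 0} = {}" for k
    by (force simp: walk_min_zero_nonneg_iff)
  then show ?thesis by (simp only: renewal_V_def) simp
qed

lemma U_neg: "x < 0 \<Longrightarrow> U x = 0"
  by (simp add: renewal_U_def)

lemma V_pos: "x > 0 \<Longrightarrow> V x = 0"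
  by (simp add: renewal_V_def)

lemma U_term_mono: "x \<le> y \<Longrightarrow> U_term x k \<le> U_term y k"
  unfolding U_term_def by (rule P.finite_measure_mono) (force, intro pred_sets, measurable)

lemma V_term_antimono: "x \<le> y \<Longrightarrow> V_term y k \<le> V_term x k"
  unfolding V_term_def by (rule P.finite_measure_mono) (force, intro pred_sets, measurable)

lemma U_partial: "x \<ge> 0 \<Longrightarrow> (\<Sum>k\<le>n. U_term x k) \<le> U x"
  unfolding U_eq using U_summable U_term_nonneg by (intro sum_le_suminf) auto

lemma V_partial: "x < 0 \<Longrightarrow> (\<Sum>k\<le>n. V_term x k) \<le> V x"
  unfolding V_eq using V_summable V_term_nonneg by (intro sum_le_suminf) auto

lemma U_ge_1: "x \<ge> 0 \<Longrightarrow> U x \<ge> 1"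
  using U_partial[of x 0] U_term_0[of x] by simp

lemma V_ge_1: "x \<le> 0 \<Longrightarrow> V x \<ge> 1"
  using V_partial[of x 0] V_term_0[of x] V_0 by (cases "x = 0") auto

lemma U_nonneg: "U x \<ge> 0"
  using U_ge_1[of x] U_neg[of x] by (cases "x \<ge> 0") auto

lemma V_nonneg: "V x \<ge> 0"
  using V_ge_1[of x] V_pos[of x] by (cases "x \<le> 0") auto

lemma U_mono: "mono U"
proof (rule monoI)
  fix x y :: real assume xy: "x \<le> y"
  show "U x \<le> U y"
  proof (cases "x \<ge> 0")
    case True
    then show ?thesis using xy U_summable[of x] U_summable[of y]
      by (simp add: U_eq suminf_le U_term_mono)
  next
    case False
    then show ?thesis using U_neg U_nonneg by simp
  qed
qed

lemma V_antimono: "antimono V"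
proof (rule antimonoI)
  fix x y :: real assume xy: "x \<le> y"
  consider "y < 0" | "y = 0" | "y > 0" by linarith
  then show "V y \<le> V x"
  proof cases
    case 1
    then show ?thesis using xy V_summable[of x] V_summable[of y]
      by (simp add: V_eq suminf_le V_term_antimono)
  next
    case 2
    then show ?thesis using xy V_0 V_ge_1 by simp
  next
    case 3
    then show ?thesis using V_pos V_nonneg by simp
  qed
qed

lemma U_meas [measurable]: "U \<in> borel_measurable borel"
  using U_mono by (rule borel_measurable_mono)

lemma V_meas [measurable]: "V \<in> borel_measurable borel"
proof -
  have "mono (\<lambda>x. - V x)" using V_antimono by (auto simp: mono_def antimono_def)
  then have "(\<lambda>x. - V x) \<in> borel_measurable borel" by (rule borel_measurable_mono)
  then have "(\<lambda>x. - (- V x)) \<in> borel_measurable borel" by measurable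
  then show ?thesis by simp
qed

lemma stay_nonneg_bound:
  assumes x: "x \<ge> 0"
  shows "(real n + 1) * stay_nonneg x n \<le> U x * (\<Sum>j\<le>n. stay_nonneg 0 j)"
proof -
  have "(real n + 1) * stay_nonneg x n \<le> (\<Sum>k\<le>n. U_term x k) * (\<Sum>j\<le>n. stay_nonneg 0 j)"
    using stay_nonneg_decomposition[OF x] U_term_nonneg stay_nonneg_antimono
    by (intro convolution_average_bound) (auto simp: stay_nonneg_def)
  also have "\<dots> \<le> U x * (\<Sum>j\<le>n. stay_nonneg 0 j)"
    using U_partial[OF x] by (intro mult_right_mono sum_nonneg) (auto simp: stay_nonneg_def)
  finally show ?thesis .
qed

lemma stay_neg_bound:
  assumes x: "x \<le> 0"
  shows "(real n + 1) * stay_neg x n \<le> V x * (\<Sum>j\<le>n. stay_neg 0 j)"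
proof (cases "x = 0")
  case True
  have "(real n + 1) * stay_neg 0 n = (\<Sum>j\<le>n. stay_neg 0 n)" by simp
  also have "\<dots> \<le> (\<Sum>j\<le>n. stay_neg 0 j)" by (intro sum_mono stay_neg_antimono) auto
  finally show ?thesis using True V_0 by simp
next
  case False
  with x have x: "x < 0" by simp
  have "(real n + 1) * stay_neg x n \<le> (\<Sum>k\<le>n. V_term x k) * (\<Sum>j\<le>n. stay_neg 0 j)"
    using stay_neg_decomposition[OF x] V_term_nonneg stay_neg_antimono
    by (intro convolution_average_bound) (auto simp: stay_neg_def)
  also have "\<dots> \<le> V x * (\<Sum>j\<le>n. stay_neg 0 j)"
    using V_partial[OF x] by (intro mult_right_mono sum_nonneg) (auto simp: stay_neg_def)
  finally show ?thesis .
qed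

lemma stay_product_bound:
  assumes "x \<le> 0" "y \<ge> 0"
  shows "stay_neg x n * stay_nonneg y n \<le> 2 * (V x * U y) / (real n + 1)"
proof -
  let ?B = "\<Sum>j\<le>n. stay_neg 0 j" and ?A = "\<Sum>j\<le>n. stay_nonneg 0 j"
  have "((real n + 1) * stay_neg x n) * ((real n + 1) * stay_nonneg y n) \<le> (V x * ?B) * (U y * ?A)"
    using assms by (intro mult_mono stay_neg_bound stay_nonneg_bound mult_nonneg_nonneg V_nonneg sum_nonneg)
       (auto simp: stay_neg_def stay_nonneg_def)
  also have "\<dots> = (V x * U y) * (?B * ?A)" by (simp add: mult_ac)
  also have "\<dots> \<le> (V x * U y) * (2 * real n + 1)"
    by (intro mult_left_mono sum_stay_mult_le mult_nonneg_nonneg V_nonneg U_nonneg)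
  also have "\<dots> \<le> (V x * U y) * (2 * (real n + 1))"
    by (intro mult_left_mono mult_nonneg_nonneg V_nonneg U_nonneg) auto
  finally have "(real n + 1) * ((real n + 1) * (stay_neg x n * stay_nonneg y n)) \<le> (real n + 1) * (2 * (V x * U y))"
    by (simp only: mult_ac)
  then have "(real n + 1) * (stay_neg x n * stay_nonneg y n) \<le> 2 * (V x * U y)"
    by (rule mult_left_le_imp_le) auto
  then show ?thesis by (simp add: field_simps)
qed

text \<open>The path is cut into three blocks. The first block keeps the walk negative, the last one,
  read backwards, stays above \<open>- (b + 1)\<close>, and the middle one has to hit an interval of length 1.\<close>

lemma local_prob_le:
  assumes conc: "\<And>y. measure P {\<omega>. walk 0 \<omega> g \<in> {y..y+1}} \<le> D"
    and h: "h \<ge> 1" and b: "b \<ge> - 1"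
  shows "measure P {\<omega>. (\<forall>i\<in>{1..h + (h + g)}. walk x \<omega> i < 0) \<and> - walk x \<omega> (h + (h + g)) \<in> {b..<b+1}}
     \<le> stay_neg x h * stay_nonneg (b + 1) h * D"
proof -
  define E where "E \<omega> \<longleftrightarrow> (\<forall>i\<in>{1..h + (h + g)}. walk x \<omega> i < 0) \<and> - walk x \<omega> (h + (h + g)) \<in> {b..<b+1}" for \<omega>
  have [measurable]: "Measurable.pred P E" unfolding E_def by measurable
  have D: "D \<ge> 0" using conc[of 0] measure_nonneg order_trans by blast
  have E_imp: "(\<forall>i\<in>{1..h}. walk x \<omega> i < 0) \<and> (\<forall>i\<in>{1..h}. walk (b + 1) \<omega>' i \<ge> 0)
      \<and> walk 0 \<omega>'' g \<in> {- b - 1 - x - walk 0 \<omega> h - walk 0 \<omega>' h .. - b - 1 - x - walk 0 \<omega> h - walk 0 \<omega>' h + 1}"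
    if "E (comb_seq h \<omega> (rev_seq (h + g) (comb_seq h \<omega>' \<omega>'')))" for \<omega> \<omega>' \<omega>''
  proof -
    let ?\<zeta> = "comb_seq h \<omega>' \<omega>''" and ?w = "comb_seq h \<omega> (rev_seq (h + g) (comb_seq h \<omega>' \<omega>''))"
    have e1: "\<And>i. i \<in> {1..h + (h + g)} \<Longrightarrow> walk x ?w i < 0" and e2: "- walk x ?w (h + (h + g)) \<in> {b..<b+1}"
      using that unfolding E_def by auto
    have wm: "walk x ?w (h + (h + g)) = walk x \<omega> h + walk 0 \<omega>' h + walk 0 \<omega>'' g"
      by (simp add: walk_comb_seq_add walk_rev_seq)
    have 1: "walk x \<omega> i < 0" if "i \<in> {1..h}" for i
      using e1[of i] that by (simp add: walk_comb_seq_le)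
    have 2: "walk (b + 1) \<omega>' i \<ge> 0" if i: "i \<in> {1..h}" for i
    proof -
      have "walk x ?w (h + (h + g - i)) < 0" using i h by (intro e1) auto
      moreover have "walk x ?w (h + (h + g - i)) = walk x ?w (h + (h + g)) - walk 0 \<omega>' i"
      proof -
        have "walk 0 (rev_seq (h + g) ?\<zeta>) (h + g - i) = walk 0 ?\<zeta> (h + g) - walk 0 ?\<zeta> i"
          using i walk_rev_seq[of "h + g - i" "h + g" 0 ?\<zeta>] by simp
        then show ?thesis
          using i unfolding wm walk_comb_seq_add by (simp add: walk_comb_seq_add walk_comb_seq_le walk_rev_seq)
      qed
      ultimately show ?thesis using e2 by (simp add: walk_start[of "b + 1"])
    qed
    show ?thesis using 1 2 e2 unfolding wm by (auto simp: walk_start[of x])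
  qed
  have "ennreal (measure P {\<omega>. E \<omega>}) = (\<integral>\<^sup>+\<omega>. (if E \<omega> then 1 else 0) \<partial>P)"
    by (simp add: nn_integral_prob_eq)
  also have "\<dots> = (\<integral>\<^sup>+\<omega>. (\<integral>\<^sup>+\<zeta>. (if E (comb_seq h \<omega> \<zeta>) then 1 else 0) \<partial>P) \<partial>P)"
    by (rule nn_integral_split) measurable
  also have "\<dots> = (\<integral>\<^sup>+\<omega>. (\<integral>\<^sup>+\<zeta>. (if E (comb_seq h \<omega> (rev_seq (h + g) \<zeta>)) then 1 else 0) \<partial>P) \<partial>P)"
    by (intro nn_integral_cong nn_integral_rev_seq[symmetric]) measurable
  also have "\<dots> = (\<integral>\<^sup>+\<omega>. (\<integral>\<^sup>+\<omega>'. (\<integral>\<^sup>+\<omega>''. (if E (comb_seq h \<omega> (rev_seq (h + g) (comb_seq h \<omega>' \<omega>''))) then 1 else 0) \<partial>P) \<partial>P) \<partial>P)"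
    by (intro nn_integral_cong nn_integral_split) measurable
  also have "\<dots> \<le> (\<integral>\<^sup>+\<omega>. (\<integral>\<^sup>+\<omega>'. (if \<forall>i\<in>{1..h}. walk x \<omega> i < 0 then 1 else 0) *
       ((if \<forall>i\<in>{1..h}. walk (b + 1) \<omega>' i \<ge> 0 then 1 else 0) * ennreal D) \<partial>P) \<partial>P)"
  proof (intro nn_integral_mono)
    fix \<omega> \<omega>' :: "nat \<Rightarrow> nat pmf"
    let ?y = "- b - 1 - x - walk 0 \<omega> h - walk 0 \<omega>' h"
    have "(\<integral>\<^sup>+\<omega>''. (if E (comb_seq h \<omega> (rev_seq (h + g) (comb_seq h \<omega>' \<omega>''))) then 1 else 0) \<partial>P)
       \<le> (\<integral>\<^sup>+\<omega>''. ((if \<forall>i\<in>{1..h}. walk x \<omega> i < 0 then 1 else 0) * (if \<forall>i\<in>{1..h}. walk (b + 1) \<omega>' i \<ge> 0 then 1 else 0))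
           * (if walk 0 \<omega>'' g \<in> {?y..?y+1} then 1 else 0) \<partial>P)"
      by (intro nn_integral_mono) (use E_imp[of \<omega> \<omega>'] in auto)
    also have "\<dots> = ((if \<forall>i\<in>{1..h}. walk x \<omega> i < 0 then 1 else 0) * (if \<forall>i\<in>{1..h}. walk (b + 1) \<omega>' i \<ge> 0 then 1 else 0))
           * ennreal (measure P {\<omega>. walk 0 \<omega> g \<in> {?y..?y+1}})"
      by (rule nn_prob_cmult) measurable
    also have "\<dots> \<le> ((if \<forall>i\<in>{1..h}. walk x \<omega> i < 0 then 1 else 0) * (if \<forall>i\<in>{1..h}. walk (b + 1) \<omega>' i \<ge> 0 then 1 else 0)) * ennreal D"
      by (intro mult_left_mono ennreal_leI conc) auto
    finally show "(\<integral>\<^sup>+\<omega>''. (if E (comb_seq h \<omega> (rev_seq (h + g) (comb_seq h \<omega>' \<omega>''))) then 1 else 0) \<partial>P)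
       \<le> (if \<forall>i\<in>{1..h}. walk x \<omega> i < 0 then 1 else 0) * ((if \<forall>i\<in>{1..h}. walk (b + 1) \<omega>' i \<ge> 0 then 1 else 0) * ennreal D)"
      by (simp only: mult.assoc)
  qed
  also have "\<dots> = (\<integral>\<^sup>+\<omega>. (if \<forall>i\<in>{1..h}. walk x \<omega> i < 0 then 1 else 0) * (ennreal (stay_nonneg (b + 1) h) * ennreal D) \<partial>P)"
    unfolding stay_nonneg_def
  proof (intro nn_integral_cong)
    fix \<omega>
    show "(\<integral>\<^sup>+\<omega>'. (if \<forall>i\<in>{1..h}. walk x \<omega> i < 0 then 1 else 0) *
         ((if \<forall>i\<in>{1..h}. walk (b + 1) \<omega>' i \<ge> 0 then 1 else 0) * ennreal D) \<partial>P)
       = (if \<forall>i\<in>{1..h}. walk x \<omega> i < 0 then 1 else 0) *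
         (ennreal (measure P {\<omega>. \<forall>i\<in>{1..h}. walk (b + 1) \<omega> i \<ge> 0}) * ennreal D)"
      by (cases "\<forall>i\<in>{1..h}. walk x \<omega> i < 0") (simp_all add: nn_prob_multc)
  qed
  also have "\<dots> = ennreal (stay_neg x h) * (ennreal (stay_nonneg (b + 1) h) * ennreal D)"
    unfolding stay_neg_def by (rule nn_prob_multc) measurable
  also have "\<dots> = ennreal (stay_neg x h * stay_nonneg (b + 1) h * D)"
    using D by (simp add: ennreal_mult stay_neg_def stay_nonneg_def mult.assoc)
  finally have "measure P {\<omega>. E \<omega>} \<le> stay_neg x h * stay_nonneg (b + 1) h * D"
    using D by (subst (asm) ennreal_le_iff) (auto simp: stay_neg_def stay_nonneg_def)
  then show ?thesis unfolding E_def .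
qed

end

locale attracted_env = oscillating_env +
  fixes \<alpha> :: real and c :: "nat \<Rightarrow> real"
  assumes \<alpha>_gt_1: "1 < \<alpha>" and attr: "attracted_to_stable P \<alpha> c"
begin

lemma norming: "norming_seq \<alpha> c"
  using attr by (simp add: attracted_to_stable_def)

lemma c_pos: "n \<ge> 1 \<Longrightarrow> c n > 0"
  by (rule norming_seq_pos[OF norming])

lemma walk_concentration: "\<exists>C>0. \<forall>n\<ge>1. \<forall>y. measure P {\<omega>. walk 0 \<omega> n \<in> {y..y+1}} \<le> C / c n"
proof -
  obtain \<mu> where \<mu>: "stable_law \<alpha> \<mu>" "weak_conv_m (\<lambda>n. distr P borel (\<lambda>\<omega>. walk 0 \<omega> n / c n)) \<mu>"
    using attr unfolding attracted_to_stable_def by blast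
  then show ?thesis
    by (intro concentration[OF norming \<alpha>_gt_1]) (auto simp: stable_law_def)
qed

lemma local_bound:
  "\<exists>C>0. \<exists>m0\<ge>1. \<forall>m\<ge>m0. \<forall>x\<le>0. \<forall>b.
     measure P {\<omega>. (\<forall>i\<in>{1..m}. walk x \<omega> i < 0) \<and> - walk x \<omega> m \<in> {b..<b+1}}
       \<le> C * V x * U (b + 1) / (real m * c m)"
proof -
  obtain C where C: "C > 0" "\<And>n y. n \<ge> 1 \<Longrightarrow> measure P {\<omega>. walk 0 \<omega> n \<in> {y..y+1}} \<le> C / c n"
    using walk_concentration by blast
  obtain n0 where n0: "n0 \<ge> 1" "\<And>n m. n \<ge> n0 \<Longrightarrow> m \<ge> n \<Longrightarrow> c m \<le> 2 * (real m / real n) * c n"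
    using norming_seq_linear_growth[OF norming \<alpha>_gt_1] by blast
  have "measure P {\<omega>. (\<forall>i\<in>{1..m}. walk x \<omega> i < 0) \<and> - walk x \<omega> m \<in> {b..<b+1}}
       \<le> (60 * C) * V x * U (b + 1) / (real m * c m)"
    if m: "m \<ge> 3 * n0" and x: "x \<le> 0" for m x b
  proof (cases "b \<ge> - 1")
    case True
    define h where "h = m div 3"
    obtain r where r: "m = 3 * h + r" "r < 3"
      using div_mult_mod_eq[of m 3] by (intro that[of "m mod 3"]) (simp_all add: h_def)
    have h_ge: "h \<ge> n0" using m r by linarith
    define g where "g = m - 2 * h"
    have h: "h \<ge> n0" "h \<ge> 1" "m = h + (h + g)" "g \<ge> h" "g \<le> m" "m \<le> 5 * h" "m \<le> 3 * h + 3"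
      using h_ge n0(1) r unfolding g_def by linarith+
    have "measure P {\<omega>. (\<forall>i\<in>{1..h + (h + g)}. walk x \<omega> i < 0) \<and> - walk x \<omega> (h + (h + g)) \<in> {b..<b+1}}
        \<le> stay_neg x h * stay_nonneg (b + 1) h * (C / c g)"
      using h True C(2)[of g] by (intro local_prob_le) auto
    also have "\<dots> \<le> (2 * (V x * U (b + 1)) / (real h + 1)) * (C / c g)"
      using x True C(1) c_pos[of g] h by (intro mult_right_mono stay_product_bound) auto
    also have "\<dots> \<le> (2 * (V x * U (b + 1)) * (3 / real m)) * (C * (10 / c m))"
    proof (intro mult_mono)
      have "real m \<le> 3 * (real h + 1)" using of_nat_mono[OF h(7), where 'a=real] by simp
      then have "1 / (real h + 1) \<le> 3 / real m" using h by (simp add: field_simps)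
      then have "2 * (V x * U (b + 1)) * (1 / (real h + 1)) \<le> 2 * (V x * U (b + 1)) * (3 / real m)"
        by (intro mult_left_mono mult_nonneg_nonneg V_nonneg U_nonneg) auto
      then show "2 * (V x * U (b + 1)) / (real h + 1) \<le> 2 * (V x * U (b + 1)) * (3 / real m)" by simp
      have "c m \<le> 2 * (real m / real g) * c g" using h by (intro n0) auto
      also have "\<dots> \<le> 2 * 5 * c g"
      proof (intro mult_right_mono mult_left_mono)
        have "real m \<le> 5 * real h" using of_nat_mono[OF h(6), where 'a=real] by simp
        also have "\<dots> \<le> 5 * real g" using h by simp
        finally show "real m / real g \<le> 5" using h by (simp add: field_simps)
      qed (use c_pos[of g] h in auto)
      finally have "1 / c g \<le> 10 / c m" using c_pos[of g] c_pos[of m] h by (simp add: field_simps)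
      then have "C * (1 / c g) \<le> C * (10 / c m)" using C(1) by (intro mult_left_mono) auto
      then show "C / c g \<le> C * (10 / c m)" by simp
      show "0 \<le> 2 * (V x * U (b + 1)) * (3 / real m)"
        by (intro mult_nonneg_nonneg V_nonneg U_nonneg) auto
      show "0 \<le> C / c g" using C(1) c_pos[of g] h by simp
    qed
    also have "\<dots> = (60 * C) * V x * U (b + 1) / (real m * c m)" by simp
    finally show ?thesis using h(3) by simp
  next
    case False
    have "m \<ge> 1" using m n0(1) by simp
    then have empty: "{\<omega>. (\<forall>i\<in>{1..m}. walk x \<omega> i < 0) \<and> - walk x \<omega> m \<in> {b..<b+1}} = {}"
      using False by force
    show ?thesis unfolding empty using False U_neg[of "b + 1"] by simp
  qed
  then show ?thesis using C(1) n0(1) by (intro exI[of _ "60 * C"] conjI exI[of _ "3 * n0"]) auto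
qed

end

lemma exp_le_suminf_strips:
  fixes s \<theta> :: real
  assumes "s < 0" "\<theta> > 0"
  shows "ennreal (exp (\<theta> * s)) \<le> (\<Sum>j. ennreal (exp (- \<theta> * real j)) * (if - s \<in> {real j..<real j + 1} then 1 else 0))"
proof -
  define j where "j = nat \<lfloor>- s\<rfloor>"
  have j: "- s \<in> {real j..<real j + 1}"
    using assms by (auto simp: j_def)
  then have "\<theta> * s \<le> - \<theta> * real j"
    using assms mult_left_mono[of s "- real j" \<theta>] by simp
  then have "ennreal (exp (\<theta> * s)) \<le> ennreal (exp (- \<theta> * real j))" by (intro ennreal_leI) simp
  also have "\<dots> = (\<Sum>i\<in>{j}. ennreal (exp (- \<theta> * real i)) * (if - s \<in> {real i..<real i + 1} then 1 else 0))"
    using j by simp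
  also have "\<dots> \<le> (\<Sum>i. ennreal (exp (- \<theta> * real i)) * (if - s \<in> {real i..<real i + 1} then 1 else 0))"
    by (rule sum_le_suminf) auto
  finally show ?thesis .
qed

context oscillating_env
begin

lemma plus_law_nn:
  assumes R: "plus_law P x R" and x: "x \<ge> 0"
    and \<psi>: "\<psi> \<in> borel_measurable (env_vec k)" "\<And>v. 0 \<le> \<psi> v" "\<And>v. \<psi> v \<le> B"
  shows "ennreal (U x) * (\<integral>\<^sup>+\<omega>. ennreal (\<psi> (first_envs k \<omega>)) \<partial>R) =
    (\<integral>\<^sup>+\<omega>. (if \<forall>i\<le>k. walk x \<omega> i \<ge> 0 then ennreal (\<psi> (first_envs k \<omega>) * U (walk x \<omega> k)) else 0) \<partial>P)"
proof -
  interpret R: prob_space R using R by (simp add: plus_law_def)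
  have sets_R: "sets R = sets P" using R sets_P by (simp add: plus_law_def)
  note [measurable] = \<psi>(1)
  have [measurable]: "(\<lambda>\<omega>. \<psi> (first_envs k \<omega>)) \<in> borel_measurable R"
    by (subst measurable_cong_sets[OF sets_R refl]) measurable
  have eq: "(\<integral>\<omega>. \<psi> (first_envs k \<omega>) \<partial>R) = 1 / U x * (\<integral>\<omega>. \<psi> (first_envs k \<omega>) * U (walk x \<omega> k)
                             * indicator {\<omega>. walk_min x \<omega> k \<ge> 0} \<omega> \<partial>P)"
    if "\<psi> \<in> borel_measurable (env_vec k)" "\<And>v. 0 \<le> \<psi> v" "\<And>v. \<psi> v \<le> B" for \<psi> B
  proof -
    have "bounded (\<psi> ` space (env_vec k))"
      using that by (auto intro!: boundedI[where B=B])
    then show ?thesis using R that(1) unfolding plus_law_def by blast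
  qed
  have Ux: "U x > 0" using U_ge_1[OF x] by linarith
  let ?g = "\<lambda>\<omega>. U (walk x \<omega> k) * (if \<forall>i\<le>k. walk x \<omega> i \<ge> 0 then 1 else 0)"
  have ind: "indicator {\<omega>. walk_min x \<omega> k \<ge> 0} \<omega> = (if \<forall>i\<le>k. walk x \<omega> i \<ge> 0 then 1 else 0 :: real)" for \<omega>
    by (simp add: walk_min_nonneg_iff indicator_def)
  have "1 = 1 / U x * (\<integral>\<omega>. ?g \<omega> \<partial>P)"
    using eq[of "\<lambda>_. 1" 1] R.prob_space by (simp add: ind)
  then have "(\<integral>\<omega>. ?g \<omega> \<partial>P) \<noteq> 0" by auto
  then have int_g: "integrable P ?g" using not_integrable_integral_eq by blast
  let ?f = "\<lambda>\<omega>. \<psi> (first_envs k \<omega>) * U (walk x \<omega> k) * (if \<forall>i\<le>k. walk x \<omega> i \<ge> 0 then 1 else 0)"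
  have int_f: "integrable P ?f"
  proof (rule Bochner_Integration.integrable_bound)
    show "integrable P (\<lambda>\<omega>. B * ?g \<omega>)" using int_g by simp
    show "AE \<omega> in P. norm (?f \<omega>) \<le> norm (B * ?g \<omega>)"
    proof (rule AE_I2)
      fix \<omega>
      have "0 \<le> B" using \<psi>(2,3) order_trans by blast
      then show "norm (?f \<omega>) \<le> norm (B * ?g \<omega>)"
        using \<psi>(2,3)[of "first_envs k \<omega>"] U_nonneg[of "walk x \<omega> k"] by (simp add: abs_mult mult_right_mono)
    qed
  qed measurable
  have f_nonneg: "0 \<le> ?f \<omega>" for \<omega> using \<psi>(2) U_nonneg by simp
  have "ennreal (U x) * (\<integral>\<^sup>+\<omega>. ennreal (\<psi> (first_envs k \<omega>)) \<partial>R) = ennreal (U x) * ennreal (\<integral>\<omega>. \<psi> (first_envs k \<omega>) \<partial>R)"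
    by (subst nn_integral_eq_integral) (use \<psi> in \<open>auto intro!: R.integrable_const_bound[where B=B]\<close>)
  also have "\<dots> = ennreal (U x * (\<integral>\<omega>. \<psi> (first_envs k \<omega>) \<partial>R))"
    using Ux \<psi>(2) by (simp add: ennreal_mult)
  also have "U x * (\<integral>\<omega>. \<psi> (first_envs k \<omega>) \<partial>R) = (\<integral>\<omega>. ?f \<omega> \<partial>P)"
    using eq[OF \<psi>] Ux by (simp add: ind)
  also have "ennreal \<dots> = (\<integral>\<^sup>+\<omega>. ennreal (?f \<omega>) \<partial>P)"
    using int_f f_nonneg by (subst nn_integral_eq_integral) auto
  also have "\<dots> = (\<integral>\<^sup>+\<omega>. (if \<forall>i\<le>k. walk x \<omega> i \<ge> 0 then ennreal (\<psi> (first_envs k \<omega>) * U (walk x \<omega> k)) else 0) \<partial>P)"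
    by (intro nn_integral_cong) auto
  finally show ?thesis .
qed

lemma minus_law_nn:
  assumes R: "minus_law P 0 R" and k: "k \<ge> 1"
    and \<psi>: "\<psi> \<in> borel_measurable (env_vec k)" "\<And>v. 0 \<le> \<psi> v" "\<And>v. \<psi> v \<le> B"
  shows "(\<integral>\<^sup>+\<omega>. ennreal (\<psi> (first_envs k \<omega>)) \<partial>R) =
    (\<integral>\<^sup>+\<omega>. (if \<forall>i\<in>{1..k}. walk 0 \<omega> i < 0 then ennreal (\<psi> (first_envs k \<omega>) * V (walk 0 \<omega> k)) else 0) \<partial>P)"
proof -
  interpret R: prob_space R using R by (simp add: minus_law_def)
  have sets_R: "sets R = sets P" using R sets_P by (simp add: minus_law_def)
  note [measurable] = \<psi>(1)
  have [measurable]: "(\<lambda>\<omega>. \<psi> (first_envs k \<omega>)) \<in> borel_measurable R"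
    by (subst measurable_cong_sets[OF sets_R refl]) measurable
  have eq: "(\<integral>\<omega>. \<psi> (first_envs k \<omega>) \<partial>R) = 1 / V 0 * (\<integral>\<omega>. \<psi> (first_envs k \<omega>) * V (walk 0 \<omega> k)
                             * indicator {\<omega>. walk_max 0 \<omega> k < 0} \<omega> \<partial>P)"
    if "\<psi> \<in> borel_measurable (env_vec k)" "\<And>v. 0 \<le> \<psi> v" "\<And>v. \<psi> v \<le> B" for \<psi> B
  proof -
    have "bounded (\<psi> ` space (env_vec k))"
      using that by (auto intro!: boundedI[where B=B])
    then show ?thesis using R k that(1) unfolding minus_law_def by blast
  qed
  let ?g = "\<lambda>\<omega>. V (walk 0 \<omega> k) * (if \<forall>i\<in>{1..k}. walk 0 \<omega> i < 0 then 1 else 0)"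
  have ind: "indicator {\<omega>. walk_max 0 \<omega> k < 0} \<omega> = (if \<forall>i\<in>{1..k}. walk 0 \<omega> i < 0 then 1 else 0 :: real)" for \<omega>
    by (simp add: walk_max_neg_iff[OF k] indicator_def)
  have "1 = (\<integral>\<omega>. ?g \<omega> \<partial>P)"
    using eq[of "\<lambda>_. 1" 1] R.prob_space V_0 by (simp add: ind)
  then have "(\<integral>\<omega>. ?g \<omega> \<partial>P) \<noteq> 0" by auto
  then have int_g: "integrable P ?g" using not_integrable_integral_eq by blast
  let ?f = "\<lambda>\<omega>. \<psi> (first_envs k \<omega>) * V (walk 0 \<omega> k) * (if \<forall>i\<in>{1..k}. walk 0 \<omega> i < 0 then 1 else 0)"
  have int_f: "integrable P ?f"
  proof (rule Bochner_Integration.integrable_bound)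
    show "integrable P (\<lambda>\<omega>. B * ?g \<omega>)" using int_g by simp
    show "AE \<omega> in P. norm (?f \<omega>) \<le> norm (B * ?g \<omega>)"
    proof (rule AE_I2)
      fix \<omega>
      have "0 \<le> B" using \<psi>(2,3) order_trans by blast
      then show "norm (?f \<omega>) \<le> norm (B * ?g \<omega>)"
        using \<psi>(2,3)[of "first_envs k \<omega>"] V_nonneg[of "walk 0 \<omega> k"] by (simp add: abs_mult mult_right_mono)
    qed
  qed measurable
  have f_nonneg: "0 \<le> ?f \<omega>" for \<omega> using \<psi>(2) V_nonneg by simp
  have "(\<integral>\<^sup>+\<omega>. ennreal (\<psi> (first_envs k \<omega>)) \<partial>R) = ennreal (\<integral>\<omega>. \<psi> (first_envs k \<omega>) \<partial>R)"
    by (subst nn_integral_eq_integral) (use \<psi> in \<open>auto intro!: R.integrable_const_bound[where B=B]\<close>)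
  also have "(\<integral>\<omega>. \<psi> (first_envs k \<omega>) \<partial>R) = (\<integral>\<omega>. ?f \<omega> \<partial>P)"
    using eq[OF \<psi>] V_0 by (simp add: ind)
  also have "ennreal \<dots> = (\<integral>\<^sup>+\<omega>. ennreal (?f \<omega>) \<partial>P)"
    using int_f f_nonneg by (subst nn_integral_eq_integral) auto
  also have "\<dots> = (\<integral>\<^sup>+\<omega>. (if \<forall>i\<in>{1..k}. walk 0 \<omega> i < 0 then ennreal (\<psi> (first_envs k \<omega>) * V (walk 0 \<omega> k)) else 0) \<partial>P)"
    by (intro nn_integral_cong) auto
  finally show ?thesis .
qed

lemma all_walk_neg_comb_seq:
  "(\<forall>i\<in>{1..k + m}. walk x (comb_seq k \<omega> \<omega>') i < 0) \<longleftrightarrow>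
   (\<forall>i\<in>{1..k}. walk x \<omega> i < 0) \<and> (\<forall>i\<in>{1..m}. walk (walk x \<omega> k) \<omega>' i < 0)"
proof (intro iffI conjI ballI)
  fix i assume *: "\<forall>i\<in>{1..k + m}. walk x (comb_seq k \<omega> \<omega>') i < 0" and i: "i \<in> {1..k}"
  show "walk x \<omega> i < 0" using *[THEN bspec, of i] i by (simp add: walk_comb_seq_le)
next
  fix i assume *: "\<forall>i\<in>{1..k + m}. walk x (comb_seq k \<omega> \<omega>') i < 0" and i: "i \<in> {1..m}"
  show "walk (walk x \<omega> k) \<omega>' i < 0"
    using *[THEN bspec, of "k + i"] i by (simp add: walk_comb_seq_add walk_start[of "walk x \<omega> k"])
next
  fix i assume *: "(\<forall>i\<in>{1..k}. walk x \<omega> i < 0) \<and> (\<forall>i\<in>{1..m}. walk (walk x \<omega> k) \<omega>' i < 0)" and i: "i \<in> {1..k + m}"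
  show "walk x (comb_seq k \<omega> \<omega>') i < 0"
  proof (cases "i \<le> k")
    case True
    then show ?thesis using * i by (simp add: walk_comb_seq_le)
  next
    case False
    then obtain j where j: "i = k + j" "j \<in> {1..m}" using i by (intro that[of "i - k"]) auto
    with * have "walk (walk x \<omega> k) \<omega>' j < 0" by blast
    then show ?thesis unfolding j(1) walk_comb_seq_add walk_start[of "walk x \<omega> k"] .
  qed
qed

lemma prob_strict_min:
  assumes [measurable]: "Measurable.pred borel B"
  shows "measure P {\<omega>. (\<forall>i<m. walk 0 \<omega> m < walk 0 \<omega> i) \<and> B (walk 0 \<omega> m)}
     = measure P {\<omega>. (\<forall>i\<in>{1..m}. walk 0 \<omega> i < 0) \<and> B (walk 0 \<omega> m)}"
proof -
  have "measure P {\<omega>. (\<forall>i\<in>{1..m}. walk 0 (rev_seq m \<omega>) i < 0) \<and> B (walk 0 (rev_seq m \<omega>) m)}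
     = measure P {\<omega>. (\<forall>i\<in>{1..m}. walk 0 \<omega> i < 0) \<and> B (walk 0 \<omega> m)}"
    by (rule prob_rev_seq) measurable
  then show ?thesis unfolding strict_min_rev_seq by (simp add: walk_rev_seq)
qed

end

context attracted_env
begin

definition strip_sum :: "real \<Rightarrow> ennreal" where
  "strip_sum \<theta> = (\<Sum>j. ennreal (exp (- \<theta> * real j)) * ennreal (U (real j + 1)))"

lemma exp_walk_bounds:
  assumes \<theta>: "\<theta> > 0"
  shows "\<exists>C>0. \<exists>m0\<ge>1. \<forall>m\<ge>m0. \<forall>k. \<forall>a\<in>borel_measurable (env_vec k).
    (\<integral>\<^sup>+\<omega>. (if \<forall>i\<in>{1..k+m}. walk 0 \<omega> i < 0 then a (first_envs k \<omega>) * ennreal (exp (\<theta> * walk 0 \<omega> (k + m))) else 0) \<partial>P)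
      \<le> ennreal (C / (real m * c m)) * strip_sum \<theta> *
        (\<integral>\<^sup>+\<omega>. (if \<forall>i\<in>{1..k}. walk 0 \<omega> i < 0 then a (first_envs k \<omega>) * ennreal (V (walk 0 \<omega> k)) else 0) \<partial>P) \<and>
    (\<integral>\<^sup>+\<omega>. (if \<forall>i<k+m. walk 0 \<omega> (k + m) < walk 0 \<omega> i then a (first_envs k \<omega>) * ennreal (exp (\<theta> * walk 0 \<omega> (k + m))) else 0) \<partial>P)
      \<le> ennreal (C / (real m * c m)) * (\<Sum>j. ennreal (exp (- \<theta> * real j)) *
        (\<integral>\<^sup>+\<omega>. (if \<forall>i\<le>k. walk (real j + 1) \<omega> i \<ge> 0 then a (first_envs k \<omega>) * ennreal (U (walk (real j + 1) \<omega> k)) else 0) \<partial>P))"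
proof -
  obtain C m0 where C: "C > 0" "m0 \<ge> 1" "\<And>m x b. m \<ge> m0 \<Longrightarrow> x \<le> 0 \<Longrightarrow>
     measure P {\<omega>. (\<forall>i\<in>{1..m}. walk x \<omega> i < 0) \<and> - walk x \<omega> m \<in> {b..<b+1}}
       \<le> C * V x * U (b + 1) / (real m * c m)"
    using local_bound by blast
  {
    fix m k :: nat and a :: "(nat \<Rightarrow> nat pmf) \<Rightarrow> ennreal"
    assume m: "m \<ge> m0" and [measurable]: "a \<in> borel_measurable (env_vec k)"
    have m1: "m \<ge> 1" using m C by simp
    have cm: "c m > 0" using c_pos m1 by simp
    have C_nonneg: "0 \<le> C / (real m * c m)" using C cm by simp
    have neg: "(\<integral>\<^sup>+\<omega>. (if \<forall>i\<in>{1..m}. walk x \<omega> i < 0 then ennreal (exp (\<theta> * walk x \<omega> m)) else 0) \<partial>P)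
        \<le> ennreal (C / (real m * c m)) * strip_sum \<theta> * ennreal (V x)" if x: "x \<le> 0" for x
    proof -
      have "(\<integral>\<^sup>+\<omega>. (if \<forall>i\<in>{1..m}. walk x \<omega> i < 0 then ennreal (exp (\<theta> * walk x \<omega> m)) else 0) \<partial>P)
        \<le> (\<integral>\<^sup>+\<omega>. (\<Sum>j. ennreal (exp (- \<theta> * real j)) * (if (\<forall>i\<in>{1..m}. walk x \<omega> i < 0) \<and> - walk x \<omega> m \<in> {real j..<real j + 1} then 1 else 0)) \<partial>P)"
      proof (rule nn_integral_mono)
        fix \<omega>
        show "(if \<forall>i\<in>{1..m}. walk x \<omega> i < 0 then ennreal (exp (\<theta> * walk x \<omega> m)) else 0)
          \<le> (\<Sum>j. ennreal (exp (- \<theta> * real j)) * (if (\<forall>i\<in>{1..m}. walk x \<omega> i < 0) \<and> - walk x \<omega> m \<in> {real j..<real j + 1} then 1 else 0))"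
        proof (cases "\<forall>i\<in>{1..m}. walk x \<omega> i < 0")
          case True
          then have "walk x \<omega> m < 0" using m1 by simp
          from exp_le_suminf_strips[OF this \<theta>] show ?thesis using True by simp
        qed (simp only: if_False zero_le)
      qed
      also have "\<dots> = (\<Sum>j. ennreal (exp (- \<theta> * real j)) * ennreal (measure P {\<omega>. (\<forall>i\<in>{1..m}. walk x \<omega> i < 0) \<and> - walk x \<omega> m \<in> {real j..<real j + 1}}))"
        by (subst nn_integral_suminf, measurable, intro suminf_cong nn_prob_cmult, measurable)
      also have "\<dots> \<le> (\<Sum>j. ennreal (exp (- \<theta> * real j)) * (ennreal (C / (real m * c m)) * ennreal (V x) * ennreal (U (real j + 1))))"
      proof (intro suminf_le mult_left_mono summableI)
        fix j
        have "ennreal (measure P {\<omega>. (\<forall>i\<in>{1..m}. walk x \<omega> i < 0) \<and> - walk x \<omega> m \<in> {real j..<real j + 1}})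
          \<le> ennreal (C / (real m * c m) * V x * U (real j + 1))"
          using C(3)[OF m x, of "real j"] by (intro ennreal_leI) (simp add: mult_ac)
        also have "\<dots> = ennreal (C / (real m * c m)) * ennreal (V x) * ennreal (U (real j + 1))"
          by (simp only: ennreal_mult C_nonneg V_nonneg U_nonneg mult_nonneg_nonneg)
        finally show "ennreal (measure P {\<omega>. (\<forall>i\<in>{1..m}. walk x \<omega> i < 0) \<and> - walk x \<omega> m \<in> {real j..<real j + 1}})
          \<le> ennreal (C / (real m * c m)) * ennreal (V x) * ennreal (U (real j + 1))" .
      qed auto
      also have "\<dots> = ennreal (C / (real m * c m)) * strip_sum \<theta> * ennreal (V x)"
        unfolding strip_sum_def ennreal_suminf_cmult[symmetric] ennreal_suminf_multc[symmetric]
        by (intro suminf_cong) (simp only: mult_ac)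
      finally show ?thesis .
    qed
    have 1: "(\<integral>\<^sup>+\<omega>. (if \<forall>i\<in>{1..k+m}. walk 0 \<omega> i < 0 then a (first_envs k \<omega>) * ennreal (exp (\<theta> * walk 0 \<omega> (k + m))) else 0) \<partial>P)
      \<le> ennreal (C / (real m * c m)) * strip_sum \<theta> *
        (\<integral>\<^sup>+\<omega>. (if \<forall>i\<in>{1..k}. walk 0 \<omega> i < 0 then a (first_envs k \<omega>) * ennreal (V (walk 0 \<omega> k)) else 0) \<partial>P)"
      (is "?L \<le> ?K * ?R")
    proof -
      have "?L = (\<integral>\<^sup>+\<omega>. (\<integral>\<^sup>+\<omega>'. (if \<forall>i\<in>{1..k+m}. walk 0 (comb_seq k \<omega> \<omega>') i < 0
           then a (first_envs k (comb_seq k \<omega> \<omega>')) * ennreal (exp (\<theta> * walk 0 (comb_seq k \<omega> \<omega>') (k + m))) else 0) \<partial>P) \<partial>P)"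
        by (rule nn_integral_split) measurable
      also have "\<dots> \<le> (\<integral>\<^sup>+\<omega>. ?K * (if \<forall>i\<in>{1..k}. walk 0 \<omega> i < 0 then a (first_envs k \<omega>) * ennreal (V (walk 0 \<omega> k)) else 0) \<partial>P)"
      proof (rule nn_integral_mono)
        fix \<omega>
        show "(\<integral>\<^sup>+\<omega>'. (if \<forall>i\<in>{1..k+m}. walk 0 (comb_seq k \<omega> \<omega>') i < 0
           then a (first_envs k (comb_seq k \<omega> \<omega>')) * ennreal (exp (\<theta> * walk 0 (comb_seq k \<omega> \<omega>') (k + m))) else 0) \<partial>P)
          \<le> ?K * (if \<forall>i\<in>{1..k}. walk 0 \<omega> i < 0 then a (first_envs k \<omega>) * ennreal (V (walk 0 \<omega> k)) else 0)"
        proof (cases "\<forall>i\<in>{1..k}. walk 0 \<omega> i < 0")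
          case True
          then have x: "walk 0 \<omega> k \<le> 0" by (cases "k = 0") (auto simp: less_imp_le)
          have "(\<integral>\<^sup>+\<omega>'. (if \<forall>i\<in>{1..k+m}. walk 0 (comb_seq k \<omega> \<omega>') i < 0
             then a (first_envs k (comb_seq k \<omega> \<omega>')) * ennreal (exp (\<theta> * walk 0 (comb_seq k \<omega> \<omega>') (k + m))) else 0) \<partial>P)
            = (\<integral>\<^sup>+\<omega>'. a (first_envs k \<omega>) * (if \<forall>i\<in>{1..m}. walk (walk 0 \<omega> k) \<omega>' i < 0 then ennreal (exp (\<theta> * walk (walk 0 \<omega> k) \<omega>' m)) else 0) \<partial>P)"
            using True by (intro nn_integral_cong)
              (simp add: all_walk_neg_comb_seq first_envs_comb_seq walk_comb_seq_add walk_start[of "walk 0 \<omega> k"] del: One_nat_def)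
          also have "\<dots> = a (first_envs k \<omega>) * (\<integral>\<^sup>+\<omega>'. (if \<forall>i\<in>{1..m}. walk (walk 0 \<omega> k) \<omega>' i < 0 then ennreal (exp (\<theta> * walk (walk 0 \<omega> k) \<omega>' m)) else 0) \<partial>P)"
            by (rule nn_integral_cmult) measurable
          also have "\<dots> \<le> a (first_envs k \<omega>) * (?K * ennreal (V (walk 0 \<omega> k)))"
            by (intro mult_left_mono neg x) auto
          finally show ?thesis using True by (simp add: mult_ac)
        next
          case False
          then show ?thesis
            by (simp only: all_walk_neg_comb_seq simp_thms if_False nn_integral_const mult_zero_left zero_le)
        qed
      qed
      also have "\<dots> = ?K * ?R" by (rule nn_integral_cmult) measurable
      finally show ?thesis .
    qed
    have 2: "(\<integral>\<^sup>+\<omega>. (if \<forall>i<k+m. walk 0 \<omega> (k + m) < walk 0 \<omega> i then a (first_envs k \<omega>) * ennreal (exp (\<theta> * walk 0 \<omega> (k + m))) else 0) \<partial>P)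
      \<le> ennreal (C / (real m * c m)) * (\<Sum>j. ennreal (exp (- \<theta> * real j)) *
        (\<integral>\<^sup>+\<omega>. (if \<forall>i\<le>k. walk (real j + 1) \<omega> i \<ge> 0 then a (first_envs k \<omega>) * ennreal (U (walk (real j + 1) \<omega> k)) else 0) \<partial>P))"
      (is "?L \<le> ?K * ?R")
    proof -
      let ?D = "\<lambda>\<omega> j. if \<forall>i\<le>k. walk (real j + 1) \<omega> i \<ge> 0 then a (first_envs k \<omega>) * ennreal (U (walk (real j + 1) \<omega> k)) else 0"
      let ?E = "\<lambda>\<omega> j \<omega>'. (\<forall>i<m. walk 0 \<omega>' m < walk 0 \<omega>' i) \<and> - walk 0 \<omega>' m \<in> {real j + walk 0 \<omega> k..<real j + walk 0 \<omega> k + 1}"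
      have "?L = (\<integral>\<^sup>+\<omega>. (\<integral>\<^sup>+\<omega>'. (if \<forall>i<k+m. walk 0 (comb_seq k \<omega> \<omega>') (k + m) < walk 0 (comb_seq k \<omega> \<omega>') i
           then a (first_envs k (comb_seq k \<omega> \<omega>')) * ennreal (exp (\<theta> * walk 0 (comb_seq k \<omega> \<omega>') (k + m))) else 0) \<partial>P) \<partial>P)"
        by (rule nn_integral_split) measurable
      also have "\<dots> \<le> (\<integral>\<^sup>+\<omega>. (\<Sum>j. ?K * (ennreal (exp (- \<theta> * real j)) * ?D \<omega> j)) \<partial>P)"
      proof (rule nn_integral_mono)
        fix \<omega>
        have "(\<integral>\<^sup>+\<omega>'. (if \<forall>i<k+m. walk 0 (comb_seq k \<omega> \<omega>') (k + m) < walk 0 (comb_seq k \<omega> \<omega>') i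
           then a (first_envs k (comb_seq k \<omega> \<omega>')) * ennreal (exp (\<theta> * walk 0 (comb_seq k \<omega> \<omega>') (k + m))) else 0) \<partial>P)
          \<le> (\<integral>\<^sup>+\<omega>'. (\<Sum>j. (if \<forall>i\<le>k. walk (real j + 1) \<omega> i \<ge> 0 then ennreal (exp (- \<theta> * real j)) * a (first_envs k \<omega>) else 0)
               * (if ?E \<omega> j \<omega>' then 1 else 0)) \<partial>P)"
        proof (rule nn_integral_mono)
          fix \<omega>'
          let ?w = "comb_seq k \<omega> \<omega>'"
          show "(if \<forall>i<k+m. walk 0 ?w (k + m) < walk 0 ?w i
             then a (first_envs k ?w) * ennreal (exp (\<theta> * walk 0 ?w (k + m))) else 0)
            \<le> (\<Sum>j. (if \<forall>i\<le>k. walk (real j + 1) \<omega> i \<ge> 0 then ennreal (exp (- \<theta> * real j)) * a (first_envs k \<omega>) else 0)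
               * (if ?E \<omega> j \<omega>' then 1 else 0))"
          proof (cases "\<forall>i<k+m. walk 0 ?w (k + m) < walk 0 ?w i")
            case True
            let ?s = "walk 0 ?w (k + m)"
            have s: "?s = walk 0 \<omega> k + walk 0 \<omega>' m" by (rule walk_comb_seq_add)
            have s0: "?s < 0" using True[rule_format, of 0] m1 by simp
            have E1: "\<forall>i<m. walk 0 \<omega>' m < walk 0 \<omega>' i"
            proof (intro allI impI)
              fix i assume "i < m"
              then have "?s < walk 0 ?w (k + i)" using True by simp
              then show "walk 0 \<omega>' m < walk 0 \<omega>' i" unfolding s walk_comb_seq_add by simp
            qed
            have E2: "?s < walk 0 \<omega> i" if "i \<le> k" for i
              using True[rule_format, of i] that m1 by (simp add: walk_comb_seq_le)
            have "a (first_envs k ?w) * ennreal (exp (\<theta> * ?s)) \<le> a (first_envs k \<omega>) * (\<Sum>j. ennreal (exp (- \<theta> * real j)) * (if - ?s \<in> {real j..<real j + 1} then 1 else 0))"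
              unfolding first_envs_comb_seq[OF order_refl] by (intro mult_left_mono exp_le_suminf_strips s0 \<theta>) simp
            also have "\<dots> = (\<Sum>j. a (first_envs k \<omega>) * (ennreal (exp (- \<theta> * real j)) * (if - ?s \<in> {real j..<real j + 1} then 1 else 0)))"
              by simp
            also have "\<dots> \<le> (\<Sum>j. (if \<forall>i\<le>k. walk (real j + 1) \<omega> i \<ge> 0 then ennreal (exp (- \<theta> * real j)) * a (first_envs k \<omega>) else 0)
               * (if ?E \<omega> j \<omega>' then 1 else 0))"
            proof (intro suminf_le summableI)
              fix j
              show "a (first_envs k \<omega>) * (ennreal (exp (- \<theta> * real j)) * (if - ?s \<in> {real j..<real j + 1} then 1 else 0))
                \<le> (if \<forall>i\<le>k. walk (real j + 1) \<omega> i \<ge> 0 then ennreal (exp (- \<theta> * real j)) * a (first_envs k \<omega>) else 0)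
                    * (if ?E \<omega> j \<omega>' then 1 else 0)"
              proof (cases "- ?s \<in> {real j..<real j + 1}")
                case True
                have "\<forall>i\<le>k. walk (real j + 1) \<omega> i \<ge> 0"
                proof (intro allI impI)
                  fix i assume "i \<le> k"
                  from E2[OF this] True show "walk (real j + 1) \<omega> i \<ge> 0"
                    by (simp add: walk_start[of "real j + 1"])
                qed
                moreover have "?E \<omega> j \<omega>'" using E1 True s by auto
                ultimately show ?thesis by (simp add: mult.commute)
              qed (simp only: if_False mult_zero_right zero_le)
            qed
            finally show ?thesis using True by simp
          qed (simp only: if_False zero_le)
        qed
        also have "\<dots> = (\<Sum>j. (if \<forall>i\<le>k. walk (real j + 1) \<omega> i \<ge> 0 then ennreal (exp (- \<theta> * real j)) * a (first_envs k \<omega>) else 0)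
               * ennreal (measure P {\<omega>'. ?E \<omega> j \<omega>'}))"
          by (subst nn_integral_suminf, measurable, intro suminf_cong nn_prob_cmult, measurable)
        also have "\<dots> \<le> (\<Sum>j. ?K * (ennreal (exp (- \<theta> * real j)) * ?D \<omega> j))"
        proof (intro suminf_le summableI)
          fix j
          have "measure P {\<omega>'. ?E \<omega> j \<omega>'} = measure P {\<omega>'. (\<forall>i\<in>{1..m}. walk 0 \<omega>' i < 0) \<and> - walk 0 \<omega>' m \<in> {real j + walk 0 \<omega> k..<real j + walk 0 \<omega> k + 1}}"
            by (rule prob_strict_min) measurable
          also have "\<dots> \<le> C / (real m * c m) * U (walk (real j + 1) \<omega> k)"
            using C(3)[OF m, of 0 "real j + walk 0 \<omega> k"] V_0
            unfolding walk_start[of "real j + 1"] by (simp add: algebra_simps)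
          finally have "ennreal (measure P {\<omega>'. ?E \<omega> j \<omega>'}) \<le> ennreal (C / (real m * c m)) * ennreal (U (walk (real j + 1) \<omega> k))"
            unfolding ennreal_mult[OF C_nonneg U_nonneg, symmetric] by (rule ennreal_leI)
          then have "ennreal (exp (- \<theta> * real j)) * a (first_envs k \<omega>) * ennreal (measure P {\<omega>'. ?E \<omega> j \<omega>'})
             \<le> ennreal (exp (- \<theta> * real j)) * a (first_envs k \<omega>) * (ennreal (C / (real m * c m)) * ennreal (U (walk (real j + 1) \<omega> k)))"
            by (intro mult_left_mono) auto
          also have "\<dots> = ?K * (ennreal (exp (- \<theta> * real j)) * (a (first_envs k \<omega>) * ennreal (U (walk (real j + 1) \<omega> k))))"
            by (simp only: mult_ac)
          finally show "(if \<forall>i\<le>k. walk (real j + 1) \<omega> i \<ge> 0 then ennreal (exp (- \<theta> * real j)) * a (first_envs k \<omega>) else 0)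
               * ennreal (measure P {\<omega>'. ?E \<omega> j \<omega>'}) \<le> ?K * (ennreal (exp (- \<theta> * real j)) * ?D \<omega> j)"
            by simp
        qed
        finally show "(\<integral>\<^sup>+\<omega>'. (if \<forall>i<k+m. walk 0 (comb_seq k \<omega> \<omega>') (k + m) < walk 0 (comb_seq k \<omega> \<omega>') i
           then a (first_envs k (comb_seq k \<omega> \<omega>')) * ennreal (exp (\<theta> * walk 0 (comb_seq k \<omega> \<omega>') (k + m))) else 0) \<partial>P)
           \<le> (\<Sum>j. ?K * (ennreal (exp (- \<theta> * real j)) * ?D \<omega> j))" .
      qed
      also have "\<dots> = (\<Sum>j. \<integral>\<^sup>+\<omega>. ?K * (ennreal (exp (- \<theta> * real j)) * ?D \<omega> j) \<partial>P)"
        by (rule nn_integral_suminf) measurable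
      also have "\<dots> = (\<Sum>j. ?K * (ennreal (exp (- \<theta> * real j)) * (\<integral>\<^sup>+\<omega>. ?D \<omega> j \<partial>P)))"
        by (intro suminf_cong) (simp add: nn_integral_cmult)
      also have "\<dots> = ?K * ?R" by simp
      finally show ?thesis .
    qed
    note 1 2
  }
  then show ?thesis using C(1,2) by (intro exI[of _ C] conjI exI[of _ m0] allI impI ballI) auto
qed

end

section \<open>Vague limits\<close>

lemma moment_convergence:
  fixes X :: "nat \<Rightarrow> 'a \<Rightarrow> real" and w :: "nat \<Rightarrow> 'a \<Rightarrow> real" and Y v :: "'b \<Rightarrow> real"
  assumes w: "\<And>n. integrable A (w n)" "\<And>n x. 0 \<le> w n x"
    and X: "\<And>n. X n \<in> borel_measurable A" "\<And>n x. X n x \<in> {0..1}"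
    and v: "integrable B v" "\<And>x. 0 \<le> v x"
    and Y: "Y \<in> borel_measurable B" "\<And>x. Y x \<in> {0..1}"
    and mom: "\<And>i. (\<lambda>n. \<integral>x. X n x ^ i * w n x \<partial>A) \<longlonglongrightarrow> (\<integral>x. Y x ^ i * v x \<partial>B)"
    and f: "continuous_on UNIV f"
  shows "(\<lambda>n. \<integral>x. f (X n x) * w n x \<partial>A) \<longlonglongrightarrow> (\<integral>x. f (Y x) * v x \<partial>B)"
proof -
  have [measurable]: "f \<in> borel_measurable borel" using f by (rule borel_measurable_continuous_onI)
  note [measurable] = X(1) Y(1)
  have int: "integrable M (\<lambda>x. g (Z x) * u x)"
    if "continuous_on UNIV g" "integrable M u" "Z \<in> borel_measurable M" "\<And>x. Z x \<in> {0..1}"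
    for g :: "real \<Rightarrow> real" and Z u :: "'c \<Rightarrow> real" and M
  proof -
    have [measurable]: "g \<in> borel_measurable borel" "Z \<in> borel_measurable M" "u \<in> borel_measurable M"
      using that by (auto intro: borel_measurable_continuous_onI)
    have "compact (g ` {0..1})"
      by (intro compact_continuous_image continuous_on_subset[OF that(1)]) auto
    then have "bounded (g ` {0..1})" by (rule compact_imp_bounded)
    then obtain D where "\<forall>y\<in>{0..1}. \<bar>g y\<bar> \<le> D"
      by (auto simp: bounded_real simp del: atLeastAtMost_iff)
    then have D: "\<And>y. y \<in> {0..1} \<Longrightarrow> \<bar>g y\<bar> \<le> D" by blast
    show ?thesis
    proof (rule Bochner_Integration.integrable_bound)
      show "integrable M (\<lambda>x. D * u x)" using that by simp
      show "AE x in M. norm (g (Z x) * u x) \<le> norm (D * u x)"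
      proof (rule AE_I2)
        fix x
        have "\<bar>g (Z x)\<bar> \<le> \<bar>D\<bar>" using D[OF that(4)[of x]] by linarith
        then show "norm (g (Z x) * u x) \<le> norm (D * u x)" by (simp add: abs_mult mult_right_mono)
      qed
    qed measurable
  qed
  let ?W = "\<integral>x. v x \<partial>B"
  have W_lim: "(\<lambda>n. \<integral>x. w n x \<partial>A) \<longlonglongrightarrow> ?W" using mom[of 0] by simp
  have W0: "?W \<ge> 0" using v(2) by simp
  show ?thesis
  proof (rule LIMSEQ_I)
    fix r :: real assume r: "r > 0"
    define e where "e = r / (2 * (2 * ?W + 2))"
    have e: "e > 0" using r W0 by (simp add: e_def)
    obtain g where g: "real_polynomial_function g" "\<And>x. x \<in> {0..1} \<Longrightarrow> \<bar>f x - g x\<bar> < e"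
      using Stone_Weierstrass_real_polynomial_function[of "{0..1::real}" f e] e continuous_on_subset[OF f]
      by auto
    obtain a N where a: "g = (\<lambda>x. \<Sum>i\<le>N. a i * x ^ i)"
      using g(1) unfolding real_polynomial_function_iff_sum by blast
    have g_cont: "continuous_on UNIV g" unfolding a by (intro continuous_intros)
    have pow: "integrable M (\<lambda>x. Z x ^ i * u x)"
      if "integrable M u" "Z \<in> borel_measurable M" "\<And>x. Z x \<in> {0..1}"
      for Z u :: "'c \<Rightarrow> real" and M i
      by (rule int[of "\<lambda>x. x ^ i"]) (use that in \<open>auto intro!: continuous_intros\<close>)
    have expand: "(\<integral>x. g (Z x) * u x \<partial>M) = (\<Sum>i\<le>N. a i * (\<integral>x. Z x ^ i * u x \<partial>M))"
      if "integrable M u" "Z \<in> borel_measurable M" "\<And>x. Z x \<in> {0..1}"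
      for Z u :: "'c \<Rightarrow> real" and M
      unfolding a using pow[OF that]
      by (simp add: sum_distrib_right mult.assoc Bochner_Integration.integral_sum)
    have close: "\<bar>(\<integral>x. f (Z x) * u x \<partial>M) - (\<integral>x. g (Z x) * u x \<partial>M)\<bar> \<le> e * (\<integral>x. u x \<partial>M)"
      if u: "integrable M u" "Z \<in> borel_measurable M" "\<And>x. Z x \<in> {0..1}" "\<And>x. 0 \<le> u x"
      for Z u :: "'c \<Rightarrow> real" and M
    proof -
      have i: "integrable M (\<lambda>x. f (Z x) * u x)" "integrable M (\<lambda>x. g (Z x) * u x)"
        using int[OF f u(1,2,3)] int[OF g_cont u(1,2,3)] by auto
      have "\<bar>(\<integral>x. f (Z x) * u x \<partial>M) - (\<integral>x. g (Z x) * u x \<partial>M)\<bar> = \<bar>\<integral>x. f (Z x) * u x - g (Z x) * u x \<partial>M\<bar>"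
        using i by simp
      also have "\<dots> \<le> (\<integral>x. \<bar>f (Z x) * u x - g (Z x) * u x\<bar> \<partial>M)" by (rule integral_abs_bound)
      also have "\<dots> \<le> (\<integral>x. e * u x \<partial>M)"
      proof (rule integral_mono)
        fix x
        have "\<bar>f (Z x) * u x - g (Z x) * u x\<bar> = \<bar>f (Z x) - g (Z x)\<bar> * u x"
          using u(4)[of x] by (simp add: left_diff_distrib[symmetric] abs_mult)
        also have "\<dots> \<le> e * u x" using g(2)[OF u(3)[of x]] u(4)[of x] by (intro mult_right_mono) auto
        finally show "\<bar>f (Z x) * u x - g (Z x) * u x\<bar> \<le> e * u x" .
      qed (use i u in auto)
      finally show ?thesis by simp
    qed
    have "(\<lambda>n. \<Sum>i\<le>N. a i * (\<integral>x. X n x ^ i * w n x \<partial>A)) \<longlonglongrightarrow> (\<Sum>i\<le>N. a i * (\<integral>x. Y x ^ i * v x \<partial>B))"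
      by (intro tendsto_intros mom)
    then have lim: "(\<lambda>n. \<integral>x. g (X n x) * w n x \<partial>A) \<longlonglongrightarrow> (\<integral>x. g (Y x) * v x \<partial>B)"
      using expand[OF v(1) Y] expand[OF w(1) X] by simp
    have "eventually (\<lambda>n. \<bar>(\<integral>x. g (X n x) * w n x \<partial>A) - (\<integral>x. g (Y x) * v x \<partial>B)\<bar> < r / 4) sequentially"
      using tendstoD[OF lim, of "r / 4"] r by (simp add: dist_real_def)
    moreover have "eventually (\<lambda>n. (\<integral>x. w n x \<partial>A) < ?W + 1) sequentially"
      using W_lim by (rule order_tendstoD(2)) simp
    ultimately have "eventually (\<lambda>n. norm ((\<integral>x. f (X n x) * w n x \<partial>A) - (\<integral>x. f (Y x) * v x \<partial>B)) < r) sequentially"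
    proof eventually_elim
      case (elim n)
      have "e * (\<integral>x. w n x \<partial>A) \<le> e * (?W + 1)" using elim e by (intro mult_left_mono) auto
      moreover have "e * (?W + 1) + e * ?W \<le> r / 2"
      proof -
        have "e * (?W + 1) + e * ?W \<le> e * (2 * ?W + 2)" using e by (simp add: algebra_simps)
        also have "\<dots> = r / 2" using W0 by (simp add: e_def field_simps)
        finally show ?thesis .
      qed
      ultimately show ?case
        using close[OF w(1)[of n] X(1)[of n] X(2) w(2)] close[OF v(1) Y v(2)] elim r unfolding real_norm_def by linarith
    qed
    then show "\<exists>n0. \<forall>n\<ge>n0. norm ((\<integral>x. f (X n x) * w n x \<partial>A) - (\<integral>x. f (Y x) * v x \<partial>B)) < r"
      by (simp add: eventually_sequentially)
  qed
qed

lemma asymp_equiv_reciprocal_limit: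
  fixes f r :: "nat \<Rightarrow> real"
  assumes eq: "f \<sim>[sequentially] (\<lambda>n. K / r n * I)" and K: "K > 0"
    and pos: "\<And>n. n \<ge> 1 \<Longrightarrow> f n > 0" and r: "\<And>n. n \<ge> 1 \<Longrightarrow> r n > 0"
  shows "I \<noteq> 0" and "(\<lambda>n. r n * f n) \<longlonglongrightarrow> K * I"
proof -
  have lim: "(\<lambda>n. if f n = 0 \<and> K / r n * I = 0 then 1 else f n / (K / r n * I)) \<longlonglongrightarrow> 1"
    using asymp_equivD[OF eq] .
  have ev: "eventually (\<lambda>n. (if f n = 0 \<and> K / r n * I = 0 then 1 else f n / (K / r n * I)) = f n / (K / r n * I)) sequentially"
    using eventually_ge_at_top[of 1] by eventually_elim (use pos in force)
  have lim2: "(\<lambda>n. f n / (K / r n * I)) \<longlonglongrightarrow> 1"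
    using Lim_transform_eventually[OF lim ev] .
  show I: "I \<noteq> 0"
  proof
    assume "I = 0"
    with lim2 have "(\<lambda>n::nat. 0::real) \<longlonglongrightarrow> 1" by simp
    then show False using LIMSEQ_unique[of "\<lambda>n::nat. 0::real" 0 1] by simp
  qed
  have lim3: "(\<lambda>n. (K * I) * (f n / (K / r n * I))) \<longlonglongrightarrow> (K * I) * 1"
    by (intro tendsto_intros lim2)
  have ev3: "eventually (\<lambda>n. (K * I) * (f n / (K / r n * I)) = r n * f n) sequentially"
    using eventually_ge_at_top[of 1]
  proof eventually_elim
    case (elim n)
    then show ?case using I K r[of n] by (simp add: field_simps)
  qed
  show "(\<lambda>n. r n * f n) \<longlonglongrightarrow> K * I"
    using Lim_transform_eventually[OF lim3 ev3] by simp
qed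

locale local_limit_env = attracted_env +
  fixes K :: real
  assumes K: "asymptotic_constant P c K"
begin

lemma K_pos: "K > 0"
  using K by (simp add: asymptotic_constant_def)

lemma nc_pos: "n \<ge> 1 \<Longrightarrow> real n * c n > 0"
  using c_pos by simp

lemma integral_pos_of_prob_pos:
  fixes f :: "(nat \<Rightarrow> nat pmf) \<Rightarrow> real"
  assumes [measurable]: "Measurable.pred P A" and f: "f \<in> borel_measurable P" 
    and fpos: "\<And>\<omega>. A \<omega> \<Longrightarrow> 0 < f \<omega>" "\<And>\<omega>. A \<omega> \<Longrightarrow> f \<omega> \<le> 1" and prob: "measure P {\<omega>. A \<omega>} > 0"
  shows "integrable P (\<lambda>\<omega>. f \<omega> * (if A \<omega> then 1 else 0))" "0 < (\<integral>\<omega>. f \<omega> * (if A \<omega> then 1 else 0) \<partial>P)"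
proof -
  note [measurable] = f
  show int: "integrable P (\<lambda>\<omega>. f \<omega> * (if A \<omega> then 1 else 0))"
    by (rule P.integrable_const_bound[where B=1]) (use fpos in \<open>auto simp: less_imp_le abs_of_pos\<close>)
  have nn: "0 \<le> f \<omega> * (if A \<omega> then 1 else 0)" for \<omega> using fpos(1)[of \<omega>] by auto
  have "(\<integral>\<omega>. f \<omega> * (if A \<omega> then 1 else 0) \<partial>P) \<noteq> 0"
  proof
    assume "(\<integral>\<omega>. f \<omega> * (if A \<omega> then 1 else 0) \<partial>P) = 0"
    then have "AE \<omega> in P. f \<omega> * (if A \<omega> then 1 else 0) = 0"
      by (subst integral_nonneg_eq_0_iff_AE[OF int, symmetric]) (use nn in auto)
    then have "AE \<omega> in P. \<omega> \<notin> {\<omega>. A \<omega>}"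
      by (rule eventually_mono) (use fpos(1) in fastforce)
    then have "emeasure P {\<omega>. A \<omega>} = 0"
      by (subst AE_iff_measurable[symmetric, where P="\<lambda>\<omega>. \<omega> \<notin> {\<omega>. A \<omega>}"]) (auto intro!: pred_sets)
    then show False using prob by (simp add: measure_def)
  qed
  moreover have "0 \<le> (\<integral>\<omega>. f \<omega> * (if A \<omega> then 1 else 0) \<partial>P)" using nn by (rule Bochner_Integration.integral_nonneg)
  ultimately show "0 < (\<integral>\<omega>. f \<omega> * (if A \<omega> then 1 else 0) \<partial>P)" by simp
qed

lemma strict_min_limit:
  assumes \<theta>: "\<theta> > 0"
  shows "set_integrable lborel {0..} (\<lambda>z. exp (- \<theta> * z) * U z)"
    and "(\<lambda>n. real n * c n * (\<integral>\<omega>. exp (\<theta> * walk 0 \<omega> n) * (if \<forall>i<n. walk 0 \<omega> n < walk 0 \<omega> i then 1 else 0) \<partial>P))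
      \<longlonglongrightarrow> K * (LINT z:{0..}|lborel. exp (- \<theta> * z) * U z)"
proof -
  let ?I = "LINT z:{0..}|lborel. exp (- \<theta> * z) * U z"
  let ?f = "\<lambda>n. \<integral>\<omega>. exp (\<theta> * walk 0 \<omega> n) * (if \<forall>i<n. walk 0 \<omega> n < walk 0 \<omega> i then 1 else 0) \<partial>P"
  have ind: "indicator {\<omega>. first_min 0 \<omega> n = n} \<omega> = (if \<forall>i<n. walk 0 \<omega> n < walk 0 \<omega> i then 1 else 0 :: real)" for \<omega> n
    by (simp add: first_min_eq_iff indicator_def)
  have eq: "?f \<sim>[sequentially] (\<lambda>n. K / (real n * c n) * ?I)"
    using K \<theta> by (simp add: asymptotic_constant_def ind)
  have pos: "?f n > 0" if "n \<ge> 1" for n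
  proof (rule integral_pos_of_prob_pos(2))
    fix \<omega> assume "\<forall>i<n. walk 0 \<omega> n < walk 0 \<omega> i"
    from this[rule_format, of 0] have "walk 0 \<omega> n < 0" using that by simp
    then show "exp (\<theta> * walk 0 \<omega> n) \<le> 1" using \<theta> by (simp add: mult_nonneg_nonpos)
  next
    show "measure P {\<omega>. \<forall>i<n. walk 0 \<omega> n < walk 0 \<omega> i} > 0"
      using prob_strict_min[of "\<lambda>_. True" n] stay_neg_pos[of n] by (simp add: stay_neg_def)
  qed auto
  show "(\<lambda>n. real n * c n * ?f n) \<longlonglongrightarrow> K * ?I"
    using eq K_pos pos nc_pos by (rule asymp_equiv_reciprocal_limit(2))
  have "?I \<noteq> 0"
    using eq K_pos pos nc_pos by (rule asymp_equiv_reciprocal_limit(1))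
  then show "set_integrable lborel {0..} (\<lambda>z. exp (- \<theta> * z) * U z)"
    unfolding set_lebesgue_integral_def set_integrable_def using not_integrable_integral_eq by blast
qed

lemma stay_nonneg_limit:
  assumes \<theta>: "\<theta> > 0" and x: "x \<ge> 0"
  shows "set_integrable lborel {..0} (\<lambda>z. exp (\<theta> * z) * V z)"
    and "integrable P (\<lambda>\<omega>. exp (- \<theta> * walk x \<omega> n) * (if \<forall>i\<le>n. walk x \<omega> i \<ge> 0 then 1 else 0))"
    and "(\<lambda>n. real n * c n * (\<integral>\<omega>. exp (- \<theta> * walk x \<omega> n) * (if \<forall>i\<le>n. walk x \<omega> i \<ge> 0 then 1 else 0) \<partial>P))
      \<longlonglongrightarrow> K * (U x * (LINT z:{..0}|lborel. exp (\<theta> * z) * V z))"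
proof -
  let ?I = "LINT z:{..0}|lborel. exp (\<theta> * z) * V z"
  let ?f = "\<lambda>n. \<integral>\<omega>. exp (- \<theta> * walk x \<omega> n) * (if \<forall>i\<le>n. walk x \<omega> i \<ge> 0 then 1 else 0) \<partial>P"
  have ind: "indicator {\<omega>. walk_min y \<omega> n \<ge> 0} \<omega> = (if \<forall>i\<le>n. walk y \<omega> i \<ge> 0 then 1 else 0 :: real)" for \<omega> n y
    by (simp add: walk_min_nonneg_iff indicator_def)
  have eq: "?f \<sim>[sequentially] (\<lambda>n. K / (real n * c n) * (U x * ?I))"
    using K \<theta> x by (simp add: asymptotic_constant_def ind mult.assoc)
  have prob_pos: "measure P {\<omega>. \<forall>i\<le>n. walk x \<omega> i \<ge> 0} > 0" for n
  proof -
    have "0 < stay_nonneg 0 n" by (rule stay_nonneg_pos)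
    also have "\<dots> \<le> measure P {\<omega>. \<forall>i\<le>n. walk x \<omega> i \<ge> 0}"
      unfolding stay_nonneg_def
    proof (rule P.finite_measure_mono)
      show "{\<omega>. \<forall>i\<in>{1..n}. 0 \<le> walk 0 \<omega> i} \<subseteq> {\<omega>. \<forall>i\<le>n. 0 \<le> walk x \<omega> i}"
      proof safe
        fix \<omega> i assume *: "\<forall>i\<in>{1..n}. 0 \<le> walk 0 \<omega> i" and "i \<le> n"
        then have "0 \<le> walk 0 \<omega> i" by (cases "i = 0") auto
        then show "0 \<le> walk x \<omega> i" using x by (simp add: walk_start[of x])
      qed
    qed (intro pred_sets, measurable)
    finally show ?thesis .
  qed
  have le1: "exp (- \<theta> * walk x \<omega> n) \<le> 1" if "\<forall>i\<le>n. walk x \<omega> i \<ge> 0" for \<omega> n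
    using that \<theta> by (simp add: mult_nonneg_nonneg)
  show "integrable P (\<lambda>\<omega>. exp (- \<theta> * walk x \<omega> n) * (if \<forall>i\<le>n. walk x \<omega> i \<ge> 0 then 1 else 0))"
    by (rule integral_pos_of_prob_pos(1)) (use le1 prob_pos in auto)
  have pos: "?f n > 0" for n
    by (rule integral_pos_of_prob_pos(2)) (use le1 prob_pos in auto)
  show "(\<lambda>n. real n * c n * ?f n) \<longlonglongrightarrow> K * (U x * ?I)"
    using eq K_pos pos nc_pos by (rule asymp_equiv_reciprocal_limit(2))
  have "U x * ?I \<noteq> 0"
    using eq K_pos pos nc_pos by (rule asymp_equiv_reciprocal_limit(1))
  then have "?I \<noteq> 0" by auto
  then show "set_integrable lborel {..0} (\<lambda>z. exp (\<theta> * z) * V z)"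
    unfolding set_lebesgue_integral_def set_integrable_def using not_integrable_integral_eq by blast
qed

lemma reflected_V_integral:
  "(LINT z:{..0}|lborel. exp (\<theta> * z) * V z) = (\<integral>y. (if y \<ge> 0 then exp (- \<theta> * y) * V (- y) else 0) \<partial>lborel)"
proof -
  have "(LINT z:{..0}|lborel. exp (\<theta> * z) * V z) = (\<integral>z. indicator {..0} (0 + (- 1) * z) *\<^sub>R (exp (\<theta> * (0 + (- 1) * z)) * V (0 + (- 1) * z)) \<partial>lborel)"
    unfolding set_lebesgue_integral_def
    by (subst lborel_integral_real_affine[where c="- 1" and t=0]) auto
  also have "\<dots> = (\<integral>y. (if y \<ge> 0 then exp (- \<theta> * y) * V (- y) else 0) \<partial>lborel)"
    by (intro Bochner_Integration.integral_cong) (auto simp: indicator_def)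
  finally show ?thesis .
qed

lemma reflected_V_integrable:
  assumes "\<theta> > 0"
  shows "integrable lborel (\<lambda>y. if y \<ge> 0 then exp (- \<theta> * y) * V (- y) else 0)"
proof -
  have "integrable lborel (\<lambda>z. indicator {..0} z *\<^sub>R (exp (\<theta> * z) * V z))"
    using stay_nonneg_limit(1)[OF assms order_refl] by (simp add: set_integrable_def)
  then have "integrable lborel (\<lambda>z. indicator {..0} (0 + (- 1) * z) *\<^sub>R (exp (\<theta> * (0 + (- 1) * z)) * V (0 + (- 1) * z)))"
    by (rule lborel_integrable_real_affine) simp
  moreover have "(\<lambda>z. indicator {..0} (0 + (- 1) * z) *\<^sub>R (exp (\<theta> * (0 + (- 1) * z)) * V (0 + (- 1) * z)))
     = (\<lambda>y. if y \<ge> 0 then exp (- \<theta> * y) * V (- y) else 0)"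
    by (auto simp: indicator_def fun_eq_iff)
  ultimately show ?thesis by simp
qed

lemma stay_nonneg_vague_limit:
  fixes f :: "real \<Rightarrow> real"
  assumes x: "x \<ge> 0" and f: "continuous_on UNIV f"
  shows "(\<lambda>n. real n * c n * (\<integral>\<omega>. f (exp (- max 0 (walk x \<omega> n))) * (exp (- walk x \<omega> n) * (if \<forall>i\<le>n. walk x \<omega> i \<ge> 0 then 1 else 0)) \<partial>P))
    \<longlonglongrightarrow> K * U x * (\<integral>y. f (exp (- max 0 y)) * (if y \<ge> 0 then exp (- y) * V (- y) else 0) \<partial>lborel)"
proof -
  let ?w = "\<lambda>n \<omega>. real n * c n * (exp (- walk x \<omega> n) * (if \<forall>i\<le>n. walk x \<omega> i \<ge> 0 then 1 else 0))"
  let ?w' = "\<lambda>n \<omega>. if n = 0 then 0 else ?w n \<omega>"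
  let ?v = "\<lambda>y. K * U x * (if y \<ge> 0 then exp (- y) * V (- y) else 0)"
  have int_w: "integrable P (\<lambda>\<omega>. exp (- walk x \<omega> n) * (if \<forall>i\<le>n. walk x \<omega> i \<ge> 0 then 1 else 0))" for n
    using stay_nonneg_limit(2)[OF zero_less_one x, of n] by simp
  have int_v: "integrable lborel (\<lambda>y. if y \<ge> 0 then exp (- y) * V (- y) else 0)"
    using reflected_V_integrable[OF zero_less_one] by (simp only: mult_minus1)
  have "(\<lambda>n. \<integral>\<omega>. f (exp (- max 0 (walk x \<omega> n))) * ?w' n \<omega> \<partial>P) \<longlonglongrightarrow> (\<integral>y. f (exp (- max 0 y)) * ?v y \<partial>lborel)"
  proof (rule moment_convergence[where X="\<lambda>n \<omega>. exp (- max 0 (walk x \<omega> n))" and w="?w'"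
        and Y="\<lambda>y. exp (- max 0 y)" and v="?v"])
    show "integrable P (?w' n)" for n using int_w[of n] by (cases "n = 0") auto
    show "0 \<le> ?w' n \<omega>" for n \<omega> using nc_pos[of n] by (auto simp: less_imp_le)
    show "integrable lborel ?v" using int_v by simp
    show "0 \<le> ?v y" for y using K_pos U_nonneg V_nonneg by simp
    fix i :: nat
    have "(\<lambda>n. real n * c n * (\<integral>\<omega>. exp (- (real i + 1) * walk x \<omega> n) * (if \<forall>i\<le>n. walk x \<omega> i \<ge> 0 then 1 else 0) \<partial>P))
      \<longlonglongrightarrow> K * (U x * (LINT z:{..0}|lborel. exp ((real i + 1) * z) * V z))"
      by (rule stay_nonneg_limit(3)) (use x in auto)
    also have "K * (U x * (LINT z:{..0}|lborel. exp ((real i + 1) * z) * V z)) = (\<integral>y. exp (- max 0 y) ^ i * ?v y \<partial>lborel)"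
      unfolding reflected_V_integral integral_mult_right_zero[symmetric]
      by (intro Bochner_Integration.integral_cong) (auto simp: exp_of_nat_mult[symmetric] exp_add[symmetric] algebra_simps)
    finally have lim: "(\<lambda>n. real n * c n * (\<integral>\<omega>. exp (- (real i + 1) * walk x \<omega> n) * (if \<forall>i\<le>n. walk x \<omega> i \<ge> 0 then 1 else 0) \<partial>P))
      \<longlonglongrightarrow> (\<integral>y. exp (- max 0 y) ^ i * ?v y \<partial>lborel)" .
    have "real n * c n * (\<integral>\<omega>. exp (- (real i + 1) * walk x \<omega> n) * (if \<forall>i\<le>n. walk x \<omega> i \<ge> 0 then 1 else 0) \<partial>P)
      = (\<integral>\<omega>. exp (- max 0 (walk x \<omega> n)) ^ i * ?w' n \<omega> \<partial>P)" for n
    proof (cases "n = 0")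
      case False
      then show ?thesis
        unfolding integral_mult_right_zero[symmetric]
        by (intro Bochner_Integration.integral_cong) (auto simp: exp_of_nat_mult[symmetric] exp_add[symmetric] algebra_simps)
    qed simp
    with lim show "(\<lambda>n. \<integral>\<omega>. exp (- max 0 (walk x \<omega> n)) ^ i * ?w' n \<omega> \<partial>P) \<longlonglongrightarrow> (\<integral>y. exp (- max 0 y) ^ i * ?v y \<partial>lborel)"
      by simp
  qed (use f in \<open>auto\<close>)
  moreover have "(\<integral>\<omega>. f (exp (- max 0 (walk x \<omega> n))) * ?w' n \<omega> \<partial>P) = real n * c n * (\<integral>\<omega>. f (exp (- max 0 (walk x \<omega> n))) * (exp (- walk x \<omega> n) * (if \<forall>i\<le>n. walk x \<omega> i \<ge> 0 then 1 else 0)) \<partial>P)" for n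
    by (cases "n = 0") (simp, simp add: mult.left_commute[of "f _"] flip: integral_mult_right_zero)
  moreover have "(\<integral>y. f (exp (- max 0 y)) * ?v y \<partial>lborel) = K * U x * (\<integral>y. f (exp (- max 0 y)) * (if y \<ge> 0 then exp (- y) * V (- y) else 0) \<partial>lborel)"
    unfolding integral_mult_right_zero[symmetric] by (intro Bochner_Integration.integral_cong) auto
  ultimately show ?thesis by simp
qed

lemma nc_shift: "(\<lambda>n. (real (n + d) * c (n + d)) / (real n * c n)) \<longlonglongrightarrow> 1"
proof -
  have l: "(\<lambda>n. 1 + real d * (1 / real n)) \<longlonglongrightarrow> 1 + real d * 0"
    by (intro tendsto_intros lim_1_over_n)
  have e: "eventually (\<lambda>n. 1 + real d * (1 / real n) = real (n + d) / real n) sequentially"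
    using eventually_ge_at_top[of 1] by eventually_elim (simp add: field_simps)
  have "(\<lambda>n. real (n + d) / real n) \<longlonglongrightarrow> 1"
    using Lim_transform_eventually[OF l e] by simp
  from tendsto_mult[OF this norming_seq_shift[OF norming \<alpha>_gt_1, of d]] show ?thesis by simp
qed

lemma local_liminf:
  assumes x: "x \<ge> 0" and ab: "0 \<le> a" "a < b"
  shows "ennreal (K * U x * V (- a) * (b - a)) \<le>
    liminf (\<lambda>n. ennreal (real n * c n) * ennreal (measure P {\<omega>. (\<forall>i\<le>n-d. walk x \<omega> i \<ge> 0) \<and> walk x \<omega> (n - d) \<in> {a<..<b}}))"
  unfolding le_Liminf_iff
proof (intro allI impI)
  let ?p = "\<lambda>n. measure P {\<omega>. (\<forall>i\<le>n. walk x \<omega> i \<ge> 0) \<and> walk x \<omega> n \<in> {a<..<b}}"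
  fix y assume y: "y < ennreal (K * U x * V (- a) * (b - a))"
  define D where "D = K * U x * V (- a)"
  have D: "D > 0" unfolding D_def using K_pos U_ge_1[OF x] V_ge_1[of "- a"] ab by simp
  obtain r where r: "y = ennreal r" "0 \<le> r" using y by (cases y) (auto simp: top_unique)
  have rD: "r < D * (b - a)" using y r by (simp add: D_def ennreal_less_iff)
  define \<eta> where "\<eta> = ((b - a) - r / D) / 4"
  have \<eta>: "\<eta> > 0" "r < D * (b - a - 2 * \<eta>)" "4 * \<eta> \<le> b - a"
  proof -
    have *: "r / D < b - a" using rD D by (simp add: field_simps)
    then show "\<eta> > 0" by (simp add: \<eta>_def)
    have "r / D < b - a - 2 * \<eta>" using * unfolding \<eta>_def diff_divide_distrib right_diff_distrib by argo
    then show "r < D * (b - a - 2 * \<eta>)" using D by (simp add: field_simps)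
    show "4 * \<eta> \<le> b - a" using D r by (simp add: \<eta>_def)
  qed
  define h where "h y = min 1 (max 0 (min (y - a) (b - y) / \<eta>))" for y
  define f where "f u = h (- ln (max u (exp (- b)))) / max u (exp (- b))" for u
  have h01: "0 \<le> h y" "h y \<le> 1" for y by (auto simp: h_def)
  have h_out: "h y = 0" if "y \<notin> {a<..<b}" for y
  proof -
    have "min (y - a) (b - y) / \<eta> \<le> 0" using that \<eta>(1) by (intro divide_nonpos_pos) auto
    then show ?thesis by (simp add: h_def)
  qed
  have h_in: "h y = 1" if "y \<in> {a+\<eta>..b-\<eta>}" for y
  proof -
    have "min (y - a) (b - y) / \<eta> \<ge> 1" using that \<eta>(1) by simp
    then show ?thesis by (simp add: h_def)
  qed
  have [measurable]: "h \<in> borel_measurable borel" unfolding h_def by measurable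
  have max_pos: "max u (exp (- b)) > 0" for u using exp_gt_zero[of "- b"] by (simp add: less_max_iff_disj)
  have max_ne: "max u (exp (- b)) \<noteq> 0" for u using max_pos[of u] by simp
  have f_cont: "continuous_on UNIV f"
    unfolding f_def h_def using max_ne \<eta>(1) by (intro continuous_intros) auto
  have fh: "f (exp (- max 0 y)) * exp (- y) = h y" if "y \<ge> 0" for y
  proof (cases "y \<le> b")
    case True
    then have "max (exp (- y)) (exp (- b)) = exp (- y)" by simp
    then show ?thesis using that by (simp add: f_def)
  next
    case False
    then have "max (exp (- y)) (exp (- b)) = exp (- b)" by simp
    then show ?thesis using that False h_out[of y] h_out[of b] by (simp add: f_def)
  qed
  have "(\<lambda>n. real n * c n * (\<integral>\<omega>. f (exp (- max 0 (walk x \<omega> n))) * (exp (- walk x \<omega> n) * (if \<forall>i\<le>n. walk x \<omega> i \<ge> 0 then 1 else 0)) \<partial>P))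
    \<longlonglongrightarrow> K * U x * (\<integral>y. f (exp (- max 0 y)) * (if y \<ge> 0 then exp (- y) * V (- y) else 0) \<partial>lborel)"
    by (rule stay_nonneg_vague_limit[OF x f_cont])
  also have "(\<lambda>n. real n * c n * (\<integral>\<omega>. f (exp (- max 0 (walk x \<omega> n))) * (exp (- walk x \<omega> n) * (if \<forall>i\<le>n. walk x \<omega> i \<ge> 0 then 1 else 0)) \<partial>P))
     = (\<lambda>n. real n * c n * (\<integral>\<omega>. h (walk x \<omega> n) * (if \<forall>i\<le>n. walk x \<omega> i \<ge> 0 then 1 else 0) \<partial>P))"
  proof (rule ext)
    fix n
    have "f (exp (- max 0 (walk x \<omega> n))) * (exp (- walk x \<omega> n) * (if \<forall>i\<le>n. walk x \<omega> i \<ge> 0 then 1 else 0))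
       = h (walk x \<omega> n) * (if \<forall>i\<le>n. walk x \<omega> i \<ge> 0 then 1 else 0)" for \<omega>
      using fh[of "walk x \<omega> n"] by (simp flip: mult.assoc)
    then show "real n * c n * (\<integral>\<omega>. f (exp (- max 0 (walk x \<omega> n))) * (exp (- walk x \<omega> n) * (if \<forall>i\<le>n. walk x \<omega> i \<ge> 0 then 1 else 0)) \<partial>P)
     = real n * c n * (\<integral>\<omega>. h (walk x \<omega> n) * (if \<forall>i\<le>n. walk x \<omega> i \<ge> 0 then 1 else 0) \<partial>P)"
      by (simp only:)
  qed
  also have "(\<integral>y. f (exp (- max 0 y)) * (if y \<ge> 0 then exp (- y) * V (- y) else 0) \<partial>lborel) = (\<integral>y. h y * V (- y) \<partial>lborel)"
  proof (intro Bochner_Integration.integral_cong refl)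
    fix y show "f (exp (- max 0 y)) * (if y \<ge> 0 then exp (- y) * V (- y) else 0) = h y * V (- y)"
      using fh[of y] h_out[of y] ab by (cases "y \<ge> 0") (auto simp flip: mult.assoc)
  qed
  finally have lim: "(\<lambda>n. real n * c n * (\<integral>\<omega>. h (walk x \<omega> n) * (if \<forall>i\<le>n. walk x \<omega> i \<ge> 0 then 1 else 0) \<partial>P))
    \<longlonglongrightarrow> K * U x * (\<integral>y. h y * V (- y) \<partial>lborel)" .
  have V_b: "V (- y) \<le> V (- b)" if "y \<le> b" for y using V_antimono that by (simp add: antimono_def)
  have V_a: "V (- a) \<le> V (- y)" if "a \<le> y" for y using V_antimono that by (simp add: antimono_def)
  have "V (- a) * (b - a - 2 * \<eta>) = (\<integral>y. indicator {a+\<eta>..b-\<eta>} y * V (- a) \<partial>lborel)"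
    using \<eta> by simp
  also have "\<dots> \<le> (\<integral>y. h y * V (- y) \<partial>lborel)"
  proof (rule integral_mono)
    show "integrable lborel (\<lambda>y. indicator {a+\<eta>..b-\<eta>} y * V (- a))"
      by (intro integrable_mult_left integrable_real_indicator) (use \<eta> in auto)
    have "integrable lborel (\<lambda>y. indicator {a..b} y * V (- b))"
      by (intro integrable_mult_left integrable_real_indicator) (use ab in auto)
    then show "integrable lborel (\<lambda>y. h y * V (- y))"
    proof (rule Bochner_Integration.integrable_bound)
      show "AE y in lborel. norm (h y * V (- y)) \<le> norm (indicator {a..b} y * V (- b))"
      proof (rule AE_I2)
        fix y
        show "norm (h y * V (- y)) \<le> norm (indicator {a..b} y * V (- b))"
        proof (cases "y \<in> {a<..<b}")
          case True
          then have "h y * V (- y) \<le> 1 * V (- b)" using h01 V_b[of y] V_nonneg by (intro mult_mono) auto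
          then show ?thesis using True h01 V_nonneg by (simp add: abs_mult)
        qed (simp add: h_out)
      qed
    qed measurable
    fix y
    show "indicator {a+\<eta>..b-\<eta>} y * V (- a) \<le> h y * V (- y)"
      using h_in[of y] V_a[of y] \<eta> h01 V_nonneg by (auto simp: indicator_def)
  qed
  finally have "D * (b - a - 2 * \<eta>) \<le> K * U x * (\<integral>y. h y * V (- y) \<partial>lborel)"
    unfolding D_def using K_pos U_nonneg[of x] by (simp add: mult.assoc mult_left_mono)
  then have rlim: "r < K * U x * (\<integral>y. h y * V (- y) \<partial>lborel)" using \<eta>(2) by linarith
  let ?q = "\<lambda>n. \<integral>\<omega>. h (walk x \<omega> n) * (if \<forall>i\<le>n. walk x \<omega> i \<ge> 0 then 1 else 0) \<partial>P"
  have qp: "?q n \<le> ?p n" for n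
  proof -
    have "?q n \<le> (\<integral>\<omega>. indicator {\<omega>. (\<forall>i\<le>n. walk x \<omega> i \<ge> 0) \<and> walk x \<omega> n \<in> {a<..<b}} \<omega> \<partial>P)"
    proof (rule integral_mono)
      show "integrable P (\<lambda>\<omega>. h (walk x \<omega> n) * (if \<forall>i\<le>n. walk x \<omega> i \<ge> 0 then 1 else 0))"
        using h01 by (intro P.integrable_const_bound[where B=1]) auto
      show "integrable P (indicator {\<omega>. (\<forall>i\<le>n. walk x \<omega> i \<ge> 0) \<and> walk x \<omega> n \<in> {a<..<b}} :: _ \<Rightarrow> real)"
        by (intro integrable_real_indicator pred_sets) (auto simp: P.emeasure_eq_measure)
      show "h (walk x \<omega> n) * (if \<forall>i\<le>n. walk x \<omega> i \<ge> 0 then 1 else 0) \<le> indicator {\<omega>. (\<forall>i\<le>n. walk x \<omega> i \<ge> 0) \<and> walk x \<omega> n \<in> {a<..<b}} \<omega>" for \<omega>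
        using h01[of "walk x \<omega> n"] h_out[of "walk x \<omega> n"] by (auto simp: indicator_def)
    qed
    then show ?thesis by simp
  qed
  have "(\<lambda>n. (real (n + d) * c (n + d)) / (real n * c n) * (real n * c n * ?q n)) \<longlonglongrightarrow> 1 * (K * U x * (\<integral>y. h y * V (- y) \<partial>lborel))"
    by (intro tendsto_mult nc_shift lim)
  then have "eventually (\<lambda>n. r < (real (n + d) * c (n + d)) / (real n * c n) * (real n * c n * ?q n)) sequentially"
    using rlim by (intro order_tendstoD(1)) auto
  then have "eventually (\<lambda>n. r < real (n + d) * c (n + d) * ?p n) sequentially"
    using eventually_ge_at_top[of 1]
  proof eventually_elim
    case (elim n)
    have "r < real (n + d) * c (n + d) * ?q n" using elim c_pos[of n] by (simp add: mult.assoc)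
    also have "\<dots> \<le> real (n + d) * c (n + d) * ?p n"
      using qp[of n] nc_pos[of "n + d"] elim by (intro mult_left_mono) (auto simp: less_imp_le)
    finally show ?case .
  qed
  then obtain n0 where n0: "\<And>n. n \<ge> n0 \<Longrightarrow> r < real (n + d) * c (n + d) * ?p n"
    unfolding eventually_sequentially by blast
  have "y < ennreal (real n * c n) * ennreal (?p (n - d))" if "n \<ge> n0 + d + 1" for n
  proof -
    have "r < real n * c n * ?p (n - d)" using n0[of "n - d"] that by simp
    then have "y < ennreal (real n * c n * ?p (n - d))" unfolding r(1) using r(2) by (simp add: ennreal_lessI)
    also have "\<dots> = ennreal (real n * c n) * ennreal (?p (n - d))"
      using nc_pos[of n] that by (intro ennreal_mult) (auto simp: less_imp_le)
    finally show ?thesis .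
  qed
  then show "eventually (\<lambda>n. y < ennreal (real n * c n) * ennreal (?p (n - d))) sequentially"
    unfolding eventually_sequentially by blast
qed

end

section \<open>Functionals of finitely many environments\<close>

lemma if_conj_mult_ennreal:
  "(if (A \<and> B) \<and> C then g else 0) = (if A then g else 0) * (if B \<and> C then 1 else (0::ennreal))"
  by simp

lemma nn_integral_if_const_conj:
  "(\<integral>\<^sup>+\<omega>. (if A \<and> B \<omega> then f \<omega> else 0) \<partial>M) = (if A then \<integral>\<^sup>+\<omega>. (if B \<omega> then f \<omega> else 0) \<partial>M else 0)"
  by (cases A) simp_all

lemma mult_liminf_le_ennreal:
  fixes f :: "nat \<Rightarrow> ennreal"
  shows "k * liminf f \<le> liminf (\<lambda>n. k * f n)"
  unfolding liminf_SUP_INF SUP_mult_left_ennreal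
  by (intro SUP_mono) (auto intro!: INF_greatest mult_left_mono INF_lower)

context oscillating_env
begin

lemma V_right_continuous:
  assumes x: "x < 0" and e: "e > 0" "x + e < 0"
  shows "(\<lambda>i. V (x + e / real (Suc i))) \<longlonglongrightarrow> V x"
proof -
  have neg: "x + e / real (Suc i) < 0" for i
  proof -
    have "e / real (Suc i) \<le> e" using e by (simp add: field_simps)
    then show ?thesis using e by linarith
  qed
  have lim: "(\<lambda>i. V_term (x + e / real (Suc i)) k) \<longlonglongrightarrow> V_term x k" for k
  proof -
    let ?A = "\<lambda>i. {\<omega>. walk 0 \<omega> k < - (x + e / real (Suc i)) \<and> (\<forall>i\<in>{1..k}. walk 0 \<omega> i \<ge> 0)}"
    have "incseq ?A"
    proof (rule incseq_SucI)
      fix i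
      have "e / real (Suc (Suc i)) \<le> e / real (Suc i)" using e by (intro divide_left_mono) auto
      then show "?A i \<le> ?A (Suc i)" by auto
    qed
    then have "(\<lambda>i. measure P (?A i)) \<longlonglongrightarrow> measure P (\<Union>i. ?A i)"
      by (intro P.finite_Lim_measure_incseq) (auto intro!: pred_sets, measurable)
    moreover have "(\<Union>i. ?A i) = {\<omega>. walk 0 \<omega> k < - x \<and> (\<forall>i\<in>{1..k}. walk 0 \<omega> i \<ge> 0)}"
    proof safe
      fix \<omega> assume "walk 0 \<omega> k < - x" and s: "\<forall>i\<in>{1..k}. walk 0 \<omega> i \<ge> 0"
      then have "0 < (- x - walk 0 \<omega> k) / e" using e by simp
      then obtain i where "inverse (real (Suc i)) < (- x - walk 0 \<omega> k) / e" using reals_Archimedean by blast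
      then have "e / real (Suc i) < - x - walk 0 \<omega> k" using e by (simp add: field_simps)
      then show "\<omega> \<in> (\<Union>i. ?A i)" using s by (intro UN_I[of i]) auto
    next
      fix \<omega> i assume "walk 0 \<omega> k < - (x + e / real (Suc i))"
      moreover have "e / real (Suc i) > 0" using e by simp
      ultimately show "walk 0 \<omega> k < - x" by linarith
    qed
    ultimately show ?thesis unfolding V_term_def by simp
  qed
  have "(\<lambda>i. \<Sum>k. V_term (x + e / real (Suc i)) k) \<longlonglongrightarrow> (\<Sum>k. V_term x k)"
  proof (rule tannerys_theorem[THEN conjunct2, THEN conjunct2])
    show "eventually (\<lambda>(k, i). norm (V_term (x + e / real (Suc i)) k) \<le> V_term x k) (at_top \<times>\<^sub>F sequentially)"
    proof (rule always_eventually, safe)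
      fix k i
      have "x \<le> x + e / real (Suc i)" using e by simp
      from V_term_antimono[OF this, of k] show "norm (V_term (x + e / real (Suc i)) k) \<le> V_term x k"
        using V_term_nonneg by simp
    qed
  qed (use lim V_summable[OF x] in auto)
  then show ?thesis using neg x by (simp add: V_eq)
qed

lemma all_walk_nonneg_comb_seq:
  "(\<forall>i\<le>k + m. walk x (comb_seq k \<omega> \<omega>') i \<ge> 0) \<longleftrightarrow>
   (\<forall>i\<le>k. walk x \<omega> i \<ge> 0) \<and> (\<forall>i\<le>m. walk (walk x \<omega> k) \<omega>' i \<ge> 0)"
proof (intro iffI conjI allI impI)
  fix i assume *: "\<forall>i\<le>k + m. walk x (comb_seq k \<omega> \<omega>') i \<ge> 0" and i: "i \<le> k"
  show "walk x \<omega> i \<ge> 0" using *[rule_format, of i] i by (simp add: walk_comb_seq_le)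
next
  fix i assume *: "\<forall>i\<le>k + m. walk x (comb_seq k \<omega> \<omega>') i \<ge> 0" and i: "i \<le> m"
  show "walk (walk x \<omega> k) \<omega>' i \<ge> 0"
    using *[rule_format, of "k + i"] i by (simp add: walk_comb_seq_add walk_start[of "walk x \<omega> k"])
next
  fix i assume *: "(\<forall>i\<le>k. walk x \<omega> i \<ge> 0) \<and> (\<forall>i\<le>m. walk (walk x \<omega> k) \<omega>' i \<ge> 0)" and i: "i \<le> k + m"
  show "walk x (comb_seq k \<omega> \<omega>') i \<ge> 0"
  proof (cases "i \<le> k")
    case True
    then show ?thesis using * i by (simp add: walk_comb_seq_le)
  next
    case False
    then obtain j where j: "i = k + j" "j \<le> m" using i by (intro that[of "i - k"]) auto
    with * have "walk (walk x \<omega> k) \<omega>' j \<ge> 0" by blast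
    then show ?thesis unfolding j(1) walk_comb_seq_add walk_start[of "walk x \<omega> k"] .
  qed
qed

end

context local_limit_env
begin

context
  fixes G :: "(nat \<Rightarrow> nat pmf) \<Rightarrow> (nat \<Rightarrow> nat pmf) \<Rightarrow> real \<Rightarrow> ennreal" and \<rho> :: nat and \<mu> :: real
  assumes G_meas_prod: "(\<lambda>(u, v, z). G u v z) \<in> borel_measurable (env_vec \<rho> \<Otimes>\<^sub>M env_vec \<rho> \<Otimes>\<^sub>M borel)"
    and \<rho>: "\<rho> \<ge> 1" and \<mu>: "\<mu> \<ge> 0"
    and G_growth: "\<And>u v z s. 0 \<le> s \<Longrightarrow> G u v z \<le> ennreal (exp (\<mu> * s)) * G u v (z + s)"
begin

lemma G_meas:
  assumes [measurable]: "f \<in> measurable M (env_vec \<rho>)" "g \<in> measurable M (env_vec \<rho>)" "h \<in> borel_measurable M"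
  shows "(\<lambda>x. G (f x) (g x) (h x)) \<in> borel_measurable M"
proof -
  have "(\<lambda>x. case (f x, g x, h x) of (u, v, z) \<Rightarrow> G u v z) \<in> borel_measurable M"
    by (rule measurable_compose[OF _ G_meas_prod]) measurable
  then show ?thesis by simp
qed

definition tail_part :: "nat \<Rightarrow> real \<Rightarrow> (nat \<Rightarrow> nat pmf) \<Rightarrow> ennreal" where
  "tail_part m x v = (\<integral>\<^sup>+\<omega>. (if \<forall>i\<in>{1..m}. walk x \<omega> i < 0 then G (last_envs_rev m \<rho> \<omega>) v (- walk x \<omega> m) else 0) \<partial>P)"

definition head_part :: "(nat \<Rightarrow> nat pmf) \<Rightarrow> ennreal" where
  "head_part v = (\<integral>\<^sup>+z. (\<integral>\<^sup>+\<omega>. (if \<forall>i\<le>\<rho>. walk z \<omega> i \<ge> 0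
      then G (first_envs \<rho> \<omega>) v z * ennreal (U (walk z \<omega> \<rho>)) else 0) \<partial>P) \<partial>lborel)"

text \<open>Averaging over the level \<open>\<eta>\<close> of the barrier and substituting \<open>z = \<eta> - S\<^sub>m\<close>
  turns the reversed walk with a fixed barrier into a walk started from Lebesgue measure.\<close>

lemma tail_part_average:
  assumes v [measurable]: "v \<in> space (env_vec \<rho>)" and m: "m \<ge> 1" "\<rho> \<le> m" and \<epsilon>: "0 < \<epsilon>" "\<epsilon> \<le> - x"
  shows "(\<integral>\<^sup>+z. (\<integral>\<^sup>+\<omega>. (if (\<forall>i\<le>m. walk z \<omega> i \<ge> 0) \<and> walk z \<omega> m \<in> {- x - \<epsilon><..<- x}
           then G (first_envs \<rho> \<omega>) v z else 0) \<partial>P) \<partial>lborel)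
       \<le> ennreal (\<epsilon> * exp (\<mu> * \<epsilon>)) * tail_part m x v"
proof -
  note G_meas [measurable (raw)]
  let ?I = "{- x - \<epsilon><..<- x}"
  have "(\<integral>\<^sup>+z. (\<integral>\<^sup>+\<omega>. (if (\<forall>i\<le>m. walk z \<omega> i \<ge> 0) \<and> walk z \<omega> m \<in> ?I then G (first_envs \<rho> \<omega>) v z else 0) \<partial>P) \<partial>lborel)
     = (\<integral>\<^sup>+z. (\<integral>\<^sup>+\<omega>. (if (\<forall>i<m. walk z \<omega> i \<ge> 0) \<and> walk z \<omega> m \<in> ?I then G (first_envs \<rho> \<omega>) v z else 0) \<partial>P) \<partial>lborel)"
    by (intro nn_integral_cong if_cong refl) (use \<epsilon> in \<open>auto simp: le_less\<close>)
  also have "\<dots> = (\<integral>\<^sup>+\<omega>. (\<integral>\<^sup>+z. (if (\<forall>i<m. walk z \<omega> i \<ge> 0) \<and> walk z \<omega> m \<in> ?I then G (first_envs \<rho> \<omega>) v z else 0) \<partial>lborel) \<partial>P)"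
  proof -
    interpret pair_sigma_finite lborel P ..
    show ?thesis by (rule Fubini'[symmetric]) measurable
  qed
  also have "\<dots> = (\<integral>\<^sup>+\<omega>. (\<integral>\<^sup>+\<eta>. (if (\<forall>i<m. walk 0 \<omega> m - walk 0 \<omega> i \<le> \<eta>) \<and> \<eta> \<in> ?I then G (first_envs \<rho> \<omega>) v (\<eta> - walk 0 \<omega> m) else 0) \<partial>lborel) \<partial>P)"
  proof (rule nn_integral_cong)
    fix \<omega>
    have "(\<integral>\<^sup>+\<eta>. (if (\<forall>i<m. walk 0 \<omega> m - walk 0 \<omega> i \<le> \<eta>) \<and> \<eta> \<in> ?I then G (first_envs \<rho> \<omega>) v (\<eta> - walk 0 \<omega> m) else 0) \<partial>lborel)
      = ennreal \<bar>1\<bar> * (\<integral>\<^sup>+z. (if (\<forall>i<m. walk 0 \<omega> m - walk 0 \<omega> i \<le> walk 0 \<omega> m + 1 * z) \<and> walk 0 \<omega> m + 1 * z \<in> ?I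
           then G (first_envs \<rho> \<omega>) v (walk 0 \<omega> m + 1 * z - walk 0 \<omega> m) else 0) \<partial>lborel)"
      by (rule nn_integral_real_affine) auto
    also have "\<dots> = (\<integral>\<^sup>+z. (if (\<forall>i<m. walk z \<omega> i \<ge> 0) \<and> walk z \<omega> m \<in> ?I then G (first_envs \<rho> \<omega>) v z else 0) \<partial>lborel)"
    proof -
      have 1: "(walk 0 \<omega> m - walk 0 \<omega> i \<le> walk z \<omega> m) \<longleftrightarrow> walk z \<omega> i \<ge> 0" for i z
        unfolding walk_start[of z] by auto
      have 2: "walk 0 \<omega> m + z = walk z \<omega> m" for z unfolding walk_start[of z] by simp
      have 3: "walk z \<omega> m - walk 0 \<omega> m = z" for z unfolding walk_start[of z] by simp
      show ?thesis by (simp only: mult_1 1 2 3 abs_one ennreal_1)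
    qed
    finally show "(\<integral>\<^sup>+z. (if (\<forall>i<m. walk z \<omega> i \<ge> 0) \<and> walk z \<omega> m \<in> ?I then G (first_envs \<rho> \<omega>) v z else 0) \<partial>lborel)
      = (\<integral>\<^sup>+\<eta>. (if (\<forall>i<m. walk 0 \<omega> m - walk 0 \<omega> i \<le> \<eta>) \<and> \<eta> \<in> ?I then G (first_envs \<rho> \<omega>) v (\<eta> - walk 0 \<omega> m) else 0) \<partial>lborel)" by (rule sym)
  qed
  also have "\<dots> = (\<integral>\<^sup>+\<eta>. (\<integral>\<^sup>+\<omega>. (if (\<forall>i<m. walk 0 \<omega> m - walk 0 \<omega> i \<le> \<eta>) \<and> \<eta> \<in> ?I then G (first_envs \<rho> \<omega>) v (\<eta> - walk 0 \<omega> m) else 0) \<partial>P) \<partial>lborel)"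
  proof -
    interpret pair_sigma_finite lborel P ..
    show ?thesis by (rule Fubini') measurable
  qed
  also have "\<dots> = (\<integral>\<^sup>+\<eta>. (\<integral>\<^sup>+\<omega>. (if (\<forall>i\<in>{1..m}. walk 0 \<omega> i \<le> \<eta>) \<and> \<eta> \<in> ?I then G (last_envs_rev m \<rho> \<omega>) v (\<eta> - walk 0 \<omega> m) else 0) \<partial>P) \<partial>lborel)"
  proof (rule nn_integral_cong)
    fix \<eta>
    have walk_end: "walk 0 (rev_seq m \<omega>) m = walk 0 \<omega> m" for \<omega> by (simp add: walk_rev_seq)
    have cond: "(\<forall>i\<in>{1..m}. walk 0 (rev_seq m \<omega>) i \<le> \<eta>) \<longleftrightarrow> (\<forall>i<m. walk 0 \<omega> m - walk 0 \<omega> i \<le> \<eta>)" for \<omega>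
    proof safe
      fix i assume *: "\<forall>i\<in>{1..m}. walk 0 (rev_seq m \<omega>) i \<le> \<eta>" and "i < m"
      then show "walk 0 \<omega> m - walk 0 \<omega> i \<le> \<eta>"
        using *[THEN bspec, of "m - i"] by (simp add: walk_rev_seq)
    qed (auto simp: walk_rev_seq)
    have "(\<integral>\<^sup>+\<omega>. (if (\<forall>i<m. walk 0 \<omega> m - walk 0 \<omega> i \<le> \<eta>) \<and> \<eta> \<in> ?I then G (first_envs \<rho> \<omega>) v (\<eta> - walk 0 \<omega> m) else 0) \<partial>P)
      = (\<integral>\<^sup>+\<omega>. (if (\<forall>i\<in>{1..m}. walk 0 (rev_seq m \<omega>) i \<le> \<eta>) \<and> \<eta> \<in> ?I
           then G (last_envs_rev m \<rho> (rev_seq m \<omega>)) v (\<eta> - walk 0 (rev_seq m \<omega>) m) else 0) \<partial>P)"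
      unfolding cond walk_end last_envs_rev_rev_seq[OF m(2)] ..
    also have "\<dots> = (\<integral>\<^sup>+\<omega>. (if (\<forall>i\<in>{1..m}. walk 0 \<omega> i \<le> \<eta>) \<and> \<eta> \<in> ?I then G (last_envs_rev m \<rho> \<omega>) v (\<eta> - walk 0 \<omega> m) else 0) \<partial>P)"
      by (rule nn_integral_rev_seq) measurable
    finally show "(\<integral>\<^sup>+\<omega>. (if (\<forall>i<m. walk 0 \<omega> m - walk 0 \<omega> i \<le> \<eta>) \<and> \<eta> \<in> ?I then G (first_envs \<rho> \<omega>) v (\<eta> - walk 0 \<omega> m) else 0) \<partial>P)
      = (\<integral>\<^sup>+\<omega>. (if (\<forall>i\<in>{1..m}. walk 0 \<omega> i \<le> \<eta>) \<and> \<eta> \<in> ?I then G (last_envs_rev m \<rho> \<omega>) v (\<eta> - walk 0 \<omega> m) else 0) \<partial>P)" .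
  qed
  also have "\<dots> \<le> (\<integral>\<^sup>+\<eta>. indicator ?I \<eta> * (ennreal (exp (\<mu> * \<epsilon>)) * tail_part m x v) \<partial>lborel)"
  proof (intro nn_integral_mono)
    fix \<eta>
    show "(\<integral>\<^sup>+\<omega>. (if (\<forall>i\<in>{1..m}. walk 0 \<omega> i \<le> \<eta>) \<and> \<eta> \<in> ?I then G (last_envs_rev m \<rho> \<omega>) v (\<eta> - walk 0 \<omega> m) else 0) \<partial>P)
      \<le> indicator ?I \<eta> * (ennreal (exp (\<mu> * \<epsilon>)) * tail_part m x v)"
    proof (cases "\<eta> \<in> ?I")
      case True
      have "(\<integral>\<^sup>+\<omega>. (if (\<forall>i\<in>{1..m}. walk 0 \<omega> i \<le> \<eta>) \<and> \<eta> \<in> ?I then G (last_envs_rev m \<rho> \<omega>) v (\<eta> - walk 0 \<omega> m) else 0) \<partial>P)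
        \<le> (\<integral>\<^sup>+\<omega>. ennreal (exp (\<mu> * \<epsilon>)) * (if \<forall>i\<in>{1..m}. walk x \<omega> i < 0 then G (last_envs_rev m \<rho> \<omega>) v (- walk x \<omega> m) else 0) \<partial>P)"
      proof (intro nn_integral_mono)
        fix \<omega>
        show "(if (\<forall>i\<in>{1..m}. walk 0 \<omega> i \<le> \<eta>) \<and> \<eta> \<in> ?I then G (last_envs_rev m \<rho> \<omega>) v (\<eta> - walk 0 \<omega> m) else 0)
          \<le> ennreal (exp (\<mu> * \<epsilon>)) * (if \<forall>i\<in>{1..m}. walk x \<omega> i < 0 then G (last_envs_rev m \<rho> \<omega>) v (- walk x \<omega> m) else 0)"
        proof (cases "\<forall>i\<in>{1..m}. walk 0 \<omega> i \<le> \<eta>")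
          case le: True
          have neg: "\<forall>i\<in>{1..m}. walk x \<omega> i < 0"
          proof
            fix i assume "i \<in> {1..m}"
            with le have "walk 0 \<omega> i \<le> \<eta>" by blast
            then show "walk x \<omega> i < 0" using True unfolding walk_start[of x] by auto
          qed
          have "G (last_envs_rev m \<rho> \<omega>) v (\<eta> - walk 0 \<omega> m) \<le> ennreal (exp (\<mu> * (- x - \<eta>))) * G (last_envs_rev m \<rho> \<omega>) v (\<eta> - walk 0 \<omega> m + (- x - \<eta>))"
            using True by (intro G_growth) auto
          also have "\<eta> - walk 0 \<omega> m + (- x - \<eta>) = - walk x \<omega> m" unfolding walk_start[of x] by simp
          also have "ennreal (exp (\<mu> * (- x - \<eta>))) * G (last_envs_rev m \<rho> \<omega>) v (- walk x \<omega> m) \<le> ennreal (exp (\<mu> * \<epsilon>)) * G (last_envs_rev m \<rho> \<omega>) v (- walk x \<omega> m)"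
            using True \<mu> by (intro mult_right_mono ennreal_leI) (auto intro!: mult_left_mono)
          finally show ?thesis using le neg True by simp
        qed (simp only: simp_thms if_False zero_le)
      qed
      also have "\<dots> = ennreal (exp (\<mu> * \<epsilon>)) * tail_part m x v"
        unfolding tail_part_def by (rule nn_integral_cmult) measurable
      finally show ?thesis using True by simp
    qed (simp only: simp_thms if_False nn_integral_const mult_zero_left zero_le)
  qed
  also have "\<dots> = emeasure lborel ?I * (ennreal (exp (\<mu> * \<epsilon>)) * tail_part m x v)"
    by (subst nn_integral_multc) auto
  also have "\<dots> = ennreal (\<epsilon> * exp (\<mu> * \<epsilon>)) * tail_part m x v"
    using \<epsilon> by (simp add: ennreal_mult mult.assoc)
  finally show ?thesis .
qed

lemma tail_part_liminf_eps:
  assumes v [measurable]: "v \<in> space (env_vec \<rho>)" and \<epsilon>: "0 < \<epsilon>" "\<epsilon> \<le> - x"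
  shows "ennreal (K * V (x + \<epsilon>)) * head_part v \<le> ennreal (exp (\<mu> * \<epsilon>)) * liminf (\<lambda>n. ennreal (real n * c n) * tail_part (n - \<rho>) x v)"
proof -
  note G_meas [measurable (raw)]
  let ?I = "{- x - \<epsilon><..<- x}"
  let ?p = "\<lambda>n y. measure P {\<omega>'. (\<forall>i\<le>n - (\<rho> + \<rho>). walk y \<omega>' i \<ge> 0) \<and> walk y \<omega>' (n - (\<rho> + \<rho>)) \<in> ?I}"
  let ?g = "\<lambda>n z \<omega>. (if \<forall>i\<le>\<rho>. walk z \<omega> i \<ge> 0 then G (first_envs \<rho> \<omega>) v z else 0) * (ennreal (real n * c n) * ennreal (?p n (walk z \<omega> \<rho>)))"
  have p_eq: "ennreal (?p n y) = (\<integral>\<^sup>+\<omega>'. (if (\<forall>i\<le>n - (\<rho> + \<rho>). walk y \<omega>' i \<ge> 0) \<and> walk y \<omega>' (n - (\<rho> + \<rho>)) \<in> ?I then 1 else 0) \<partial>P)" for n y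
    by (rule nn_integral_prob_eq[symmetric]) measurable
  have p_meas [measurable]: "(\<lambda>y. ennreal (?p n y)) \<in> borel_measurable borel" for n
    unfolding p_eq by measurable
  have "ennreal (\<epsilon> * (K * V (x + \<epsilon>))) * head_part v
     = (\<integral>\<^sup>+z. (\<integral>\<^sup>+\<omega>. ennreal (\<epsilon> * (K * V (x + \<epsilon>))) * (if \<forall>i\<le>\<rho>. walk z \<omega> i \<ge> 0
      then G (first_envs \<rho> \<omega>) v z * ennreal (U (walk z \<omega> \<rho>)) else 0) \<partial>P) \<partial>lborel)"
    unfolding head_part_def by (subst nn_integral_cmult, measurable, subst nn_integral_cmult, measurable)
  also have "\<dots> \<le> (\<integral>\<^sup>+z. (\<integral>\<^sup>+\<omega>. liminf (\<lambda>n. ?g n z \<omega>) \<partial>P) \<partial>lborel)"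
  proof (intro nn_integral_mono)
    fix z \<omega>
    show "ennreal (\<epsilon> * (K * V (x + \<epsilon>))) * (if \<forall>i\<le>\<rho>. walk z \<omega> i \<ge> 0 then G (first_envs \<rho> \<omega>) v z * ennreal (U (walk z \<omega> \<rho>)) else 0)
       \<le> liminf (\<lambda>n. ?g n z \<omega>)"
    proof (cases "\<forall>i\<le>\<rho>. walk z \<omega> i \<ge> 0")
      case True
      let ?y = "walk z \<omega> \<rho>"
      have y: "?y \<ge> 0" using True by simp
      have "ennreal (\<epsilon> * (K * V (x + \<epsilon>))) * (G (first_envs \<rho> \<omega>) v z * ennreal (U ?y))
        = G (first_envs \<rho> \<omega>) v z * ennreal (K * U ?y * V (- (- x - \<epsilon>)) * (- x - (- x - \<epsilon>)))"
      proof -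
        have "ennreal (K * U ?y * V (- (- x - \<epsilon>)) * (- x - (- x - \<epsilon>))) = ennreal ((\<epsilon> * (K * V (x + \<epsilon>))) * U ?y)"
          by (simp add: mult_ac add.commute)
        also have "\<dots> = ennreal (\<epsilon> * (K * V (x + \<epsilon>))) * ennreal (U ?y)"
          using \<epsilon> K_pos V_nonneg U_nonneg by (intro ennreal_mult) auto
        finally show ?thesis by (simp only: mult_ac)
      qed
      also have "\<dots> \<le> G (first_envs \<rho> \<omega>) v z * liminf (\<lambda>n. ennreal (real n * c n) * ennreal (?p n ?y))"
        using y \<epsilon> by (intro mult_left_mono local_liminf) auto
      also have "\<dots> \<le> liminf (\<lambda>n. G (first_envs \<rho> \<omega>) v z * (ennreal (real n * c n) * ennreal (?p n ?y)))"
        by (rule mult_liminf_le_ennreal)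
      finally show ?thesis using True by simp
    qed (simp only: if_False mult_zero_right zero_le)
  qed
  also have "\<dots> \<le> (\<integral>\<^sup>+z. liminf (\<lambda>n. \<integral>\<^sup>+\<omega>. ?g n z \<omega> \<partial>P) \<partial>lborel)"
    by (intro nn_integral_mono nn_integral_liminf) measurable
  also have "\<dots> \<le> liminf (\<lambda>n. \<integral>\<^sup>+z. (\<integral>\<^sup>+\<omega>. ?g n z \<omega> \<partial>P) \<partial>lborel)"
    by (intro nn_integral_liminf) measurable
  also have "\<dots> \<le> liminf (\<lambda>n. ennreal (\<epsilon> * exp (\<mu> * \<epsilon>)) * (ennreal (real n * c n) * tail_part (n - \<rho>) x v))"
  proof (rule Liminf_mono)
    show "eventually (\<lambda>n. (\<integral>\<^sup>+z. (\<integral>\<^sup>+\<omega>. ?g n z \<omega> \<partial>P) \<partial>lborel) \<le> ennreal (\<epsilon> * exp (\<mu> * \<epsilon>)) * (ennreal (real n * c n) * tail_part (n - \<rho>) x v)) sequentially"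
      using eventually_ge_at_top[of "\<rho> + \<rho>"]
    proof eventually_elim
      case (elim n)
      define j where "j = n - (\<rho> + \<rho>)"
      have m: "n - \<rho> = \<rho> + j" "n - \<rho> \<ge> 1" "\<rho> \<le> n - \<rho>" using elim \<rho> by (auto simp: j_def)
      have split: "(\<integral>\<^sup>+\<omega>. (if (\<forall>i\<le>n - \<rho>. walk z \<omega> i \<ge> 0) \<and> walk z \<omega> (n - \<rho>) \<in> ?I then G (first_envs \<rho> \<omega>) v z else 0) \<partial>P)
        = (\<integral>\<^sup>+\<omega>. (if \<forall>i\<le>\<rho>. walk z \<omega> i \<ge> 0 then G (first_envs \<rho> \<omega>) v z else 0) * ennreal (?p n (walk z \<omega> \<rho>)) \<partial>P)" for z
      proof -
        have "(\<integral>\<^sup>+\<omega>. (if (\<forall>i\<le>n - \<rho>. walk z \<omega> i \<ge> 0) \<and> walk z \<omega> (n - \<rho>) \<in> ?I then G (first_envs \<rho> \<omega>) v z else 0) \<partial>P)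
          = (\<integral>\<^sup>+\<omega>. (\<integral>\<^sup>+\<omega>'. (if (\<forall>i\<le>n - \<rho>. walk z (comb_seq \<rho> \<omega> \<omega>') i \<ge> 0) \<and> walk z (comb_seq \<rho> \<omega> \<omega>') (n - \<rho>) \<in> ?I
               then G (first_envs \<rho> (comb_seq \<rho> \<omega> \<omega>')) v z else 0) \<partial>P) \<partial>P)"
          by (rule nn_integral_split) measurable
        also have "\<dots> = (\<integral>\<^sup>+\<omega>. (\<integral>\<^sup>+\<omega>'. (if \<forall>i\<le>\<rho>. walk z \<omega> i \<ge> 0 then G (first_envs \<rho> \<omega>) v z else 0) *
             (if (\<forall>i\<le>n - (\<rho> + \<rho>). walk (walk z \<omega> \<rho>) \<omega>' i \<ge> 0) \<and> walk (walk z \<omega> \<rho>) \<omega>' (n - (\<rho> + \<rho>)) \<in> ?I then 1 else 0) \<partial>P) \<partial>P)"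
        proof (intro nn_integral_cong)
          fix \<omega> \<omega>' :: "nat \<Rightarrow> nat pmf"
          have 1: "walk z (comb_seq \<rho> \<omega> \<omega>') (n - \<rho>) = walk (walk z \<omega> \<rho>) \<omega>' j"
            unfolding m walk_comb_seq_add walk_start[of "walk z \<omega> \<rho>"] ..
          have 2: "(\<forall>i\<le>n - \<rho>. walk z (comb_seq \<rho> \<omega> \<omega>') i \<ge> 0) \<longleftrightarrow> (\<forall>i\<le>\<rho>. walk z \<omega> i \<ge> 0) \<and> (\<forall>i\<le>j. walk (walk z \<omega> \<rho>) \<omega>' i \<ge> 0)"
            unfolding m by (rule all_walk_nonneg_comb_seq)
          show "(if (\<forall>i\<le>n - \<rho>. walk z (comb_seq \<rho> \<omega> \<omega>') i \<ge> 0) \<and> walk z (comb_seq \<rho> \<omega> \<omega>') (n - \<rho>) \<in> ?I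
               then G (first_envs \<rho> (comb_seq \<rho> \<omega> \<omega>')) v z else 0) = (if \<forall>i\<le>\<rho>. walk z \<omega> i \<ge> 0 then G (first_envs \<rho> \<omega>) v z else 0) *
             (if (\<forall>i\<le>n - (\<rho> + \<rho>). walk (walk z \<omega> \<rho>) \<omega>' i \<ge> 0) \<and> walk (walk z \<omega> \<rho>) \<omega>' (n - (\<rho> + \<rho>)) \<in> ?I then 1 else 0)"
            unfolding 1 2 j_def[symmetric] first_envs_comb_seq[OF order_refl] by (rule if_conj_mult_ennreal)
        qed
        also have "\<dots> = (\<integral>\<^sup>+\<omega>. (if \<forall>i\<le>\<rho>. walk z \<omega> i \<ge> 0 then G (first_envs \<rho> \<omega>) v z else 0) * ennreal (?p n (walk z \<omega> \<rho>)) \<partial>P)"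
          by (intro nn_integral_cong nn_prob_cmult) measurable
        finally show ?thesis .
      qed
      have "(\<integral>\<^sup>+z. (\<integral>\<^sup>+\<omega>. ?g n z \<omega> \<partial>P) \<partial>lborel)
        = (\<integral>\<^sup>+z. (\<integral>\<^sup>+\<omega>. ennreal (real n * c n) * ((if \<forall>i\<le>\<rho>. walk z \<omega> i \<ge> 0 then G (first_envs \<rho> \<omega>) v z else 0) * ennreal (?p n (walk z \<omega> \<rho>))) \<partial>P) \<partial>lborel)"
        by (simp only: mult.left_commute)
      also have "\<dots> = ennreal (real n * c n) * (\<integral>\<^sup>+z. (\<integral>\<^sup>+\<omega>. (if \<forall>i\<le>\<rho>. walk z \<omega> i \<ge> 0 then G (first_envs \<rho> \<omega>) v z else 0) * ennreal (?p n (walk z \<omega> \<rho>)) \<partial>P) \<partial>lborel)"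
        by (subst nn_integral_cmult, measurable, subst nn_integral_cmult, measurable)
      also have "\<dots> \<le> ennreal (real n * c n) * (ennreal (\<epsilon> * exp (\<mu> * \<epsilon>)) * tail_part (n - \<rho>) x v)"
        unfolding split[symmetric] by (intro mult_left_mono tail_part_average v m \<epsilon>) simp
      finally show ?case by (simp only: mult_ac)
    qed
  qed
  also have "\<dots> = ennreal (\<epsilon> * exp (\<mu> * \<epsilon>)) * liminf (\<lambda>n. ennreal (real n * c n) * tail_part (n - \<rho>) x v)"
  proof (rule antisym)
    let ?a = "ennreal (\<epsilon> * exp (\<mu> * \<epsilon>))" and ?b = "ennreal (1 / (\<epsilon> * exp (\<mu> * \<epsilon>)))" and ?f = "\<lambda>n. ennreal (real n * c n) * tail_part (n - \<rho>) x v"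
    have ab: "?a * ?b = 1" "?b * ?a = 1" using \<epsilon> by (auto simp: ennreal_mult[symmetric])
    have "liminf (\<lambda>n. ?a * ?f n) = ?a * (?b * liminf (\<lambda>n. ?a * ?f n))" by (simp only: mult.assoc[symmetric] ab mult_1)
    also have "\<dots> \<le> ?a * liminf (\<lambda>n. ?b * (?a * ?f n))" by (intro mult_left_mono mult_liminf_le_ennreal) simp
    also have "\<dots> = ?a * liminf ?f" by (simp only: mult.assoc[symmetric] ab mult_1)
    finally show "liminf (\<lambda>n. ?a * ?f n) \<le> ?a * liminf ?f" .
  qed (rule mult_liminf_le_ennreal)
  finally have "ennreal (1 / \<epsilon>) * (ennreal (\<epsilon> * (K * V (x + \<epsilon>))) * head_part v)
    \<le> ennreal (1 / \<epsilon>) * (ennreal (\<epsilon> * exp (\<mu> * \<epsilon>)) * liminf (\<lambda>n. ennreal (real n * c n) * tail_part (n - \<rho>) x v))"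
    by (intro mult_left_mono) auto
  moreover have "ennreal (1 / \<epsilon>) * (ennreal (\<epsilon> * t) * y) = ennreal t * y" for t y
    using \<epsilon> by (subst mult.assoc[symmetric], subst ennreal_mult'[symmetric]) auto
  ultimately show ?thesis by (simp only:)
qed

lemma tail_part_liminf:
  assumes v: "v \<in> space (env_vec \<rho>)" and x: "x < 0"
  shows "ennreal (K * V x) * head_part v \<le> liminf (\<lambda>n. ennreal (real n * c n) * tail_part (n - \<rho>) x v)" (is "_ \<le> ?L")
proof -
  define e where "e = - x / 2"
  have e: "e > 0" "x + e < 0" using x by (auto simp: e_def)
  have ei: "0 < e / real (Suc i)" "e / real (Suc i) \<le> - x" for i
  proof -
    have "e / real (Suc i) \<le> e" using e by (simp add: field_simps)
    then show "e / real (Suc i) \<le> - x" using e by linarith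
  qed (use e in simp)
  have main: "ennreal (K * V (x + e / real (Suc i))) * head_part v \<le> ennreal (exp (\<mu> * (e / real (Suc i)))) * ?L" for i
    by (rule tail_part_liminf_eps[OF v ei])
  show ?thesis
  proof (cases "?L = \<top>")
    case False
    then obtain l where l: "?L = ennreal l" "l \<ge> 0" by (cases ?L) auto
    have "head_part v \<noteq> \<top>"
    proof
      assume top: "head_part v = \<top>"
      have "K * V (x + e / real (Suc 0)) > 0" using K_pos V_ge_1[of "x + e"] e by simp
      then have "ennreal (K * V (x + e / real (Suc 0))) \<noteq> 0" by (simp only: ennreal_eq_0_iff not_le)
      then have "ennreal (K * V (x + e / real (Suc 0))) * head_part v = \<top>"
        using top by (simp only: ennreal_mult_eq_top_iff) blast
      then have "ennreal (exp (\<mu> * (e / real (Suc 0)))) * ?L = \<top>" using main[of 0] by (simp add: top_unique)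
      then show False unfolding l by (simp add: ennreal_mult_eq_top_iff)
    qed
    then obtain h where h: "head_part v = ennreal h" "h \<ge> 0" by (cases "head_part v") auto
    have le: "K * V (x + e / real (Suc i)) * h \<le> exp (\<mu> * (e / real (Suc i))) * l" for i
      using main[of i] K_pos V_nonneg l(2) h(2) unfolding l h by (simp add: ennreal_mult[symmetric])
    have e0: "(\<lambda>i. e / real (Suc i)) \<longlonglongrightarrow> 0"
      using tendsto_mult[OF tendsto_const[of e] LIMSEQ_inverse_real_of_nat] by (simp add: divide_inverse)
    have "(\<lambda>i. K * V (x + e / real (Suc i)) * h) \<longlonglongrightarrow> K * V x * h"
      by (intro tendsto_intros V_right_continuous x e)
    moreover have "(\<lambda>i. exp (\<mu> * (e / real (Suc i))) * l) \<longlonglongrightarrow> exp (\<mu> * 0) * l"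
      by (intro tendsto_intros e0)
    ultimately have "K * V x * h \<le> exp (\<mu> * 0) * l" using le by (intro LIMSEQ_le) auto
    then have "K * V x * h \<le> l" by simp
    then show ?thesis unfolding l h using K_pos V_nonneg h(2) by (simp add: ennreal_mult[symmetric] ennreal_leI)
  qed simp
qed

lemma head_part_meas: "head_part \<in> borel_measurable (env_vec \<rho>)"
proof -
  note G_meas [measurable (raw)]
  show ?thesis unfolding head_part_def[abs_def] by measurable
qed

lemma fixed_horizon_liminf:
  "(\<integral>\<^sup>+\<omega>'. (if \<forall>i\<in>{1..\<rho>}. walk 0 \<omega>' i < 0 then ennreal (K * V (walk 0 \<omega>' \<rho>)) * head_part (first_envs \<rho> \<omega>') else 0) \<partial>P)
    \<le> liminf (\<lambda>n. ennreal (real n * c n) * (\<integral>\<^sup>+\<omega>. (if \<forall>i<n. walk 0 \<omega> n < walk 0 \<omega> i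
         then G (first_envs \<rho> \<omega>) (last_envs_rev n \<rho> \<omega>) (- walk 0 \<omega> n) else 0) \<partial>P))"
proof -
  note G_meas [measurable (raw)]
  have space_first: "first_envs \<rho> \<omega> \<in> space (env_vec \<rho>)" for \<omega>
    using measurable_space[OF first_envs_meas, of \<omega> \<rho>] by simp
  have tp_meas [measurable]: "(\<lambda>\<omega>'. tail_part m (walk 0 \<omega>' \<rho>) (first_envs \<rho> \<omega>')) \<in> borel_measurable P" for m
    unfolding tail_part_def by measurable
  let ?h = "\<lambda>n \<omega>'. if \<forall>i\<in>{1..\<rho>}. walk 0 \<omega>' i < 0 then ennreal (real n * c n) * tail_part (n - \<rho>) (walk 0 \<omega>' \<rho>) (first_envs \<rho> \<omega>') else 0"
  have "(\<integral>\<^sup>+\<omega>'. (if \<forall>i\<in>{1..\<rho>}. walk 0 \<omega>' i < 0 then ennreal (K * V (walk 0 \<omega>' \<rho>)) * head_part (first_envs \<rho> \<omega>') else 0) \<partial>P)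
    \<le> (\<integral>\<^sup>+\<omega>'. liminf (\<lambda>n. ?h n \<omega>') \<partial>P)"
  proof (intro nn_integral_mono)
    fix \<omega>'
    show "(if \<forall>i\<in>{1..\<rho>}. walk 0 \<omega>' i < 0 then ennreal (K * V (walk 0 \<omega>' \<rho>)) * head_part (first_envs \<rho> \<omega>') else 0) \<le> liminf (\<lambda>n. ?h n \<omega>')"
    proof (cases "\<forall>i\<in>{1..\<rho>}. walk 0 \<omega>' i < 0")
      case True
      then have "walk 0 \<omega>' \<rho> < 0" using \<rho> by auto
      from tail_part_liminf[OF space_first this, of \<omega>'] show ?thesis using True by simp
    qed (simp only: if_False zero_le)
  qed
  also have "\<dots> \<le> liminf (\<lambda>n. \<integral>\<^sup>+\<omega>'. ?h n \<omega>' \<partial>P)"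
    by (intro nn_integral_liminf) measurable
  also have "\<dots> = liminf (\<lambda>n. ennreal (real n * c n) * (\<integral>\<^sup>+\<omega>. (if \<forall>i<n. walk 0 \<omega> n < walk 0 \<omega> i
         then G (first_envs \<rho> \<omega>) (last_envs_rev n \<rho> \<omega>) (- walk 0 \<omega> n) else 0) \<partial>P))"
  proof (rule Liminf_eq)
    show "eventually (\<lambda>n. (\<integral>\<^sup>+\<omega>'. ?h n \<omega>' \<partial>P) = ennreal (real n * c n) * (\<integral>\<^sup>+\<omega>. (if \<forall>i<n. walk 0 \<omega> n < walk 0 \<omega> i
         then G (first_envs \<rho> \<omega>) (last_envs_rev n \<rho> \<omega>) (- walk 0 \<omega> n) else 0) \<partial>P)) sequentially"
      using eventually_ge_at_top[of "\<rho> + \<rho>"]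
    proof eventually_elim
      case (elim n)
      have walk_end: "walk 0 (rev_seq n \<omega>) n = walk 0 \<omega> n" for \<omega> by (simp add: walk_rev_seq)
      define m where "m = n - \<rho>"
      have m: "n = \<rho> + m" "\<rho> \<le> m" "\<rho> \<le> n" using elim by (auto simp: m_def)
      have "(\<integral>\<^sup>+\<omega>. (if \<forall>i<n. walk 0 \<omega> n < walk 0 \<omega> i
           then G (first_envs \<rho> \<omega>) (last_envs_rev n \<rho> \<omega>) (- walk 0 \<omega> n) else 0) \<partial>P)
        = (\<integral>\<^sup>+\<omega>. (if \<forall>i\<in>{1..n}. walk 0 (rev_seq n \<omega>) i < 0
           then G (last_envs_rev n \<rho> (rev_seq n \<omega>)) (first_envs \<rho> (rev_seq n \<omega>)) (- walk 0 (rev_seq n \<omega>) n) else 0) \<partial>P)"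
        unfolding strict_min_rev_seq first_envs_rev_seq[OF m(3)] last_envs_rev_rev_seq[OF m(3)] walk_end ..
      also have "\<dots> = (\<integral>\<^sup>+\<omega>. (if \<forall>i\<in>{1..n}. walk 0 \<omega> i < 0
           then G (last_envs_rev n \<rho> \<omega>) (first_envs \<rho> \<omega>) (- walk 0 \<omega> n) else 0) \<partial>P)"
        by (rule nn_integral_rev_seq) measurable
      also have "\<dots> = (\<integral>\<^sup>+\<omega>'. (\<integral>\<^sup>+\<omega>. (if \<forall>i\<in>{1..n}. walk 0 (comb_seq \<rho> \<omega>' \<omega>) i < 0
           then G (last_envs_rev n \<rho> (comb_seq \<rho> \<omega>' \<omega>)) (first_envs \<rho> (comb_seq \<rho> \<omega>' \<omega>)) (- walk 0 (comb_seq \<rho> \<omega>' \<omega>) n) else 0) \<partial>P) \<partial>P)"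
        by (rule nn_integral_split) measurable
      also have "\<dots> = (\<integral>\<^sup>+\<omega>'. (if \<forall>i\<in>{1..\<rho>}. walk 0 \<omega>' i < 0 then tail_part (n - \<rho>) (walk 0 \<omega>' \<rho>) (first_envs \<rho> \<omega>') else 0) \<partial>P)"
      proof (intro nn_integral_cong)
        fix \<omega>'
        have 1: "walk 0 (comb_seq \<rho> \<omega>' \<omega>) n = walk (walk 0 \<omega>' \<rho>) \<omega> m" for \<omega>
          unfolding m(1) walk_comb_seq_add walk_start[of "walk 0 \<omega>' \<rho>"] ..
        have 2: "last_envs_rev n \<rho> (comb_seq \<rho> \<omega>' \<omega>) = last_envs_rev m \<rho> \<omega>" for \<omega>
          unfolding m(1) using m(2) by (rule last_envs_rev_comb_seq)
        have 3: "(\<forall>i\<in>{1..n}. walk 0 (comb_seq \<rho> \<omega>' \<omega>) i < 0) \<longleftrightarrow> (\<forall>i\<in>{1..\<rho>}. walk 0 \<omega>' i < 0) \<and> (\<forall>i\<in>{1..m}. walk (walk 0 \<omega>' \<rho>) \<omega> i < 0)" for \<omega>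
          unfolding m(1) by (rule all_walk_neg_comb_seq)
        show "(\<integral>\<^sup>+\<omega>. (if \<forall>i\<in>{1..n}. walk 0 (comb_seq \<rho> \<omega>' \<omega>) i < 0
           then G (last_envs_rev n \<rho> (comb_seq \<rho> \<omega>' \<omega>)) (first_envs \<rho> (comb_seq \<rho> \<omega>' \<omega>)) (- walk 0 (comb_seq \<rho> \<omega>' \<omega>) n) else 0) \<partial>P)
          = (if \<forall>i\<in>{1..\<rho>}. walk 0 \<omega>' i < 0 then tail_part (n - \<rho>) (walk 0 \<omega>' \<rho>) (first_envs \<rho> \<omega>') else 0)"
          unfolding 1 2 3 first_envs_comb_seq[OF order_refl] m_def[symmetric] tail_part_def
          by (rule nn_integral_if_const_conj)
      qed
      finally have eq: "(\<integral>\<^sup>+\<omega>. (if \<forall>i<n. walk 0 \<omega> n < walk 0 \<omega> i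
           then G (first_envs \<rho> \<omega>) (last_envs_rev n \<rho> \<omega>) (- walk 0 \<omega> n) else 0) \<partial>P)
        = (\<integral>\<^sup>+\<omega>'. (if \<forall>i\<in>{1..\<rho>}. walk 0 \<omega>' i < 0 then tail_part (n - \<rho>) (walk 0 \<omega>' \<rho>) (first_envs \<rho> \<omega>') else 0) \<partial>P)" .
      show ?case unfolding eq
        by (subst nn_integral_cmult[symmetric], measurable, intro nn_integral_cong) simp
    qed
  qed
  finally show ?thesis .
qed

end

end

section \<open>Functionals of a growing number of environments\<close>

lemma liminf_add_convergent_le:
  fixes Q e :: "nat \<Rightarrow> ennreal"
  assumes e: "e \<longlonglongrightarrow> l" and l: "l < \<top>"
  shows "liminf (\<lambda>n. Q n + e n) \<le> liminf Q + l"
proof (rule ennreal_le_epsilon)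
  fix \<eta> :: real assume \<eta>: "0 < \<eta>"
  have "l < l + ennreal \<eta>" using l \<eta> by (simp add: ennreal_add_left_cancel_less[of l 0, simplified])
  then have "eventually (\<lambda>n. e n < l + ennreal \<eta>) sequentially" by (rule order_tendstoD(2)[OF e])
  then have "liminf (\<lambda>n. Q n + e n) \<le> liminf (\<lambda>n. Q n + (l + ennreal \<eta>))"
    by (intro Liminf_mono) (auto elim!: eventually_mono intro: add_left_mono)
  also have "\<dots> = liminf Q + (l + ennreal \<eta>)" by (rule Liminf_add_const) simp
  finally show "liminf (\<lambda>n. Q n + e n) \<le> liminf Q + l + ennreal \<eta>" by (simp add: add.assoc)
qed

lemma suminf_dominated_convergence_ennreal:
  fixes a :: "nat \<Rightarrow> ennreal" and d :: "nat \<Rightarrow> nat \<Rightarrow> ennreal"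
  assumes lim: "\<And>j. (\<lambda>n. d n j) \<longlonglongrightarrow> dl j" and bound: "\<And>n j. d n j \<le> b" and b: "b < \<top>"
    and a: "(\<Sum>j. a j) < \<top>"
  shows "(\<lambda>n. \<Sum>j. a j * d n j) \<longlonglongrightarrow> (\<Sum>j. a j * dl j)"
proof -
  have aj: "a j < \<top>" for j
    using sum_le_suminf[of a "{j}"] a by (simp add: le_less_trans)
  have "(\<lambda>n. \<integral>\<^sup>+j. a j * d n j \<partial>count_space UNIV) \<longlonglongrightarrow> (\<integral>\<^sup>+j. a j * dl j \<partial>count_space UNIV)"
  proof (rule nn_integral_dominated_convergence[where w="\<lambda>j. a j * b"])
    show "(\<integral>\<^sup>+j. a j * b \<partial>count_space UNIV) < \<infinity>"
      using a b by (simp add: nn_integral_count_space_nat ennreal_mult_less_top)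
    show "AE j in count_space UNIV. (\<lambda>n. a j * d n j) \<longlonglongrightarrow> a j * dl j"
      using lim aj by (auto intro!: ennreal_tendsto_cmult)
  qed (auto intro!: mult_left_mono bound)
  then show ?thesis by (simp add: nn_integral_count_space_nat)
qed

locale conditioned_env = local_limit_env +
  fixes P_plus :: "real \<Rightarrow> (nat \<Rightarrow> nat pmf) measure" and P_minus :: "(nat \<Rightarrow> nat pmf) measure"
    and \<delta> \<theta> :: real
  assumes P_plus: "\<And>x. x \<ge> 0 \<Longrightarrow> plus_law P x (P_plus x)"
    and P_minus: "minus_law P 0 P_minus"
    and \<delta>: "0 < \<delta>" "\<delta> < 1" and \<theta>: "\<theta> > 0"
begin

abbreviation h :: "nat \<Rightarrow> nat" where "h n \<equiv> nat \<lfloor>\<delta> * real n\<rfloor>"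

lemma prob_space_plus: "x \<ge> 0 \<Longrightarrow> prob_space (P_plus x)"
  using P_plus[of x] by (simp add: plus_law_def)

lemma sets_plus: "x \<ge> 0 \<Longrightarrow> sets (P_plus x) = sets P"
  using P_plus[of x] sets_P by (simp add: plus_law_def)

lemma prob_space_minus: "prob_space P_minus"
  using P_minus by (simp add: minus_law_def)

lemma sets_minus [measurable_cong]: "sets P_minus = sets P"
  using P_minus sets_P by (simp add: minus_law_def)

lemma h_mono: "m \<le> n \<Longrightarrow> h m \<le> h n"
  using \<delta> by (intro nat_mono floor_mono mult_left_mono) auto

lemma h_le: "real (h n) \<le> \<delta> * real n"
  using \<delta> by simp

lemma h_at_top: "filterlim h at_top sequentially"
proof -
  have "filterlim (\<lambda>n. \<delta> * real n) at_top sequentially"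
    using \<delta>(1) by (intro filterlim_tendsto_pos_mult_at_top[OF tendsto_const _ filterlim_real_sequentially])
  then show ?thesis
    by (intro filterlim_compose[OF filterlim_nat_sequentially] filterlim_compose[OF filterlim_floor_sequentially])
qed

definition U_weight :: "real \<Rightarrow> ennreal" where
  "U_weight z = ennreal (if z \<ge> 0 then exp (- \<theta> * z) * U z else 0)"

lemma U_weight_meas [measurable]: "U_weight \<in> borel_measurable borel"
  unfolding U_weight_def[abs_def] by measurable

lemma U_weight_integral:
  "(\<integral>\<^sup>+z. U_weight z \<partial>lborel) = ennreal (LINT z:{0..}|lborel. exp (- \<theta> * z) * U z)"
proof -
  have "(\<integral>\<^sup>+z. U_weight z \<partial>lborel) = (\<integral>\<^sup>+z. ennreal (indicator {0..} z *\<^sub>R (exp (- \<theta> * z) * U z)) \<partial>lborel)"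
    by (intro nn_integral_cong) (auto simp: U_weight_def indicator_def)
  also have "\<dots> = ennreal (\<integral>z. indicator {0..} z *\<^sub>R (exp (- \<theta> * z) * U z) \<partial>lborel)"
    using strict_min_limit(1)[OF \<theta>] U_nonneg unfolding set_integrable_def
    by (intro nn_integral_eq_integral) (auto simp: indicator_def)
  finally show ?thesis by (simp add: set_lebesgue_integral_def)
qed

lemma strip_sum_finite: "strip_sum \<theta> < \<top>"
proof -
  let ?A = "\<lambda>j. {real j + 1..<real j + 2}"
  have "strip_sum \<theta> \<le> (\<Sum>j. ennreal (exp (2 * \<theta>)) * (\<integral>\<^sup>+z. U_weight z * indicator (?A j) z \<partial>lborel))"
    unfolding strip_sum_def
  proof (intro suminf_le summableI)
    fix j
    have "ennreal (exp (- \<theta> * real j)) * ennreal (U (real j + 1)) = ennreal (exp (- \<theta> * real j) * U (real j + 1)) * emeasure lborel (?A j)"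
      using U_nonneg by (simp add: ennreal_mult)
    also have "\<dots> = (\<integral>\<^sup>+z. ennreal (exp (- \<theta> * real j) * U (real j + 1)) * indicator (?A j) z \<partial>lborel)"
      by (simp add: nn_integral_cmult_indicator)
    also have "\<dots> \<le> (\<integral>\<^sup>+z. ennreal (exp (2 * \<theta>)) * (U_weight z * indicator (?A j) z) \<partial>lborel)"
    proof (intro nn_integral_mono)
      fix z
      show "ennreal (exp (- \<theta> * real j) * U (real j + 1)) * indicator (?A j) z \<le> ennreal (exp (2 * \<theta>)) * (U_weight z * indicator (?A j) z)"
      proof (cases "z \<in> ?A j")
        case True
        have "\<theta> * z \<le> \<theta> * (real j + 2)" using True \<theta> by (intro mult_left_mono) auto
        then have "exp (- \<theta> * real j) \<le> exp (2 * \<theta> + - \<theta> * z)" by (simp add: algebra_simps)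
        moreover have "U (real j + 1) \<le> U z" using True U_mono by (simp add: mono_def)
        ultimately have "exp (- \<theta> * real j) * U (real j + 1) \<le> exp (2 * \<theta> + - \<theta> * z) * U z"
          using U_nonneg by (intro mult_mono) auto
        also have "\<dots> = exp (2 * \<theta>) * (exp (- \<theta> * z) * U z)" by (simp only: exp_add mult.assoc)
        finally have "ennreal (exp (- \<theta> * real j) * U (real j + 1)) \<le> ennreal (exp (2 * \<theta>)) * ennreal (exp (- \<theta> * z) * U z)"
          using U_nonneg by (subst ennreal_mult[symmetric]) (auto intro!: ennreal_leI)
        then show ?thesis using True by (simp add: U_weight_def)
      qed simp
    qed
    also have "\<dots> = ennreal (exp (2 * \<theta>)) * (\<integral>\<^sup>+z. U_weight z * indicator (?A j) z \<partial>lborel)"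
      by (intro nn_integral_cmult) measurable
    finally show "ennreal (exp (- \<theta> * real j)) * ennreal (U (real j + 1)) \<le> ennreal (exp (2 * \<theta>)) * (\<integral>\<^sup>+z. U_weight z * indicator (?A j) z \<partial>lborel)" .
  qed
  also have "\<dots> = ennreal (exp (2 * \<theta>)) * (\<integral>\<^sup>+z. U_weight z * indicator (\<Union>j. ?A j) z \<partial>lborel)"
  proof -
    have "disjoint_family ?A"
      unfolding disjoint_family_on_def
    proof (intro ballI impI)
      have *: "?A i \<inter> ?A j = {}" if "i < j" for i j using that by auto
      show "?A i \<inter> ?A j = {}" if "i \<noteq> j" for i j using *[of i j] *[of j i] that by (cases i j rule: linorder_cases) auto
    qed
    then show ?thesis
      by (subst nn_integral_disjoint_family) auto
  qed
  also have "\<dots> \<le> ennreal (exp (2 * \<theta>)) * (\<integral>\<^sup>+z. U_weight z \<partial>lborel)"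
    by (intro mult_left_mono nn_integral_mono) (auto simp: indicator_def)
  also have "\<dots> < \<top>" unfolding U_weight_integral by (simp add: ennreal_mult_less_top)
  finally show ?thesis .
qed

lemma error_bounds:
  "\<exists>C. \<exists>n0. \<forall>n\<ge>n0. \<forall>a\<in>borel_measurable (env_vec (h n)). \<forall>B::real. (\<forall>u. 0 \<le> a u \<and> a u \<le> B) \<longrightarrow>
    ennreal (real n * c n) * (\<integral>\<^sup>+\<omega>. (if \<forall>i<n. walk 0 \<omega> n < walk 0 \<omega> i then ennreal (exp (\<theta> * walk 0 \<omega> n) * a (first_envs (h n) \<omega>)) else 0) \<partial>P)
      \<le> ennreal C * (\<Sum>j. ennreal (exp (- \<theta> * real j)) * ennreal (U (real j + 1)) * (\<integral>\<^sup>+\<omega>. ennreal (a (first_envs (h n) \<omega>)) \<partial>P_plus (real j + 1))) \<and>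
    ennreal (real n * c n) * (\<integral>\<^sup>+\<omega>. (if \<forall>i<n. walk 0 \<omega> n < walk 0 \<omega> i then ennreal (exp (\<theta> * walk 0 \<omega> n) * a (last_envs_rev n (h n) \<omega>)) else 0) \<partial>P)
      \<le> ennreal C * strip_sum \<theta> * (\<integral>\<^sup>+\<omega>. ennreal (a (first_envs (h n) \<omega>)) \<partial>P_minus)"
proof -
  obtain C m0 where C: "C > 0" "m0 \<ge> 1" and bounds: "\<And>m k a. m \<ge> m0 \<Longrightarrow> a \<in> borel_measurable (env_vec k) \<Longrightarrow>
    (\<integral>\<^sup>+\<omega>. (if \<forall>i\<in>{1..k+m}. walk 0 \<omega> i < 0 then a (first_envs k \<omega>) * ennreal (exp (\<theta> * walk 0 \<omega> (k + m))) else 0) \<partial>P)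
      \<le> ennreal (C / (real m * c m)) * strip_sum \<theta> *
        (\<integral>\<^sup>+\<omega>. (if \<forall>i\<in>{1..k}. walk 0 \<omega> i < 0 then a (first_envs k \<omega>) * ennreal (V (walk 0 \<omega> k)) else 0) \<partial>P) \<and>
    (\<integral>\<^sup>+\<omega>. (if \<forall>i<k+m. walk 0 \<omega> (k + m) < walk 0 \<omega> i then a (first_envs k \<omega>) * ennreal (exp (\<theta> * walk 0 \<omega> (k + m))) else 0) \<partial>P)
      \<le> ennreal (C / (real m * c m)) * (\<Sum>j. ennreal (exp (- \<theta> * real j)) *
        (\<integral>\<^sup>+\<omega>. (if \<forall>i\<le>k. walk (real j + 1) \<omega> i \<ge> 0 then a (first_envs k \<omega>) * ennreal (U (walk (real j + 1) \<omega> k)) else 0) \<partial>P))"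
    using exp_walk_bounds[OF \<theta>] by blast
  obtain n1 where n1: "n1 \<ge> 1" "\<And>n m. n \<ge> n1 \<Longrightarrow> m \<ge> n \<Longrightarrow> c m \<le> 2 * (real m / real n) * c n"
    using norming_seq_linear_growth[OF norming \<alpha>_gt_1] by blast
  define q where "q = 1 / (1 - \<delta>)"
  have q: "q > 0" using \<delta> by (simp add: q_def)
  have "eventually (\<lambda>n. h n \<ge> 1 \<and> n \<ge> 1 \<and> real n \<ge> q * real (max m0 n1)) sequentially"
  proof (intro eventually_conj)
    show "eventually (\<lambda>n. h n \<ge> 1) sequentially" using h_at_top by (simp add: filterlim_at_top)
    show "eventually (\<lambda>n. real n \<ge> q * real (max m0 n1)) sequentially"
      using filterlim_real_sequentially unfolding filterlim_at_top by blast
  qed (rule eventually_ge_at_top)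
  then obtain n0 where n0: "\<And>n. n \<ge> n0 \<Longrightarrow> h n \<ge> 1 \<and> n \<ge> 1 \<and> real n \<ge> q * real (max m0 n1)"
    unfolding eventually_sequentially by blast
  define C' where "C' = 2 * q * q * C"
  {
    fix n :: nat and a :: "(nat \<Rightarrow> nat pmf) \<Rightarrow> real" and B :: real
    assume n: "n \<ge> n0" and a_meas [measurable]: "a \<in> borel_measurable (env_vec (h n))" and a: "\<forall>u. 0 \<le> a u \<and> a u \<le> B"
    have hn: "h n \<ge> 1" "n \<ge> 1" "real n \<ge> q * real (max m0 n1)" using n0[OF n] by auto
    define m where "m = n - h n"
    have "real (h n) \<le> real n" using h_le[of n] \<delta> by (meson less_imp_le mult_left_le_one_le of_nat_0_le_iff order_trans)
    then have hle: "h n \<le> n" by simp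
    then have nm: "n = h n + m" by (simp add: m_def)
    have m_real: "real m \<ge> (1 - \<delta>) * real n"
      using h_le[of n] hle by (simp add: m_def of_nat_diff algebra_simps)
    have "real (max m0 n1) \<le> (1 - \<delta>) * real n" using hn(3) \<delta> by (simp add: q_def field_simps)
    then have "real (max m0 n1) \<le> real m" using m_real by linarith
    then have m: "m \<ge> m0" "m \<ge> n1" "m \<ge> 1" using C(2) by auto
    have cm: "c m > 0" using c_pos m by simp
    have nq: "real n / real m \<le> q" using m_real m \<delta> by (simp add: q_def field_simps)
    have ratio: "ennreal (real n * c n) * ennreal (C / (real m * c m)) \<le> ennreal C'"
    proof -
      have "c n \<le> 2 * (real n / real m) * c m" using m nm by (intro n1) auto
      also have "\<dots> \<le> 2 * q * c m" using nq cm by (intro mult_right_mono mult_left_mono) auto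
      finally have "c n / c m \<le> 2 * q" using cm by (simp add: field_simps)
      then have "(real n / real m) * (c n / c m) \<le> q * (2 * q)"
        using nq q c_pos[OF hn(2)] cm by (intro mult_mono) auto
      then have "(real n / real m) * (c n / c m) * C \<le> q * (2 * q) * C" using C(1) by (intro mult_right_mono) auto
      then have "real n * c n * (C / (real m * c m)) \<le> C'" by (simp add: C'_def mult_ac)
      then show ?thesis using c_pos[OF hn(2)] C(1) cm by (subst ennreal_mult[symmetric]) (auto intro!: ennreal_leI)
    qed
    have a_nn: "(\<lambda>u. ennreal (a u)) \<in> borel_measurable (env_vec (h n))" by measurable
    note bd = bounds[OF m(1) a_nn, folded nm]
    have E: "ennreal (exp (\<theta> * s) * a u) = ennreal (a u) * ennreal (exp (\<theta> * s))" for s u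
      using a by (simp add: ennreal_mult mult.commute)
    have aU: "ennreal (a u * U s) = ennreal (a u) * ennreal (U s)" for u s
      using a U_nonneg by (intro ennreal_mult) auto
    have aV: "ennreal (a u * V s) = ennreal (a u) * ennreal (V s)" for u s
      using a V_nonneg by (intro ennreal_mult) auto
    have 1: "ennreal (real n * c n) * (\<integral>\<^sup>+\<omega>. (if \<forall>i<n. walk 0 \<omega> n < walk 0 \<omega> i then ennreal (exp (\<theta> * walk 0 \<omega> n) * a (first_envs (h n) \<omega>)) else 0) \<partial>P)
      \<le> ennreal C' * (\<Sum>j. ennreal (exp (- \<theta> * real j)) * ennreal (U (real j + 1)) * (\<integral>\<^sup>+\<omega>. ennreal (a (first_envs (h n) \<omega>)) \<partial>P_plus (real j + 1)))" (is "_ \<le> _ * ?S")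
    proof -
      have eq: "ennreal (U (real j + 1)) * (\<integral>\<^sup>+\<omega>. ennreal (a (first_envs (h n) \<omega>)) \<partial>P_plus (real j + 1))
        = (\<integral>\<^sup>+\<omega>. (if \<forall>i\<le>h n. walk (real j + 1) \<omega> i \<ge> 0 then ennreal (a (first_envs (h n) \<omega>)) * ennreal (U (walk (real j + 1) \<omega> (h n))) else 0) \<partial>P)" for j
      proof (subst plus_law_nn[OF P_plus _ a_meas])
        show "0 \<le> a v" "a v \<le> B" for v using a by auto
        show "(\<integral>\<^sup>+\<omega>. (if \<forall>i\<le>h n. 0 \<le> walk (real j + 1) \<omega> i then ennreal (a (first_envs (h n) \<omega>) * U (walk (real j + 1) \<omega> (h n))) else 0) \<partial>P)
          = (\<integral>\<^sup>+\<omega>. (if \<forall>i\<le>h n. walk (real j + 1) \<omega> i \<ge> 0 then ennreal (a (first_envs (h n) \<omega>)) * ennreal (U (walk (real j + 1) \<omega> (h n))) else 0) \<partial>P)"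
          unfolding aU ..
      qed simp_all
      have "ennreal (real n * c n) * (\<integral>\<^sup>+\<omega>. (if \<forall>i<n. walk 0 \<omega> n < walk 0 \<omega> i then ennreal (exp (\<theta> * walk 0 \<omega> n) * a (first_envs (h n) \<omega>)) else 0) \<partial>P)
        \<le> ennreal (real n * c n) * (ennreal (C / (real m * c m)) * ?S)"
        unfolding E mult.assoc eq using bd by (intro mult_left_mono) auto
      also have "\<dots> \<le> ennreal C' * ?S"
        unfolding mult.assoc[symmetric] by (intro mult_right_mono ratio[unfolded mult.assoc[symmetric]]) simp
      finally show ?thesis .
    qed
    have 2: "ennreal (real n * c n) * (\<integral>\<^sup>+\<omega>. (if \<forall>i<n. walk 0 \<omega> n < walk 0 \<omega> i then ennreal (exp (\<theta> * walk 0 \<omega> n) * a (last_envs_rev n (h n) \<omega>)) else 0) \<partial>P)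
      \<le> ennreal C' * strip_sum \<theta> * (\<integral>\<^sup>+\<omega>. ennreal (a (first_envs (h n) \<omega>)) \<partial>P_minus)" (is "_ \<le> _ * _ * ?S")
    proof -
      have walk_end: "walk 0 (rev_seq n \<omega>) n = walk 0 \<omega> n" for \<omega> by (simp add: walk_rev_seq)
      have eq: "?S = (\<integral>\<^sup>+\<omega>. (if \<forall>i\<in>{1..h n}. walk 0 \<omega> i < 0 then ennreal (a (first_envs (h n) \<omega>)) * ennreal (V (walk 0 \<omega> (h n))) else 0) \<partial>P)"
      proof (subst minus_law_nn[OF P_minus hn(1) a_meas])
        show "0 \<le> a v" "a v \<le> B" for v using a by auto
        show "(\<integral>\<^sup>+\<omega>. (if \<forall>i\<in>{1..h n}. walk 0 \<omega> i < 0 then ennreal (a (first_envs (h n) \<omega>) * V (walk 0 \<omega> (h n))) else 0) \<partial>P)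
          = (\<integral>\<^sup>+\<omega>. (if \<forall>i\<in>{1..h n}. walk 0 \<omega> i < 0 then ennreal (a (first_envs (h n) \<omega>)) * ennreal (V (walk 0 \<omega> (h n))) else 0) \<partial>P)"
          unfolding aV ..
      qed
      have "(\<integral>\<^sup>+\<omega>. (if \<forall>i<n. walk 0 \<omega> n < walk 0 \<omega> i then ennreal (exp (\<theta> * walk 0 \<omega> n) * a (last_envs_rev n (h n) \<omega>)) else 0) \<partial>P)
        = (\<integral>\<^sup>+\<omega>. (if \<forall>i\<in>{1..n}. walk 0 (rev_seq n \<omega>) i < 0 then ennreal (a (first_envs (h n) (rev_seq n \<omega>))) * ennreal (exp (\<theta> * walk 0 (rev_seq n \<omega>) n)) else 0) \<partial>P)"
        unfolding strict_min_rev_seq first_envs_rev_seq[OF hle] walk_end E ..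
      also have "\<dots> = (\<integral>\<^sup>+\<omega>. (if \<forall>i\<in>{1..n}. walk 0 \<omega> i < 0 then ennreal (a (first_envs (h n) \<omega>)) * ennreal (exp (\<theta> * walk 0 \<omega> n)) else 0) \<partial>P)"
        by (rule nn_integral_rev_seq) measurable
      finally have rev: "(\<integral>\<^sup>+\<omega>. (if \<forall>i<n. walk 0 \<omega> n < walk 0 \<omega> i then ennreal (exp (\<theta> * walk 0 \<omega> n) * a (last_envs_rev n (h n) \<omega>)) else 0) \<partial>P)
        = (\<integral>\<^sup>+\<omega>. (if \<forall>i\<in>{1..n}. walk 0 \<omega> i < 0 then ennreal (a (first_envs (h n) \<omega>)) * ennreal (exp (\<theta> * walk 0 \<omega> n)) else 0) \<partial>P)" .
      have "ennreal (real n * c n) * (\<integral>\<^sup>+\<omega>. (if \<forall>i<n. walk 0 \<omega> n < walk 0 \<omega> i then ennreal (exp (\<theta> * walk 0 \<omega> n) * a (last_envs_rev n (h n) \<omega>)) else 0) \<partial>P)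
        \<le> ennreal (real n * c n) * (ennreal (C / (real m * c m)) * strip_sum \<theta> * ?S)"
        unfolding rev eq using bd by (intro mult_left_mono) auto
      also have "\<dots> \<le> ennreal C' * strip_sum \<theta> * ?S"
        unfolding mult.assoc[symmetric] by (intro mult_right_mono ratio[unfolded mult.assoc[symmetric]]) simp_all
      finally show ?thesis .
    qed
    note 1 2
  }
  then show ?thesis by blast
qed

end

lemma dist_triple_le: "dist (a, b, z) (a', b', z) \<le> dist a a' + dist b b'"
proof -
  have "dist (a, b, z) (a', b', z) = sqrt ((dist a a')\<^sup>2 + (dist b b')\<^sup>2)"
    by (simp add: dist_Pair_Pair)
  also have "\<dots> \<le> dist a a' + dist b b'" by (rule sqrt_sum_squares_le_sum) auto
  finally show ?thesis .
qed

locale convergent_functionals = conditioned_env +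
  fixes w :: "nat \<Rightarrow> (nat \<Rightarrow> nat pmf) \<Rightarrow> 'w :: polish_space"
    and t :: "nat \<Rightarrow> (nat \<Rightarrow> nat pmf) \<Rightarrow> 't :: polish_space"
    and W_inf :: "(nat \<Rightarrow> nat pmf) \<Rightarrow> 'w"
    and T_inf :: "(nat \<Rightarrow> nat pmf) \<Rightarrow> 't"
  assumes w_meas [measurable]: "\<And>n. w n \<in> borel_measurable (env_vec (h n))"
    and t_meas [measurable]: "\<And>n. t n \<in> borel_measurable (env_vec (h n))"
    and W_inf_meas [measurable]: "W_inf \<in> borel_measurable P"
    and T_inf_meas [measurable]: "T_inf \<in> borel_measurable P"
    and W_lim: "\<And>x. x \<ge> 0 \<Longrightarrow> AE \<omega> in P_plus x. (\<lambda>n. w n (first_envs (h n) \<omega>)) \<longlonglongrightarrow> W_inf \<omega>"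
    and T_lim: "AE \<omega> in P_minus. (\<lambda>n. t n (first_envs (h n) \<omega>)) \<longlonglongrightarrow> T_inf \<omega>"
begin

definition limit_int :: "('w \<times> 't \<times> real \<Rightarrow> real) \<Rightarrow> real \<Rightarrow> ennreal" where
  "limit_int \<Phi> z = (\<integral>\<^sup>+\<omega>'. (\<integral>\<^sup>+\<omega>. ennreal (\<Phi> (W_inf \<omega>, T_inf \<omega>', z)) \<partial>P_plus z) \<partial>P_minus)"

definition horizon_int :: "nat \<Rightarrow> ('w \<times> 't \<times> real \<Rightarrow> real) \<Rightarrow> real \<Rightarrow> ennreal" where
  "horizon_int r \<Phi> z = (\<integral>\<^sup>+\<omega>'. (\<integral>\<^sup>+\<omega>. ennreal (\<Phi> (w r (first_envs (h r) \<omega>), t r (first_envs (h r) \<omega>'), z)) \<partial>P_plus z) \<partial>P_minus)"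

definition pre_limit :: "('w \<times> 't \<times> real \<Rightarrow> real) \<Rightarrow> nat \<Rightarrow> ennreal" where
  "pre_limit \<Phi> n = ennreal (real n * c n) * (\<integral>\<^sup>+\<omega>. (if \<forall>i<n. walk 0 \<omega> n < walk 0 \<omega> i
     then ennreal (exp (\<theta> * walk 0 \<omega> n) * \<Phi> (w n (first_envs (h n) \<omega>), t n (last_envs_rev n (h n) \<omega>), - walk 0 \<omega> n)) else 0) \<partial>P)"

lemma nn_integral_bounded_convergence:
  assumes "prob_space M" and u: "\<And>n. u n \<in> borel_measurable M" "u' \<in> borel_measurable M"
    and bound: "\<And>n x. u n x \<le> ennreal B" and lim: "AE x in M. (\<lambda>n. u n x) \<longlonglongrightarrow> u' x"
  shows "(\<lambda>n. \<integral>\<^sup>+x. u n x \<partial>M) \<longlonglongrightarrow> (\<integral>\<^sup>+x. u' x \<partial>M)"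
proof -
  interpret prob_space M by fact
  show ?thesis
    by (rule nn_integral_dominated_convergence[where w="\<lambda>_. ennreal B"])
       (use u bound lim in \<open>auto simp: emeasure_space_1\<close>)
qed

lemma continuous_meas:
  "continuous_on UNIV \<Phi> \<Longrightarrow> \<Phi> \<in> borel_measurable (borel :: ('w \<times> 't \<times> real) measure)"
  for \<Phi> :: "'w \<times> 't \<times> real \<Rightarrow> real"
  by (rule borel_measurable_continuous_onI)

lemma nn_integral_prob_le:
  "prob_space M \<Longrightarrow> (\<And>x. u x \<le> ennreal B) \<Longrightarrow> (\<integral>\<^sup>+x. u x \<partial>M) \<le> ennreal B"
proof -
  assume "prob_space M" and le: "\<And>x. u x \<le> ennreal B"
  then interpret prob_space M by simp
  have "(\<integral>\<^sup>+x. u x \<partial>M) \<le> (\<integral>\<^sup>+x. ennreal B \<partial>M)" by (intro nn_integral_mono le)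
  then show ?thesis by (simp add: emeasure_space_1)
qed

lemma horizon_int_tendsto:
  assumes \<Phi>: "continuous_on UNIV \<Phi>" "\<And>p. \<Phi> p \<le> B" and z: "z \<ge> 0"
  shows "(\<lambda>r. horizon_int r \<Phi> z) \<longlonglongrightarrow> limit_int \<Phi> z"
proof -
  note [measurable] = continuous_meas[OF \<Phi>(1)]
  note [measurable_cong] = sets_plus[OF z]
  interpret plus: prob_space "P_plus z" by (rule prob_space_plus[OF z])
  have le: "ennreal (\<Phi> p) \<le> ennreal B" for p by (intro ennreal_leI \<Phi>)
  show ?thesis
    unfolding horizon_int_def limit_int_def
  proof (rule nn_integral_bounded_convergence[OF prob_space_minus, where B=B])
    show "AE \<omega>' in P_minus. (\<lambda>n. \<integral>\<^sup>+\<omega>. ennreal (\<Phi> (w n (first_envs (h n) \<omega>), t n (first_envs (h n) \<omega>'), z)) \<partial>P_plus z)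
       \<longlonglongrightarrow> (\<integral>\<^sup>+\<omega>. ennreal (\<Phi> (W_inf \<omega>, T_inf \<omega>', z)) \<partial>P_plus z)"
      using T_lim
    proof eventually_elim
      case T: (elim \<omega>')
      show ?case
      proof (rule nn_integral_bounded_convergence[OF prob_space_plus[OF z], where B=B])
        show "AE \<omega> in P_plus z. (\<lambda>n. ennreal (\<Phi> (w n (first_envs (h n) \<omega>), t n (first_envs (h n) \<omega>'), z)))
          \<longlonglongrightarrow> ennreal (\<Phi> (W_inf \<omega>, T_inf \<omega>', z))"
          using W_lim[OF z]
        proof eventually_elim
          case (elim \<omega>)
          have "isCont \<Phi> (W_inf \<omega>, T_inf \<omega>', z)" using \<Phi>(1) by (simp add: continuous_on_eq_continuous_at)
          from isCont_tendsto_compose[OF this tendsto_Pair[OF elim tendsto_Pair[OF T tendsto_const]]]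
          show ?case by (rule tendsto_ennrealI)
        qed
      qed (use le in measurable)
    qed
    show "(\<integral>\<^sup>+\<omega>. ennreal (\<Phi> (w n (first_envs (h n) \<omega>), t n (first_envs (h n) \<omega>'), z)) \<partial>P_plus z) \<le> ennreal B" for n \<omega>'
      by (rule nn_integral_prob_le[OF prob_space_plus[OF z] le])
  qed measurable
qed

text \<open>Nothing is assumed about the dependence of the law \<open>P_plus z\<close> on \<open>z\<close>; its measurability comes
  from expressing cylinder functionals by the harmonic transform of \<open>P\<close>.\<close>

lemma horizon_liminf:
  assumes \<Phi>: "continuous_on UNIV \<Phi>" "\<And>p. 1 \<le> \<Phi> p" "\<And>p. \<Phi> p \<le> B"
    and lip: "L \<ge> 0" "\<And>p q. \<bar>\<Phi> p - \<Phi> q\<bar> \<le> L * dist p q" and r: "h r \<ge> 1"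
  shows "(\<lambda>z. U_weight z * horizon_int r \<Phi> z) \<in> borel_measurable lborel" (is ?meas)
    and "ennreal K * (\<integral>\<^sup>+z. U_weight z * horizon_int r \<Phi> z \<partial>lborel) \<le>
     liminf (\<lambda>n. ennreal (real n * c n) * (\<integral>\<^sup>+\<omega>. (if \<forall>i<n. walk 0 \<omega> n < walk 0 \<omega> i
       then ennreal (exp (\<theta> * walk 0 \<omega> n) * \<Phi> (w r (first_envs (h r) \<omega>), t r (last_envs_rev n (h r) \<omega>), - walk 0 \<omega> n)) else 0) \<partial>P))" (is ?liminf)
proof -
  note [measurable] = continuous_meas[OF \<Phi>(1)]
  have B: "B \<ge> 1" using \<Phi>(2,3) order_trans by blast
  define G where "G u v z = ennreal (exp (- \<theta> * z) * \<Phi> (w r u, t r v, max z 0))" for u v z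
  have G_meas: "(\<lambda>(u, v, z). G u v z) \<in> borel_measurable (env_vec (h r) \<Otimes>\<^sub>M env_vec (h r) \<Otimes>\<^sub>M borel)"
    unfolding G_def by measurable
  have growth: "G u v z \<le> ennreal (exp ((\<theta> + L) * s)) * G u v (z + s)" if s: "0 \<le> s" for u v z s
  proof -
    let ?p = "(w r u, t r v, max z 0)" and ?q = "(w r u, t r v, max (z + s) 0)"
    have "dist ?p ?q \<le> s" using s by (auto simp: dist_Pair_Pair dist_real_def)
    then have "L * dist ?p ?q \<le> L * s" using lip(1) by (intro mult_left_mono)
    then have "\<Phi> ?p \<le> \<Phi> ?q + L * s" using lip(2)[of ?p ?q] by linarith
    also have "\<dots> \<le> \<Phi> ?q + L * s * \<Phi> ?q" using mult_left_mono[OF \<Phi>(2)[of ?q], of "L * s"] lip(1) s by simp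
    also have "\<dots> = (1 + L * s) * \<Phi> ?q" by (simp add: algebra_simps)
    also have "\<dots> \<le> exp (L * s) * \<Phi> ?q" using \<Phi>(2)[of ?q] exp_ge_add_one_self[of "L * s"] by (intro mult_right_mono) auto
    finally have "exp (- \<theta> * z) * \<Phi> ?p \<le> exp (- \<theta> * z) * (exp (L * s) * \<Phi> ?q)" by (intro mult_left_mono) auto
    also have "\<dots> = exp ((\<theta> + L) * s) * (exp (- \<theta> * (z + s)) * \<Phi> ?q)"
      by (simp add: mult.assoc[symmetric] exp_add[symmetric] algebra_simps)
    finally have "ennreal (exp (- \<theta> * z) * \<Phi> ?p) \<le> ennreal (exp ((\<theta> + L) * s) * (exp (- \<theta> * (z + s)) * \<Phi> ?q))"
      by (rule ennreal_leI)
    also have "\<dots> = ennreal (exp ((\<theta> + L) * s)) * G u v (z + s)"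
      unfolding G_def using \<Phi>(2)[of ?q] by (intro ennreal_mult) (auto intro!: mult_nonneg_nonneg)
    finally show ?thesis by (simp add: G_def)
  qed
  have mu: "0 \<le> \<theta> + L" using \<theta> lip by simp
  note hp_meas = head_part_meas[OF G_meas r mu growth]
  note fh = fixed_horizon_liminf[OF G_meas r mu growth]
  have space_first: "first_envs (h r) \<omega> \<in> space (env_vec (h r))" for \<omega>
    using measurable_space[OF first_envs_meas, of \<omega> "h r"] by simp
  define M where "M z v = (\<integral>\<^sup>+\<omega>. (if \<forall>i\<le>h r. walk z \<omega> i \<ge> 0
      then G (first_envs (h r) \<omega>) v z * ennreal (U (walk z \<omega> (h r))) else 0) \<partial>P)" for z v
  have M_meas: "(\<lambda>(z, v). M z v) \<in> borel_measurable (borel \<Otimes>\<^sub>M env_vec (h r))"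
    unfolding M_def G_def by measurable
  have M_meas' [measurable (raw)]: "(\<lambda>x. M (f x) (g x)) \<in> borel_measurable N'" 
    if [measurable]: "f \<in> borel_measurable N'" "g \<in> measurable N' (env_vec (h r))" for f g N'
  proof -
    have "(\<lambda>x. case (f x, g x) of (z, v) \<Rightarrow> M z v) \<in> borel_measurable N'"
      by (rule measurable_compose[OF _ M_meas]) measurable
    then show ?thesis by simp
  qed
  have M_eq: "M z v = U_weight z * (\<integral>\<^sup>+\<omega>. ennreal (\<Phi> (w r (first_envs (h r) \<omega>), t r v, z)) \<partial>P_plus z)"
    if v: "v \<in> space (env_vec (h r))" for z v
  proof (cases "z \<ge> 0")
    case True
    note [measurable_cong] = sets_plus[OF True]
    let ?\<psi> = "\<lambda>u. exp (- \<theta> * z) * \<Phi> (w r u, t r v, z)"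
    have nn: "0 \<le> \<Phi> p" for p using \<Phi>(2)[of p] by linarith
    have "M z v = (\<integral>\<^sup>+\<omega>. (if \<forall>i\<le>h r. walk z \<omega> i \<ge> 0 then ennreal (?\<psi> (first_envs (h r) \<omega>) * U (walk z \<omega> (h r))) else 0) \<partial>P)"
    proof -
      have "G u v z * ennreal (U s) = ennreal (?\<psi> u * U s)" for u s
        unfolding G_def using True nn U_nonneg by (subst ennreal_mult[symmetric]) auto
      then show ?thesis unfolding M_def by (simp only:)
    qed
    also have "\<dots> = ennreal (U z) * (\<integral>\<^sup>+\<omega>. ennreal (?\<psi> (first_envs (h r) \<omega>)) \<partial>P_plus z)"
      using v nn \<Phi>(3) by (intro plus_law_nn[symmetric, OF P_plus[OF True] True, where B="exp (- \<theta> * z) * B"]) (auto intro!: mult_left_mono)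
    also have "(\<integral>\<^sup>+\<omega>. ennreal (?\<psi> (first_envs (h r) \<omega>)) \<partial>P_plus z) = ennreal (exp (- \<theta> * z)) * (\<integral>\<^sup>+\<omega>. ennreal (\<Phi> (w r (first_envs (h r) \<omega>), t r v, z)) \<partial>P_plus z)"
      using v nn by (subst nn_integral_cmult[symmetric]) (auto simp: ennreal_mult)
    also have "ennreal (U z) * (ennreal (exp (- \<theta> * z)) * (\<integral>\<^sup>+\<omega>. ennreal (\<Phi> (w r (first_envs (h r) \<omega>), t r v, z)) \<partial>P_plus z))
      = U_weight z * (\<integral>\<^sup>+\<omega>. ennreal (\<Phi> (w r (first_envs (h r) \<omega>), t r v, z)) \<partial>P_plus z)"
      using True U_nonneg by (simp add: U_weight_def ennreal_mult mult_ac)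
    finally show ?thesis .
  next
    case False
    then have "\<not> (\<forall>i\<le>h r. walk z \<omega> i \<ge> 0)" for \<omega> by (auto intro!: exI[of _ 0])
    then have "M z v = (\<integral>\<^sup>+\<omega>. 0 \<partial>P)" unfolding M_def by (simp only: if_False)
    then show ?thesis using False by (simp add: U_weight_def)
  qed
  have head_eq: "head_part G (h r) v = (\<integral>\<^sup>+z. M z v \<partial>lborel)" for v
    unfolding M_def by (rule head_part_def[OF G_meas r mu growth])
  define IU where "IU = (LINT z:{0..}|lborel. exp (- \<theta> * z) * U z)"
  have IU: "IU \<ge> 0" unfolding IU_def set_lebesgue_integral_def using U_nonneg by (intro Bochner_Integration.integral_nonneg) auto
  have head_le: "head_part G (h r) v \<le> ennreal (B * IU)" if v: "v \<in> space (env_vec (h r))" for v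
  proof -
    have "head_part G (h r) v \<le> (\<integral>\<^sup>+z. U_weight z * ennreal B \<partial>lborel)"
      unfolding head_eq
    proof (intro nn_integral_mono)
      fix z
      show "M z v \<le> U_weight z * ennreal B"
      proof (cases "z \<ge> 0")
        case True
        then show ?thesis unfolding M_eq[OF v]
          by (intro mult_left_mono nn_integral_prob_le prob_space_plus ennreal_leI \<Phi>(3)) auto
      qed (simp add: M_eq[OF v] U_weight_def)
    qed
    also have "\<dots> = (\<integral>\<^sup>+z. U_weight z \<partial>lborel) * ennreal B"
      by (rule nn_integral_multc) measurable
    also have "\<dots> = ennreal (B * IU)"
      unfolding U_weight_integral IU_def[symmetric] using B IU by (simp add: ennreal_mult mult.commute)
    finally show ?thesis .
  qed
  define \<psi> where "\<psi> v = min (enn2real (head_part G (h r) v)) (B * IU)" for v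
  have BIU: "0 \<le> B * IU" using B IU by simp
  have \<psi>: "ennreal (\<psi> v) = head_part G (h r) v" if "v \<in> space (env_vec (h r))" for v
  proof -
    have "head_part G (h r) v < \<top>" using head_le[OF that] by (simp add: le_less_trans)
    moreover have "enn2real (head_part G (h r) v) \<le> B * IU" using head_le[OF that] BIU enn2real_leI by blast
    ultimately show ?thesis by (simp add: \<psi>_def min_absorb1)
  qed
  have KV: "ennreal (K * V s) * head_part G (h r) (first_envs (h r) \<omega>) = ennreal K * ennreal (\<psi> (first_envs (h r) \<omega>) * V s)" for s \<omega>
  proof -
    have nn: "0 \<le> \<psi> (first_envs (h r) \<omega>)" using BIU by (simp add: \<psi>_def)
    show ?thesis unfolding \<psi>[OF space_first, symmetric]
      using K_pos V_nonneg nn by (simp add: ennreal_mult[symmetric] mult_ac)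
  qed
  interpret minus: prob_space P_minus by (rule prob_space_minus)
  have Mz: "U_weight z * horizon_int r \<Phi> z = (\<integral>\<^sup>+\<omega>'. M z (first_envs (h r) \<omega>') \<partial>P_minus)" for z
  proof (cases "z \<ge> 0")
    case True
    note [measurable_cong] = sets_plus[OF True]
    interpret plus: prob_space "P_plus z" by (rule prob_space_plus[OF True])
    show ?thesis unfolding horizon_int_def M_eq[OF space_first]
      by (rule nn_integral_cmult[symmetric]) measurable
  qed (simp add: M_eq[OF space_first] U_weight_def)
  show ?meas unfolding Mz by measurable
  have "ennreal K * (\<integral>\<^sup>+z. U_weight z * horizon_int r \<Phi> z \<partial>lborel) = ennreal K * (\<integral>\<^sup>+\<omega>'. (\<integral>\<^sup>+z. M z (first_envs (h r) \<omega>') \<partial>lborel) \<partial>P_minus)"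
  proof -
    interpret pair_sigma_finite lborel P_minus ..
    show ?thesis unfolding Mz by (subst Fubini') measurable
  qed
  also have "\<dots> = ennreal K * (\<integral>\<^sup>+\<omega>'. ennreal (\<psi> (first_envs (h r) \<omega>')) \<partial>P_minus)"
    unfolding head_eq[symmetric] \<psi>[OF space_first] ..
  also have "(\<integral>\<^sup>+\<omega>'. ennreal (\<psi> (first_envs (h r) \<omega>')) \<partial>P_minus)
    = (\<integral>\<^sup>+\<omega>. (if \<forall>i\<in>{1..h r}. walk 0 \<omega> i < 0 then ennreal (\<psi> (first_envs (h r) \<omega>) * V (walk 0 \<omega> (h r))) else 0) \<partial>P)"
  proof (rule minus_law_nn[OF P_minus r, where B="B * IU"])
    show "\<psi> \<in> borel_measurable (env_vec (h r))" unfolding \<psi>_def[abs_def] using hp_meas by measurable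
  qed (use BIU in \<open>auto simp: \<psi>_def\<close>)
  also have "ennreal K * \<dots> = (\<integral>\<^sup>+\<omega>. ennreal K * (if \<forall>i\<in>{1..h r}. walk 0 \<omega> i < 0 then ennreal (\<psi> (first_envs (h r) \<omega>) * V (walk 0 \<omega> (h r))) else 0) \<partial>P)"
  proof (rule nn_integral_cmult[symmetric])
    have [measurable]: "\<psi> \<in> borel_measurable (env_vec (h r))" unfolding \<psi>_def[abs_def] using hp_meas by measurable
    show "(\<lambda>\<omega>. if \<forall>i\<in>{1..h r}. walk 0 \<omega> i < 0 then ennreal (\<psi> (first_envs (h r) \<omega>) * V (walk 0 \<omega> (h r))) else 0) \<in> borel_measurable P"
      by measurable
  qed
  also have "\<dots> = (\<integral>\<^sup>+\<omega>. (if \<forall>i\<in>{1..h r}. walk 0 \<omega> i < 0 then ennreal (K * V (walk 0 \<omega> (h r))) * head_part G (h r) (first_envs (h r) \<omega>) else 0) \<partial>P)"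
    unfolding KV if_distrib[of "(*) (ennreal K)"] mult_zero_right ..
  also note fh
  finally have final: "ennreal K * (\<integral>\<^sup>+z. U_weight z * horizon_int r \<Phi> z \<partial>lborel) \<le>
    liminf (\<lambda>n. ennreal (real n * c n) * (\<integral>\<^sup>+\<omega>. (if \<forall>i<n. walk 0 \<omega> n < walk 0 \<omega> i
      then G (first_envs (h r) \<omega>) (last_envs_rev n (h r) \<omega>) (- walk 0 \<omega> n) else 0) \<partial>P))" .
  have G_int: "(\<integral>\<^sup>+\<omega>. (if \<forall>i<n. walk 0 \<omega> n < walk 0 \<omega> i then G (first_envs (h r) \<omega>) (last_envs_rev n (h r) \<omega>) (- walk 0 \<omega> n) else 0) \<partial>P)
    = (\<integral>\<^sup>+\<omega>. (if \<forall>i<n. walk 0 \<omega> n < walk 0 \<omega> i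
       then ennreal (exp (\<theta> * walk 0 \<omega> n) * \<Phi> (w r (first_envs (h r) \<omega>), t r (last_envs_rev n (h r) \<omega>), - walk 0 \<omega> n)) else 0) \<partial>P)" for n
  proof (intro nn_integral_cong if_cong refl)
    fix \<omega> assume *: "\<forall>i<n. walk 0 \<omega> n < walk 0 \<omega> i"
    have "walk 0 \<omega> n \<le> 0" using *[rule_format, of 0] by (cases "n = 0") auto
    then show "G (first_envs (h r) \<omega>) (last_envs_rev n (h r) \<omega>) (- walk 0 \<omega> n)
      = ennreal (exp (\<theta> * walk 0 \<omega> n) * \<Phi> (w r (first_envs (h r) \<omega>), t r (last_envs_rev n (h r) \<omega>), - walk 0 \<omega> n))"
      by (simp add: G_def max_def)
  qed
  show ?liminf using final unfolding G_int .
qed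

end

lemma first_envs_first_envs: "k \<le> l \<Longrightarrow> first_envs k (first_envs l \<omega>) = first_envs k \<omega>"
  by (auto simp: first_envs_def restrict_def)

lemma first_envs_last_envs_rev: "k \<le> l \<Longrightarrow> first_envs k (last_envs_rev n l \<omega>) = last_envs_rev n k \<omega>"
  by (auto simp: first_envs_def last_envs_rev_def restrict_def)

lemma first_envs_env_vec_meas: "k \<le> l \<Longrightarrow> first_envs k \<in> measurable (env_vec l) (env_vec k)"
  unfolding first_envs_def[abs_def] env_vec_def
  by (rule measurable_restrict_subset) auto

text \<open>The infimal convolutions with multiples of the metric approximate \<open>\<Phi>\<close> from below.\<close>

definition lip_approx :: "nat \<Rightarrow> ('a :: metric_space \<Rightarrow> real) \<Rightarrow> 'a \<Rightarrow> real" where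
  "lip_approx k \<Phi> p = (INF q. \<Phi> q + real k * dist p q)"

context
  fixes \<Phi> :: "'a :: metric_space \<Rightarrow> real" and m :: real
  assumes lower: "\<And>p. m \<le> \<Phi> p"
begin

lemma lip_approx_bdd: "bdd_below (range (\<lambda>q. \<Phi> q + real k * dist p q))"
  using lower by (intro bdd_belowI2[where m=m]) (auto intro: add_increasing2)

lemma lip_approx_ge: "m \<le> lip_approx k \<Phi> p"
  unfolding lip_approx_def by (rule cINF_greatest) (auto intro: add_increasing2 lower)

lemma lip_approx_le: "lip_approx k \<Phi> p \<le> \<Phi> q + real k * dist p q"
  unfolding lip_approx_def by (rule cINF_lower[OF lip_approx_bdd]) simp

lemma lip_approx_le_self: "lip_approx k \<Phi> p \<le> \<Phi> p"
  using lip_approx_le[of k p p] by simp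

lemma lip_approx_lipschitz: "\<bar>lip_approx k \<Phi> p - lip_approx k \<Phi> p'\<bar> \<le> real k * dist p p'"
proof -
  have *: "lip_approx k \<Phi> p - real k * dist p p' \<le> lip_approx k \<Phi> p'" for p p'
    unfolding lip_approx_def[of k \<Phi> p']
  proof (rule cINF_greatest)
    fix q
    have "lip_approx k \<Phi> p \<le> \<Phi> q + real k * dist p q" by (rule lip_approx_le)
    also have "real k * dist p q \<le> real k * (dist p p' + dist p' q)"
      by (intro mult_left_mono dist_triangle) auto
    finally show "lip_approx k \<Phi> p - real k * dist p p' \<le> \<Phi> q + real k * dist p' q"
      by (simp add: algebra_simps)
  qed simp
  show ?thesis using *[of p p'] *[of p' p] by (auto simp: dist_commute)
qed

lemma lip_approx_continuous: "continuous_on UNIV (lip_approx k \<Phi>)"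
proof -
  have "(real k)-lipschitz_on UNIV (lip_approx k \<Phi>)"
    using lip_approx_lipschitz by (intro lipschitz_onI) (auto simp: dist_real_def)
  then show ?thesis by (rule lipschitz_on_continuous_on)
qed

lemma lip_approx_tendsto:
  assumes cont: "continuous_on UNIV \<Phi>"
  shows "(\<lambda>k. lip_approx k \<Phi> p) \<longlonglongrightarrow> \<Phi> p"
proof (rule order_tendstoI)
  fix a assume a: "a < \<Phi> p"
  obtain b where b: "a < b" "b < \<Phi> p" using dense a by blast
  have "isCont \<Phi> p" using cont by (simp add: continuous_on_eq_continuous_at)
  then have "(\<Phi> \<longlongrightarrow> \<Phi> p) (nhds p)" by (simp add: isCont_def tendsto_at_iff_tendsto_nhds)
  then have "eventually (\<lambda>q. b < \<Phi> q) (nhds p)" using b(2) by (rule order_tendstoD(1))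
  then obtain d where d: "d > 0" "\<And>q. dist q p < d \<Longrightarrow> b < \<Phi> q"
    unfolding eventually_nhds_metric by blast
  obtain k0 :: nat where k0: "\<Phi> p - m \<le> real k0 * d"
    using ex_less_of_nat_mult[OF d(1), of "\<Phi> p - m"] by (auto intro: less_imp_le)
  have "a < lip_approx k \<Phi> p" if "k \<ge> k0" for k
  proof -
    have "b \<le> lip_approx k \<Phi> p"
      unfolding lip_approx_def
    proof (rule cINF_greatest)
      fix q
      show "b \<le> \<Phi> q + real k * dist p q"
      proof (cases "dist q p < d")
        case True
        then have "b < \<Phi> q" by (rule d)
        moreover have "0 \<le> real k * dist p q" by simp
        ultimately show ?thesis by linarith
      next
        case False
        have "real k0 * d \<le> real k * dist p q" using that False d by (intro mult_mono) (auto simp: dist_commute)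
        then show ?thesis using k0 lower[of q] b by linarith
      qed
    qed simp
    then show ?thesis using b by linarith
  qed
  then show "eventually (\<lambda>k. a < lip_approx k \<Phi> p) sequentially" unfolding eventually_sequentially by blast
next
  fix a assume "\<Phi> p < a"
  then show "eventually (\<lambda>k. lip_approx k \<Phi> p < a) sequentially"
    using lip_approx_le_self by (intro always_eventually) (auto intro: le_less_trans)
qed

end

context convergent_functionals
begin

lemma U_weight_finite: "U_weight z < \<top>"
  by (simp add: U_weight_def)

lemma U_weight_neg: "z < 0 \<Longrightarrow> U_weight z = 0"
  by (simp add: U_weight_def)

lemma weighted_convergence:
  assumes meas: "\<And>r. (\<lambda>z. U_weight z * f r z) \<in> borel_measurable lborel"
    and lim: "\<And>z. z \<ge> 0 \<Longrightarrow> (\<lambda>r. f r z) \<longlonglongrightarrow> g z" and bound: "\<And>r z. z \<ge> 0 \<Longrightarrow> f r z \<le> ennreal B"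
  shows "(\<lambda>z. U_weight z * g z) \<in> borel_measurable lborel"
    and "(\<lambda>r. \<integral>\<^sup>+z. U_weight z * f r z \<partial>lborel) \<longlonglongrightarrow> (\<integral>\<^sup>+z. U_weight z * g z \<partial>lborel)"
proof -
  have lim': "(\<lambda>r. U_weight z * f r z) \<longlonglongrightarrow> U_weight z * g z" for z
    using lim[of z] U_weight_neg[of z] U_weight_finite[of z] by (cases "z \<ge> 0") (auto intro!: ennreal_tendsto_cmult)
  show g_meas: "(\<lambda>z. U_weight z * g z) \<in> borel_measurable lborel"
    using lim' by (intro borel_measurable_LIMSEQ_order[OF _ meas])
  show "(\<lambda>r. \<integral>\<^sup>+z. U_weight z * f r z \<partial>lborel) \<longlonglongrightarrow> (\<integral>\<^sup>+z. U_weight z * g z \<partial>lborel)"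
  proof (rule nn_integral_dominated_convergence[where w="\<lambda>z. U_weight z * ennreal B"])
    have "(\<integral>\<^sup>+z. U_weight z * ennreal B \<partial>lborel) = (\<integral>\<^sup>+z. U_weight z \<partial>lborel) * ennreal B"
      by (rule nn_integral_multc) measurable
    also have "\<dots> < \<infinity>" unfolding U_weight_integral by (simp add: ennreal_mult_less_top)
    finally show "(\<integral>\<^sup>+z. U_weight z * ennreal B \<partial>lborel) < \<infinity>" .
    show "AE z in lborel. U_weight z * f r z \<le> U_weight z * ennreal B" for r
    proof (rule AE_I2)
      fix z show "U_weight z * f r z \<le> U_weight z * ennreal B"
        using bound[of z r] U_weight_neg[of z] by (cases "z \<ge> 0") (auto intro!: mult_left_mono)
    qed
  qed (use meas g_meas lim' in auto)
qed

lemma horizon_int_le: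
  assumes "\<And>p. \<Phi> p \<le> B" "z \<ge> 0"
  shows "horizon_int r \<Phi> z \<le> ennreal B"
  unfolding horizon_int_def using assms
  by (intro nn_integral_prob_le prob_space_minus prob_space_plus ennreal_leI)

lemma limit_int_le:
  assumes "\<And>p. \<Phi> p \<le> B" "z \<ge> 0"
  shows "limit_int \<Phi> z \<le> ennreal B"
  unfolding limit_int_def using assms
  by (intro nn_integral_prob_le prob_space_minus prob_space_plus ennreal_leI)

lemma h_eventually: "\<exists>r0. \<forall>r\<ge>r0. h r \<ge> 1"
proof -
  have "eventually (\<lambda>r. h r \<ge> 1) sequentially" using h_at_top by (simp add: filterlim_at_top)
  then show ?thesis by (simp add: eventually_sequentially)
qed

lemma lipschitz_liminf:
  assumes \<Phi>: "\<And>p. 1 \<le> \<Phi> p" "\<And>p. \<Phi> p \<le> B"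
    and lip: "L \<ge> 0" "\<And>p q. \<bar>\<Phi> p - \<Phi> q\<bar> \<le> L * dist p q" and cont: "continuous_on UNIV \<Phi>"
  shows "(\<lambda>z. U_weight z * limit_int \<Phi> z) \<in> borel_measurable lborel" (is ?meas)
    and "ennreal K * (\<integral>\<^sup>+z. U_weight z * limit_int \<Phi> z \<partial>lborel) \<le> liminf (pre_limit \<Phi>)" (is ?liminf)
proof -
  note [measurable] = continuous_meas[OF cont]
  have B: "B \<ge> 1" using \<Phi> order_trans by blast
  obtain r0 where r0: "\<And>r. r \<ge> r0 \<Longrightarrow> h r \<ge> 1" using h_eventually by blast
  have conv: "(\<lambda>z. U_weight z * limit_int \<Phi> z) \<in> borel_measurable lborel"
    "(\<lambda>r. \<integral>\<^sup>+z. U_weight z * horizon_int (r + r0) \<Phi> z \<partial>lborel) \<longlonglongrightarrow> (\<integral>\<^sup>+z. U_weight z * limit_int \<Phi> z \<partial>lborel)"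
    by (rule weighted_convergence[where B=B and f="\<lambda>r. horizon_int (r + r0) \<Phi>"];
        use horizon_liminf(1)[OF cont \<Phi> lip r0] horizon_int_le[OF \<Phi>(2)]
          LIMSEQ_ignore_initial_segment[OF horizon_int_tendsto[OF cont \<Phi>(2)]] in force)+
  show ?meas by (rule conv(1))
  define D where "D d = min B (L * d)" for d :: real
  have D: "0 \<le> D d" "D d \<le> B" if "d \<ge> 0" for d using that lip(1) B by (auto simp: D_def)
  have D_cont: "isCont D d" for d unfolding D_def by (intro continuous_intros)
  have D_meas [measurable]: "D \<in> borel_measurable borel" unfolding D_def by measurable
  have \<Phi>_diff: "\<Phi> (a, b, z) \<le> \<Phi> (a', b', z) + D (dist a' a) + D (dist b' b)" for a b a' b' z
  proof -
    have "L * dist (a, b, z) (a', b', z) \<le> L * (dist a' a + dist b' b)"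
      using lip(1) dist_triple_le[of a b z a' b'] by (intro mult_left_mono) (auto simp: dist_commute)
    then have "\<Phi> (a, b, z) - \<Phi> (a', b', z) \<le> L * dist a' a + L * dist b' b"
      using lip(2)[of "(a, b, z)" "(a', b', z)"] by (simp add: algebra_simps)
    moreover have "\<Phi> (a, b, z) - \<Phi> (a', b', z) \<le> B"
      using \<Phi>(1)[of "(a', b', z)"] \<Phi>(2)[of "(a, b, z)"] by linarith
    moreover have "0 \<le> L * dist a' a" "0 \<le> L * dist b' b" using lip(1) by auto
    ultimately show ?thesis unfolding D_def using B by (auto simp: min_def)
  qed
  obtain C n0 where err: "\<And>n a B'. n \<ge> n0 \<Longrightarrow> a \<in> borel_measurable (env_vec (h n)) \<Longrightarrow> (\<And>u. 0 \<le> a u \<and> a u \<le> (B'::real)) \<Longrightarrow>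
    ennreal (real n * c n) * (\<integral>\<^sup>+\<omega>. (if \<forall>i<n. walk 0 \<omega> n < walk 0 \<omega> i then ennreal (exp (\<theta> * walk 0 \<omega> n) * a (first_envs (h n) \<omega>)) else 0) \<partial>P)
      \<le> ennreal C * (\<Sum>j. ennreal (exp (- \<theta> * real j)) * ennreal (U (real j + 1)) * (\<integral>\<^sup>+\<omega>. ennreal (a (first_envs (h n) \<omega>)) \<partial>P_plus (real j + 1))) \<and>
    ennreal (real n * c n) * (\<integral>\<^sup>+\<omega>. (if \<forall>i<n. walk 0 \<omega> n < walk 0 \<omega> i then ennreal (exp (\<theta> * walk 0 \<omega> n) * a (last_envs_rev n (h n) \<omega>)) else 0) \<partial>P)
      \<le> ennreal C * strip_sum \<theta> * (\<integral>\<^sup>+\<omega>. ennreal (a (first_envs (h n) \<omega>)) \<partial>P_minus)"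
    using error_bounds by blast
  let ?a = "\<lambda>j. ennreal (exp (- \<theta> * real j)) * ennreal (U (real j + 1))"
  define wn where "wn n \<omega> = w n (first_envs (h n) \<omega>)" for n \<omega>
  define tn where "tn n \<omega> = t n (first_envs (h n) \<omega>)" for n \<omega>
  have wn_meas [measurable]: "wn n \<in> borel_measurable P" for n unfolding wn_def by measurable
  have tn_meas [measurable]: "tn n \<in> borel_measurable P" for n unfolding tn_def by measurable
  define dp where "dp r n j = (\<integral>\<^sup>+\<omega>. ennreal (D (dist (wn n \<omega>) (wn r \<omega>))) \<partial>P_plus (real j + 1))" for r n j
  define dp' where "dp' r j = (\<integral>\<^sup>+\<omega>. ennreal (D (dist (W_inf \<omega>) (wn r \<omega>))) \<partial>P_plus (real j + 1))" for r j
  define dm where "dm r n = (\<integral>\<^sup>+\<omega>. ennreal (D (dist (tn n \<omega>) (tn r \<omega>))) \<partial>P_minus)" for r n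
  define dm' where "dm' r = (\<integral>\<^sup>+\<omega>. ennreal (D (dist (T_inf \<omega>) (tn r \<omega>))) \<partial>P_minus)" for r
  have Dle: "ennreal (D (dist x y)) \<le> ennreal B" for x y :: "'z :: metric_space" by (intro ennreal_leI D) simp
  have D_lim: "(\<lambda>n. ennreal (D (dist (x n) (y n)))) \<longlonglongrightarrow> ennreal (D (dist a b))"
    if "x \<longlonglongrightarrow> a" "y \<longlonglongrightarrow> b" for x y :: "nat \<Rightarrow> 'z :: metric_space" and a b
    by (intro tendsto_ennrealI isCont_tendsto_compose[OF D_cont] tendsto_dist that)
  have D0: "D 0 = 0" using B by (simp add: D_def)
  have W_lim': "AE \<omega> in P_plus (real j + 1). (\<lambda>n. wn n \<omega>) \<longlonglongrightarrow> W_inf \<omega>" for j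
    unfolding wn_def by (rule W_lim) simp
  have T_lim': "AE \<omega> in P_minus. (\<lambda>n. tn n \<omega>) \<longlonglongrightarrow> T_inf \<omega>"
    unfolding tn_def by (rule T_lim)
  have ps: "prob_space (P_plus (real j + 1))" and sp: "sets (P_plus (real j + 1)) = sets P" for j :: nat
    by (auto intro!: prob_space_plus sets_plus)
  have dp_le: "dp r n j \<le> ennreal B" "dp' r j \<le> ennreal B" for r n j
    unfolding dp_def dp'_def by (auto intro!: nn_integral_prob_le ps Dle)
  have dp_lim: "(\<lambda>n. dp r n j) \<longlonglongrightarrow> dp' r j" for r j
  proof -
    note [measurable_cong] = sp[of j]
    show ?thesis unfolding dp_def dp'_def
    proof (rule nn_integral_bounded_convergence[OF ps _ _ Dle])
      show "AE \<omega> in P_plus (real j + 1). (\<lambda>n. ennreal (D (dist (wn n \<omega>) (wn r \<omega>)))) \<longlonglongrightarrow> ennreal (D (dist (W_inf \<omega>) (wn r \<omega>)))"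
        using W_lim' by eventually_elim (intro D_lim tendsto_const)
    qed measurable
  qed
  have dp'_lim: "(\<lambda>r. dp' r j) \<longlonglongrightarrow> 0" for j
  proof -
    note [measurable_cong] = sp[of j]
    have "(\<lambda>r. dp' r j) \<longlonglongrightarrow> (\<integral>\<^sup>+\<omega>. ennreal (D (dist (W_inf \<omega>) (W_inf \<omega>))) \<partial>P_plus (real j + 1))"
      unfolding dp'_def
    proof (rule nn_integral_bounded_convergence[OF ps _ _ Dle])
      show "AE \<omega> in P_plus (real j + 1). (\<lambda>r. ennreal (D (dist (W_inf \<omega>) (wn r \<omega>)))) \<longlonglongrightarrow> ennreal (D (dist (W_inf \<omega>) (W_inf \<omega>)))"
        using W_lim' by eventually_elim (intro D_lim tendsto_const)
    qed measurable
    then show ?thesis by (simp add: D0)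
  qed
  have dm_lim: "(\<lambda>n. dm r n) \<longlonglongrightarrow> dm' r" for r
    unfolding dm_def dm'_def
  proof (rule nn_integral_bounded_convergence[OF prob_space_minus _ _ Dle])
    show "AE \<omega> in P_minus. (\<lambda>n. ennreal (D (dist (tn n \<omega>) (tn r \<omega>)))) \<longlonglongrightarrow> ennreal (D (dist (T_inf \<omega>) (tn r \<omega>)))"
      using T_lim' by eventually_elim (intro D_lim tendsto_const)
  qed measurable
  have dm'_lim: "dm' \<longlonglongrightarrow> 0"
  proof -
    have "dm' \<longlonglongrightarrow> (\<integral>\<^sup>+\<omega>. ennreal (D (dist (T_inf \<omega>) (T_inf \<omega>))) \<partial>P_minus)"
      unfolding dm'_def[abs_def]
    proof (rule nn_integral_bounded_convergence[OF prob_space_minus _ _ Dle])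
      show "AE \<omega> in P_minus. (\<lambda>r. ennreal (D (dist (T_inf \<omega>) (tn r \<omega>)))) \<longlonglongrightarrow> ennreal (D (dist (T_inf \<omega>) (T_inf \<omega>)))"
        using T_lim' by eventually_elim (intro D_lim tendsto_const)
    qed measurable
    then show ?thesis by (simp add: D0)
  qed
  have dm'_fin: "dm' r < \<top>" for r
  proof -
    have "dm' r \<le> ennreal B" unfolding dm'_def by (intro nn_integral_prob_le prob_space_minus Dle)
    then show ?thesis by (rule le_less_trans) simp
  qed
  have a_fin: "(\<Sum>j. ?a j) < \<top>" using strip_sum_finite by (simp add: strip_sum_def)
  define e where "e r n = ennreal C * (\<Sum>j. ?a j * dp r n j) + ennreal C * strip_sum \<theta> * dm r n" for r n
  define e' where "e' r = ennreal C * (\<Sum>j. ?a j * dp' r j) + ennreal C * strip_sum \<theta> * dm' r" for r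
  have Cs: "ennreal C * strip_sum \<theta> < \<top>" using strip_sum_finite by (simp add: ennreal_mult_less_top)
  have e_lim: "(\<lambda>n. e r n) \<longlonglongrightarrow> e' r" for r
    unfolding e_def e'_def
    by (intro tendsto_add ennreal_tendsto_cmult suminf_dominated_convergence_ennreal[OF dp_lim dp_le(1) _ a_fin] dm_lim Cs) auto
  have e'_fin: "e' r < \<top>" for r
  proof -
    have "(\<Sum>j. ?a j * dp' r j) \<le> (\<Sum>j. ?a j * ennreal B)" by (intro suminf_le summableI mult_left_mono dp_le) auto
    also have "\<dots> < \<top>" using a_fin by (simp add: ennreal_mult_less_top)
    finally show ?thesis using Cs dm'_fin[of r] by (simp add: e'_def ennreal_mult_less_top)
  qed
  have e'_lim: "e' \<longlonglongrightarrow> 0"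
  proof -
    have "e' \<longlonglongrightarrow> ennreal C * (\<Sum>j. ?a j * 0) + ennreal C * strip_sum \<theta> * 0"
      unfolding e'_def[abs_def]
      by (intro tendsto_add ennreal_tendsto_cmult suminf_dominated_convergence_ennreal[OF dp'_lim dp_le(2) _ a_fin] dm'_lim Cs) auto
    then show ?thesis by simp
  qed
  have step: "ennreal K * (\<integral>\<^sup>+z. U_weight z * horizon_int r \<Phi> z \<partial>lborel) \<le> liminf (pre_limit \<Phi>) + e' r" if r: "r \<ge> r0" for r
  proof -
    let ?A = "\<lambda>n. ennreal (real n * c n) * (\<integral>\<^sup>+\<omega>. (if \<forall>i<n. walk 0 \<omega> n < walk 0 \<omega> i
       then ennreal (exp (\<theta> * walk 0 \<omega> n) * \<Phi> (w r (first_envs (h r) \<omega>), t r (last_envs_rev n (h r) \<omega>), - walk 0 \<omega> n)) else 0) \<partial>P)"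
    have "ennreal K * (\<integral>\<^sup>+z. U_weight z * horizon_int r \<Phi> z \<partial>lborel) \<le> liminf ?A"
      by (rule horizon_liminf(2)[OF cont \<Phi> lip r0[OF r]])
    also have "\<dots> \<le> liminf (\<lambda>n. pre_limit \<Phi> n + e r n)"
    proof (rule Liminf_mono)
      show "eventually (\<lambda>n. ?A n \<le> pre_limit \<Phi> n + e r n) sequentially"
        using eventually_ge_at_top[of n0] eventually_ge_at_top[of r]
      proof eventually_elim
        case (elim n)
        have hrn: "h r \<le> h n" using elim by (intro h_mono)
        note [measurable] = first_envs_env_vec_meas[OF hrn]
        let ?aw = "\<lambda>u. D (dist (w n u) (w r (first_envs (h r) u)))" and ?at = "\<lambda>u. D (dist (t n u) (t r (first_envs (h r) u)))"
        have aw: "?aw \<in> borel_measurable (env_vec (h n))" and at: "?at \<in> borel_measurable (env_vec (h n))"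
          by measurable
        have E1: "ennreal (real n * c n) * (\<integral>\<^sup>+\<omega>. (if \<forall>i<n. walk 0 \<omega> n < walk 0 \<omega> i then ennreal (exp (\<theta> * walk 0 \<omega> n) * ?aw (first_envs (h n) \<omega>)) else 0) \<partial>P)
          \<le> ennreal C * (\<Sum>j. ?a j * dp r n j)"
          using err[OF elim(1) aw, of B] D unfolding dp_def wn_def by (simp add: first_envs_first_envs[OF hrn])
        have E2: "ennreal (real n * c n) * (\<integral>\<^sup>+\<omega>. (if \<forall>i<n. walk 0 \<omega> n < walk 0 \<omega> i then ennreal (exp (\<theta> * walk 0 \<omega> n) * ?at (last_envs_rev n (h n) \<omega>)) else 0) \<partial>P)
          \<le> ennreal C * strip_sum \<theta> * dm r n"
          using err[OF elim(1) at, of B] D unfolding dm_def tn_def by (simp add: first_envs_first_envs[OF hrn])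
        let ?if = "\<lambda>\<omega> x. if \<forall>i<n. walk 0 \<omega> n < walk 0 \<omega> i then ennreal (exp (\<theta> * walk 0 \<omega> n) * x) else 0"
        have "?A n \<le> ennreal (real n * c n) * (\<integral>\<^sup>+\<omega>. ?if \<omega> (\<Phi> (w n (first_envs (h n) \<omega>), t n (last_envs_rev n (h n) \<omega>), - walk 0 \<omega> n))
            + ?if \<omega> (?aw (first_envs (h n) \<omega>)) + ?if \<omega> (?at (last_envs_rev n (h n) \<omega>)) \<partial>P)"
        proof (intro mult_left_mono nn_integral_mono)
          fix \<omega>
          show "?if \<omega> (\<Phi> (w r (first_envs (h r) \<omega>), t r (last_envs_rev n (h r) \<omega>), - walk 0 \<omega> n))
            \<le> ?if \<omega> (\<Phi> (w n (first_envs (h n) \<omega>), t n (last_envs_rev n (h n) \<omega>), - walk 0 \<omega> n))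
            + ?if \<omega> (?aw (first_envs (h n) \<omega>)) + ?if \<omega> (?at (last_envs_rev n (h n) \<omega>))"
          proof (cases "\<forall>i<n. walk 0 \<omega> n < walk 0 \<omega> i")
            case True
            let ?x = "\<Phi> (w n (first_envs (h n) \<omega>), t n (last_envs_rev n (h n) \<omega>), - walk 0 \<omega> n)"
              and ?y = "?aw (first_envs (h n) \<omega>)" and ?z = "?at (last_envs_rev n (h n) \<omega>)" and ?E = "exp (\<theta> * walk 0 \<omega> n)"
            have nn: "0 \<le> ?x" "0 \<le> ?y" "0 \<le> ?z" using \<Phi>(1)[of "(w n (first_envs (h n) \<omega>), t n (last_envs_rev n (h n) \<omega>), - walk 0 \<omega> n)"] D by auto
            have "\<Phi> (w r (first_envs (h r) \<omega>), t r (last_envs_rev n (h r) \<omega>), - walk 0 \<omega> n) \<le> ?x + ?y + ?z"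
              unfolding first_envs_first_envs[OF hrn] first_envs_last_envs_rev[OF hrn] by (rule \<Phi>_diff)
            then have "?E * \<Phi> (w r (first_envs (h r) \<omega>), t r (last_envs_rev n (h r) \<omega>), - walk 0 \<omega> n) \<le> ?E * (?x + ?y + ?z)"
              by (intro mult_left_mono) auto
            also have "\<dots> = ?E * ?x + ?E * ?y + ?E * ?z" by (simp add: algebra_simps)
            finally have "ennreal (?E * \<Phi> (w r (first_envs (h r) \<omega>), t r (last_envs_rev n (h r) \<omega>), - walk 0 \<omega> n)) \<le> ennreal (?E * ?x + ?E * ?y + ?E * ?z)"
              by (rule ennreal_leI)
            also have "\<dots> = ennreal (?E * ?x) + ennreal (?E * ?y) + ennreal (?E * ?z)"
              using nn by (simp add: ennreal_plus)
            finally show ?thesis unfolding if_P[OF True] .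
          qed (simp only: if_False zero_le)
        qed simp
        also have "\<dots> = ennreal (real n * c n) * (\<integral>\<^sup>+\<omega>. ?if \<omega> (\<Phi> (w n (first_envs (h n) \<omega>), t n (last_envs_rev n (h n) \<omega>), - walk 0 \<omega> n)) \<partial>P)
           + ennreal (real n * c n) * (\<integral>\<^sup>+\<omega>. ?if \<omega> (?aw (first_envs (h n) \<omega>)) \<partial>P) + ennreal (real n * c n) * (\<integral>\<^sup>+\<omega>. ?if \<omega> (?at (last_envs_rev n (h n) \<omega>)) \<partial>P)"
          by (subst nn_integral_add, measurable, subst nn_integral_add, measurable, simp only: distrib_left)
        also have "\<dots> \<le> pre_limit \<Phi> n + ennreal C * (\<Sum>j. ?a j * dp r n j) + ennreal C * strip_sum \<theta> * dm r n"
          unfolding pre_limit_def by (intro add_mono E1 E2 order_refl)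
        finally show ?case by (simp only: e_def add.assoc)
      qed
    qed
    also have "\<dots> \<le> liminf (pre_limit \<Phi>) + e' r" by (rule liminf_add_convergent_le[OF e_lim e'_fin])
    finally show ?thesis .
  qed
  show ?liminf
  proof (rule LIMSEQ_le)
    show "(\<lambda>r. ennreal K * (\<integral>\<^sup>+z. U_weight z * horizon_int (r + r0) \<Phi> z \<partial>lborel)) \<longlonglongrightarrow> ennreal K * (\<integral>\<^sup>+z. U_weight z * limit_int \<Phi> z \<partial>lborel)"
      by (intro ennreal_tendsto_cmult conv(2)) simp
    have "(\<lambda>r. liminf (pre_limit \<Phi>) + e' (r + r0)) \<longlonglongrightarrow> liminf (pre_limit \<Phi>) + 0"
      by (intro tendsto_add tendsto_const LIMSEQ_ignore_initial_segment e'_lim)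
    then show "(\<lambda>r. liminf (pre_limit \<Phi>) + e' (r + r0)) \<longlonglongrightarrow> liminf (pre_limit \<Phi>)" by simp
    show "\<exists>N. \<forall>r\<ge>N. ennreal K * (\<integral>\<^sup>+z. U_weight z * horizon_int (r + r0) \<Phi> z \<partial>lborel) \<le> liminf (pre_limit \<Phi>) + e' (r + r0)"
      using step by auto
  qed
qed

end

lemma ennreal_le_liminf_eventually:
  fixes b :: "nat \<Rightarrow> real"
  assumes le: "ennreal a \<le> liminf (\<lambda>n. ennreal (b n))" and b: "\<And>n. n \<ge> 1 \<Longrightarrow> 0 \<le> b n" and e: "e > 0"
  shows "eventually (\<lambda>n. a - e < b n) sequentially"
proof (cases "a - e < 0")
  case True
  show ?thesis using eventually_ge_at_top[of 1]
  proof eventually_elim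
    case (elim n)
    then show ?case using True b[of n] by linarith
  qed
next
  case False
  then have "ennreal (a - e) < ennreal a" using e by (simp add: ennreal_less_iff)
  then have "eventually (\<lambda>n. ennreal (a - e) < ennreal (b n)) sequentially"
    using le by (auto simp: le_Liminf_iff)
  then show ?thesis using False by (auto elim!: eventually_mono simp: ennreal_less_iff)
qed

context convergent_functionals
begin

lemma limit_int_tendsto:
  assumes \<Psi>: "\<And>k. continuous_on UNIV (\<Psi> k)" "\<And>k p. \<Psi> k p \<le> B" and \<Phi>: "continuous_on UNIV \<Phi>"
    and lim: "\<And>p. (\<lambda>k. \<Psi> k p) \<longlonglongrightarrow> \<Phi> p" and z: "z \<ge> 0"
  shows "(\<lambda>k. limit_int (\<Psi> k) z) \<longlonglongrightarrow> limit_int \<Phi> z"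
proof -
  note [measurable] = continuous_meas[OF \<Psi>(1)] continuous_meas[OF \<Phi>]
  note [measurable_cong] = sets_plus[OF z]
  interpret plus: prob_space "P_plus z" by (rule prob_space_plus[OF z])
  have le: "ennreal (\<Psi> k p) \<le> ennreal B" for k p by (intro ennreal_leI \<Psi>)
  show ?thesis
    unfolding limit_int_def
  proof (rule nn_integral_bounded_convergence[OF prob_space_minus, where B=B])
    show "AE \<omega>' in P_minus. (\<lambda>k. \<integral>\<^sup>+\<omega>. ennreal (\<Psi> k (W_inf \<omega>, T_inf \<omega>', z)) \<partial>P_plus z)
       \<longlonglongrightarrow> (\<integral>\<^sup>+\<omega>. ennreal (\<Phi> (W_inf \<omega>, T_inf \<omega>', z)) \<partial>P_plus z)"
    proof (rule AE_I2, rule nn_integral_bounded_convergence[OF prob_space_plus[OF z], where B=B])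
      fix \<omega>'
      show "AE \<omega> in P_plus z. (\<lambda>k. ennreal (\<Psi> k (W_inf \<omega>, T_inf \<omega>', z))) \<longlonglongrightarrow> ennreal (\<Phi> (W_inf \<omega>, T_inf \<omega>', z))"
        by (intro AE_I2 tendsto_ennrealI lim)
    qed (use le in measurable)
    show "(\<integral>\<^sup>+\<omega>. ennreal (\<Psi> k (W_inf \<omega>, T_inf \<omega>', z)) \<partial>P_plus z) \<le> ennreal B" for k \<omega>'
      by (rule nn_integral_prob_le[OF prob_space_plus[OF z] le])
  qed measurable
qed

lemma continuous_liminf:
  assumes \<Phi>: "\<And>p. 1 \<le> \<Phi> p" "\<And>p. \<Phi> p \<le> B" and cont: "continuous_on UNIV \<Phi>"
  shows "(\<lambda>z. U_weight z * limit_int \<Phi> z) \<in> borel_measurable lborel" (is ?meas)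
    and "ennreal K * (\<integral>\<^sup>+z. U_weight z * limit_int \<Phi> z \<partial>lborel) \<le> liminf (pre_limit \<Phi>)" (is ?liminf)
proof -
  let ?\<Psi> = "\<lambda>k. lip_approx k \<Phi>"
  have ge: "1 \<le> ?\<Psi> k p" for k p by (rule lip_approx_ge[OF \<Phi>(1)])
  have le: "?\<Psi> k p \<le> \<Phi> p" for k p by (rule lip_approx_le_self[OF \<Phi>(1)])
  have leB: "?\<Psi> k p \<le> B" for k p using le[of k p] \<Phi>(2)[of p] by linarith
  have cont_k: "continuous_on UNIV (?\<Psi> k)" for k by (rule lip_approx_continuous[OF \<Phi>(1)])
  note lip = lip_approx_lipschitz[OF \<Phi>(1)]
  have lim: "(\<lambda>k. ?\<Psi> k p) \<longlonglongrightarrow> \<Phi> p" for p by (rule lip_approx_tendsto[OF \<Phi>(1) cont])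
  have m: "(\<lambda>z. U_weight z * limit_int (?\<Psi> k) z) \<in> borel_measurable lborel" for k
    by (rule lipschitz_liminf(1)[OF ge leB _ lip cont_k]) simp
  note conv = weighted_convergence[where f="\<lambda>k. limit_int (?\<Psi> k)", OF m limit_int_tendsto[OF cont_k leB cont lim] limit_int_le[OF leB]]
  show ?meas by (rule conv(1))
  have "ennreal K * (\<integral>\<^sup>+z. U_weight z * limit_int (?\<Psi> k) z \<partial>lborel) \<le> liminf (pre_limit \<Phi>)" for k
  proof -
    have "ennreal K * (\<integral>\<^sup>+z. U_weight z * limit_int (?\<Psi> k) z \<partial>lborel) \<le> liminf (pre_limit (?\<Psi> k))"
      by (rule lipschitz_liminf(2)[OF ge leB _ lip cont_k]) simp
    also have "\<dots> \<le> liminf (pre_limit \<Phi>)"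
      unfolding pre_limit_def
      by (intro Liminf_mono always_eventually allI mult_left_mono nn_integral_mono)
         (auto intro!: ennreal_leI mult_left_mono le)
    finally show ?thesis .
  qed
  moreover have "(\<lambda>k. ennreal K * (\<integral>\<^sup>+z. U_weight z * limit_int (?\<Psi> k) z \<partial>lborel)) \<longlonglongrightarrow> ennreal K * (\<integral>\<^sup>+z. U_weight z * limit_int \<Phi> z \<partial>lborel)"
    by (intro ennreal_tendsto_cmult conv(2)) simp
  ultimately show ?liminf by (intro LIMSEQ_le_const2) auto
qed

lemma nn_integral_shift_eq:
  fixes f :: "'z \<Rightarrow> real"
  assumes "prob_space M" and f: "f \<in> borel_measurable M" "\<And>x. \<bar>f x\<bar> \<le> D" and s: "\<bar>s\<bar> \<le> 1" and "D \<le> C"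
  shows "(\<integral>\<^sup>+x. ennreal (C + s * f x) \<partial>M) = ennreal (C + s * (\<integral>x. f x \<partial>M))"
    and "\<bar>\<integral>x. f x \<partial>M\<bar> \<le> D"
proof -
  interpret prob_space M by fact
  have int: "integrable M f" using f by (intro integrable_const_bound[where B=D]) auto
  have nn: "0 \<le> C + s * f x" for x
  proof -
    have "\<bar>s * f x\<bar> \<le> 1 * D" unfolding abs_mult using s f(2)[of x] by (intro mult_mono) auto
    then show ?thesis using assms(5) by linarith
  qed
  have "(\<integral>\<^sup>+x. ennreal (C + s * f x) \<partial>M) = ennreal (\<integral>x. C + s * f x \<partial>M)"
    using int nn by (intro nn_integral_eq_integral) auto
  also have "(\<integral>x. C + s * f x \<partial>M) = C + s * (\<integral>x. f x \<partial>M)"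
    using int by (simp add: prob_space)
  finally show "(\<integral>\<^sup>+x. ennreal (C + s * f x) \<partial>M) = ennreal (C + s * (\<integral>x. f x \<partial>M))" .
  have "\<bar>\<integral>x. f x \<partial>M\<bar> \<le> (\<integral>x. \<bar>f x\<bar> \<partial>M)" by (rule integral_abs_bound)
  also have "\<dots> \<le> (\<integral>x. D \<partial>M)" using int f(2) by (intro integral_mono) auto
  finally show "\<bar>\<integral>x. f x \<partial>M\<bar> \<le> D" by (simp add: prob_space)
qed

theorem functional_limit:
  fixes \<phi> :: "'w \<times> 't \<times> real \<Rightarrow> real"
  assumes \<phi>_cont: "continuous_on (UNIV \<times> UNIV \<times> {..0}) \<phi>"
    and \<phi>_bound: "\<And>u v z. z \<le> 0 \<Longrightarrow> \<bar>\<phi> (u, v, z)\<bar> * exp (- \<theta> * z) \<le> D"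
  defines "J z \<equiv> \<integral>\<omega>'. (\<integral>\<omega>. \<phi> (W_inf \<omega>, T_inf \<omega>', - z) \<partial>P_plus z) \<partial>P_minus"
  shows "(\<lambda>n. real n * c n * (\<integral>\<omega>. \<phi> (w n (first_envs (h n) \<omega>), t n (last_envs_rev n (h n) \<omega>), walk 0 \<omega> n)
            * (if \<forall>i<n. walk 0 \<omega> n < walk 0 \<omega> i then 1 else 0) \<partial>P))
    \<longlonglongrightarrow> K * (\<integral>z. (if z \<ge> 0 then J z * U z else 0) \<partial>lborel)"
proof -
  define \<phi>' where "\<phi>' p = \<phi> (fst p, fst (snd p), min (snd (snd p)) 0)" for p
  have \<phi>'_cont: "continuous_on UNIV \<phi>'"
    unfolding \<phi>'_def by (rule continuous_on_compose2[OF \<phi>_cont]) (auto intro!: continuous_intros)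
  have \<phi>'_eq: "\<phi>' (u, v, z) = \<phi> (u, v, z)" if "z \<le> 0" for u v z using that by (simp add: \<phi>'_def)
  have \<phi>'_bound: "\<bar>\<phi>' (u, v, - z)\<bar> \<le> D * exp (- \<theta> * z)" if "z \<ge> 0" for u v z
  proof -
    have "\<bar>\<phi> (u, v, - z)\<bar> * exp (\<theta> * z) \<le> D" using \<phi>_bound[of "- z" u v] that by simp
    then have "\<bar>\<phi> (u, v, - z)\<bar> \<le> D / exp (\<theta> * z)" by (simp add: pos_le_divide_eq)
    then show ?thesis using that by (simp add: \<phi>'_eq exp_minus divide_inverse)
  qed
  have D: "D \<ge> 0" using order_trans[OF _ \<phi>_bound[of 0]] by simp
  have [measurable]: "\<phi>' \<in> borel_measurable borel" by (rule continuous_meas[OF \<phi>'_cont])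
  define C where "C = D + 1"
  define \<Phi> where "\<Phi> s p = C + s * (exp (\<theta> * max (snd (snd p)) 0) * \<phi>' (fst p, fst (snd p), - max (snd (snd p)) 0))" for s and p :: "'w \<times> 't \<times> real"
  have \<Phi>_cont: "continuous_on UNIV (\<Phi> s)" for s
    unfolding \<Phi>_def by (intro continuous_intros continuous_on_compose2[OF \<phi>'_cont]) auto
  have \<psi>_bound: "\<bar>exp (\<theta> * z) * \<phi>' (u, v, - z)\<bar> \<le> D" if "z \<ge> 0" for u v z
  proof -
    have "exp (\<theta> * z) * \<bar>\<phi>' (u, v, - z)\<bar> \<le> exp (\<theta> * z) * (D * exp (- \<theta> * z))"
      using \<phi>'_bound[OF that] by (intro mult_left_mono) auto
    also have "\<dots> = D" by (simp add: exp_minus)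
    finally show ?thesis by (simp add: abs_mult)
  qed
  have \<Phi>_bounds: "1 \<le> \<Phi> s p" "\<Phi> s p \<le> 2 * D + 1" if s: "\<bar>s\<bar> \<le> 1" for s p
  proof -
    let ?x = "exp (\<theta> * max (snd (snd p)) 0) * \<phi>' (fst p, fst (snd p), - max (snd (snd p)) 0)"
    have "\<bar>s * ?x\<bar> \<le> 1 * D" unfolding abs_mult[of s] using s by (intro mult_mono \<psi>_bound) auto
    then show "1 \<le> \<Phi> s p" "\<Phi> s p \<le> 2 * D + 1" unfolding \<Phi>_def C_def by linarith+
  qed
  define IU where "IU = (LINT z:{0..}|lborel. exp (- \<theta> * z) * U z)"
  define TI where "TI = (\<integral>z. (if z \<ge> 0 then J z * U z else 0) \<partial>lborel)"
  let ?A = "\<lambda>n \<omega>. \<forall>i<n. walk 0 \<omega> n < walk 0 \<omega> i"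
  define f where "f n = (\<integral>\<omega>. exp (\<theta> * walk 0 \<omega> n) * (if ?A n \<omega> then 1 else 0) \<partial>P)" for n
  define x where "x n = (\<integral>\<omega>. \<phi> (w n (first_envs (h n) \<omega>), t n (last_envs_rev n (h n) \<omega>), walk 0 \<omega> n) * (if ?A n \<omega> then 1 else 0) \<partial>P)" for n
  have A_neg: "walk 0 \<omega> n \<le> 0" if "?A n \<omega>" for n \<omega>
    using that[rule_format, of 0] by (cases "n = 0") auto
  have pre: "pre_limit (\<Phi> s) n = ennreal (real n * c n * (C * f n + s * x n))" "0 \<le> real n * c n * (C * f n + s * x n)" if s: "\<bar>s\<bar> \<le> 1" and n: "n \<ge> 1" for s n
  proof -
    let ?f = "\<lambda>\<omega>. exp (\<theta> * walk 0 \<omega> n) * (if ?A n \<omega> then 1 else 0)"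
    let ?x = "\<lambda>\<omega>. \<phi>' (w n (first_envs (h n) \<omega>), t n (last_envs_rev n (h n) \<omega>), walk 0 \<omega> n) * (if ?A n \<omega> then 1 else 0)"
    have x_eq: "x n = (\<integral>\<omega>. ?x \<omega> \<partial>P)"
      unfolding x_def using A_neg \<phi>'_eq by (intro Bochner_Integration.integral_cong) auto
    have E1: "exp (\<theta> * walk 0 \<omega> n) \<le> 1" if "?A n \<omega>" for \<omega>
      using A_neg[OF that] \<theta> by (simp add: mult_nonneg_nonpos)
    have int_f: "integrable P ?f"
      by (rule P.integrable_const_bound[where B=1]) (use E1 in auto)
    have x_le: "\<bar>\<phi>' (u, v, walk 0 \<omega> n)\<bar> \<le> D * exp (\<theta> * walk 0 \<omega> n)" if "?A n \<omega>" for \<omega> u v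
      using \<phi>'_bound[of "- walk 0 \<omega> n" u v] A_neg[OF that] by simp
    have int_x: "integrable P ?x"
    proof (rule P.integrable_const_bound[where B=D])
      show "AE \<omega> in P. norm (?x \<omega>) \<le> D"
      proof (rule AE_I2)
        fix \<omega>
        show "norm (?x \<omega>) \<le> D"
        proof (cases "?A n \<omega>")
          case True
          have "D * exp (\<theta> * walk 0 \<omega> n) \<le> D * 1" using D E1[OF True] by (intro mult_left_mono)
          then show ?thesis using x_le[OF True, of "w n (first_envs (h n) \<omega>)" "t n (last_envs_rev n (h n) \<omega>)"] D by simp
        qed (simp only: if_False mult_zero_right norm_zero D)
      qed
    qed measurable
    have pt: "(if ?A n \<omega> then ennreal (exp (\<theta> * walk 0 \<omega> n) * \<Phi> s (w n (first_envs (h n) \<omega>), t n (last_envs_rev n (h n) \<omega>), - walk 0 \<omega> n)) else 0)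
       = ennreal (C * ?f \<omega> + s * ?x \<omega>)" "0 \<le> C * ?f \<omega> + s * ?x \<omega>" for \<omega>
    proof -
      have on_A: "exp (\<theta> * walk 0 \<omega> n) * \<Phi> s (w n (first_envs (h n) \<omega>), t n (last_envs_rev n (h n) \<omega>), - walk 0 \<omega> n)
        = C * ?f \<omega> + s * ?x \<omega>" if A: "?A n \<omega>"
      proof -
        have "exp (\<theta> * walk 0 \<omega> n) * exp (\<theta> * (- walk 0 \<omega> n)) = 1" by (simp add: exp_add[symmetric])
        then show ?thesis unfolding if_P[OF A] using A_neg[OF A] by (simp add: \<Phi>_def algebra_simps)
      qed
      then show "(if ?A n \<omega> then ennreal (exp (\<theta> * walk 0 \<omega> n) * \<Phi> s (w n (first_envs (h n) \<omega>), t n (last_envs_rev n (h n) \<omega>), - walk 0 \<omega> n)) else 0)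
        = ennreal (C * ?f \<omega> + s * ?x \<omega>)" 
        by (cases "?A n \<omega>") (simp_all only: if_True if_False simp_thms if_P mult_zero_right add_0_left ennreal_0)
      show "0 \<le> C * ?f \<omega> + s * ?x \<omega>"
      proof (cases "?A n \<omega>")
        case True
        have "0 \<le> exp (\<theta> * walk 0 \<omega> n) * \<Phi> s (w n (first_envs (h n) \<omega>), t n (last_envs_rev n (h n) \<omega>), - walk 0 \<omega> n)"
          using \<Phi>_bounds(1)[OF s] by (intro mult_nonneg_nonneg) (auto intro: order_trans[OF zero_le_one])
        then show ?thesis unfolding on_A[OF True] .
      qed (simp only: if_False mult_zero_right add_0_left order_refl)
    qed
    have nc: "0 \<le> real n * c n" using nc_pos[OF n] by simp
    have sum_eq: "(\<integral>\<omega>. C * ?f \<omega> + s * ?x \<omega> \<partial>P) = C * f n + s * x n"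
      using int_f int_x by (subst Bochner_Integration.integral_add) (auto simp only: x_eq f_def integral_mult_right_zero integrable_mult_right)
    have nn: "0 \<le> C * f n + s * x n"
      unfolding sum_eq[symmetric] by (rule Bochner_Integration.integral_nonneg[OF pt(2)])
    show "0 \<le> real n * c n * (C * f n + s * x n)" using nc nn by simp
    have "(\<integral>\<^sup>+\<omega>. ennreal (C * ?f \<omega> + s * ?x \<omega>) \<partial>P) = ennreal (C * f n + s * x n)"
      unfolding sum_eq[symmetric] using int_f int_x pt(2)
      by (intro nn_integral_eq_integral Bochner_Integration.integrable_add integrable_mult_right) (auto simp only: eventually_True intro!: AE_I2)
    then show "pre_limit (\<Phi> s) n = ennreal (real n * c n * (C * f n + s * x n))"
      unfolding pre_limit_def pt(1) using nc nn by (simp only: ennreal_mult)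
  qed
  define g where "g s z = (if z \<ge> 0 then C * (exp (- \<theta> * z) * U z) + s * (J z * U z) else 0)" for s z
  have J_bound: "\<bar>J z\<bar> \<le> D * exp (- \<theta> * z)" and limit_eq: "U_weight z * limit_int (\<Phi> s) z = ennreal (g s z)"
    if z: "z \<ge> 0" and s: "\<bar>s\<bar> \<le> 1" for z s
  proof -
    note [measurable_cong] = sets_plus[OF z]
    interpret plus: prob_space "P_plus z" by (rule prob_space_plus[OF z])
    let ?\<psi> = "\<lambda>\<omega> \<omega>'. exp (\<theta> * z) * \<phi>' (W_inf \<omega>, T_inf \<omega>', - z)"
    have DC: "D \<le> C" by (simp add: C_def)
    have in1: "(\<integral>\<^sup>+\<omega>. ennreal (C + s * ?\<psi> \<omega> \<omega>') \<partial>P_plus z) = ennreal (C + s * (\<integral>\<omega>. ?\<psi> \<omega> \<omega>' \<partial>P_plus z))"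
      and in2: "\<bar>\<integral>\<omega>. ?\<psi> \<omega> \<omega>' \<partial>P_plus z\<bar> \<le> D" for \<omega>'
      by (rule nn_integral_shift_eq[OF prob_space_plus[OF z] _ \<psi>_bound[OF z] s DC]; measurable)+
    have out1: "(\<integral>\<^sup>+\<omega>'. ennreal (C + s * (\<integral>\<omega>. ?\<psi> \<omega> \<omega>' \<partial>P_plus z)) \<partial>P_minus) = ennreal (C + s * (\<integral>\<omega>'. (\<integral>\<omega>. ?\<psi> \<omega> \<omega>' \<partial>P_plus z) \<partial>P_minus))"
      and out2: "\<bar>\<integral>\<omega>'. (\<integral>\<omega>. ?\<psi> \<omega> \<omega>' \<partial>P_plus z) \<partial>P_minus\<bar> \<le> D"
      by (rule nn_integral_shift_eq[OF prob_space_minus _ in2 s DC]; measurable)+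
    have J_eq: "(\<integral>\<omega>'. (\<integral>\<omega>. ?\<psi> \<omega> \<omega>' \<partial>P_plus z) \<partial>P_minus) = exp (\<theta> * z) * J z"
      unfolding J_def using z by (simp add: \<phi>'_eq)
    have "exp (\<theta> * z) * \<bar>J z\<bar> \<le> D" using out2 unfolding J_eq by (simp add: abs_mult)
    then have "\<bar>J z\<bar> \<le> D / exp (\<theta> * z)" by (simp add: pos_le_divide_eq mult.commute)
    then show "\<bar>J z\<bar> \<le> D * exp (- \<theta> * z)" by (simp add: exp_minus divide_inverse)
    have "limit_int (\<Phi> s) z = (\<integral>\<^sup>+\<omega>'. (\<integral>\<^sup>+\<omega>. ennreal (C + s * ?\<psi> \<omega> \<omega>') \<partial>P_plus z) \<partial>P_minus)"
      unfolding limit_int_def \<Phi>_def using z by simp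
    also have "\<dots> = ennreal (C + s * (exp (\<theta> * z) * J z))" unfolding in1 out1 J_eq ..
    finally have "U_weight z * limit_int (\<Phi> s) z = ennreal (exp (- \<theta> * z) * U z) * ennreal (C + s * (exp (\<theta> * z) * J z))"
      using z by (simp add: U_weight_def)
    also have "\<dots> = ennreal ((exp (- \<theta> * z) * U z) * (C + s * (exp (\<theta> * z) * J z)))"
      using U_nonneg by (intro ennreal_mult'[symmetric]) auto
    also have "(exp (- \<theta> * z) * U z) * (C + s * (exp (\<theta> * z) * J z)) = g s z"
    proof -
      have "exp (- \<theta> * z) * exp (\<theta> * z) = 1" by (simp add: exp_add[symmetric])
      then have "exp (- \<theta> * z) * U z * (s * (exp (\<theta> * z) * J z)) = s * (J z * U z)" by (simp add: mult_ac)
      then show ?thesis using z by (simp add: g_def distrib_left mult_ac)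
    qed
    finally show "U_weight z * limit_int (\<Phi> s) z = ennreal (g s z)" .
  qed
  have limit_eq': "U_weight z * limit_int (\<Phi> s) z = ennreal (g s z)" if "\<bar>s\<bar> \<le> 1" for s z
    using limit_eq[of z s] that U_weight_neg[of z] by (cases "z \<ge> 0") (auto simp: g_def)
  have g_nonneg: "0 \<le> g s z" if s: "\<bar>s\<bar> \<le> 1" for s z
  proof (cases "z \<ge> 0")
    case True
    have "\<bar>s * J z\<bar> \<le> 1 * (D * exp (- \<theta> * z))" unfolding abs_mult using s J_bound[OF True s] by (intro mult_mono) auto
    then have "\<bar>s * J z\<bar> \<le> C * exp (- \<theta> * z)" unfolding C_def by (simp add: distrib_right add_increasing2)
    then have "0 \<le> C * exp (- \<theta> * z) + s * J z" by linarith
    then have "0 \<le> (C * exp (- \<theta> * z) + s * J z) * U z" using U_nonneg by simp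
    then show ?thesis using True by (simp add: g_def algebra_simps)
  qed (simp add: g_def)
  have g_meas: "g s \<in> borel_measurable lborel" if s: "\<bar>s\<bar> \<le> 1" for s
  proof -
    have "(\<lambda>z. ennreal (g s z)) \<in> borel_measurable lborel"
      using continuous_liminf(1)[OF \<Phi>_bounds[OF s] \<Phi>_cont] unfolding limit_eq'[OF s] .
    then have "(\<lambda>z. enn2real (ennreal (g s z))) \<in> borel_measurable lborel" by measurable
    then show ?thesis using g_nonneg[OF s] by simp
  qed
  let ?u = "\<lambda>z. if z \<ge> 0 then exp (- \<theta> * z) * U z else 0" and ?j = "\<lambda>z. if z \<ge> 0 then J z * U z else 0"
  have u_eq: "(\<lambda>z. indicator {0..} z *\<^sub>R (exp (- \<theta> * z) * U z)) = ?u" by (auto simp: indicator_def fun_eq_iff)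
  have int_u: "integrable lborel ?u"
    using strict_min_limit(1)[OF \<theta>] unfolding set_integrable_def u_eq .
  have IU_eq: "(\<integral>z. ?u z \<partial>lborel) = IU" unfolding IU_def set_lebesgue_integral_def u_eq ..
  have int_j: "integrable lborel ?j"
  proof (rule Bochner_Integration.integrable_bound)
    show "integrable lborel (\<lambda>z. D * ?u z)" using int_u by simp
    have "(\<lambda>z. (g 1 z - g (- 1) z) / 2) \<in> borel_measurable lborel" using g_meas[of 1] g_meas[of "- 1"] by simp
    moreover have "(\<lambda>z. (g 1 z - g (- 1) z) / 2) = ?j" by (auto simp: g_def fun_eq_iff)
    ultimately show "?j \<in> borel_measurable lborel" by simp
    show "AE z in lborel. norm (?j z) \<le> norm (D * ?u z)"
    proof (rule AE_I2)
      fix z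
      show "norm (?j z) \<le> norm (D * ?u z)"
      proof (cases "z \<ge> 0")
        case True
        have "\<bar>J z\<bar> * U z \<le> D * exp (- \<theta> * z) * U z" using J_bound[OF True, of 0] U_nonneg by (intro mult_right_mono) auto
        then show ?thesis using True D U_nonneg by (simp add: abs_mult mult.assoc)
      qed simp
    qed
  qed
  have g_int: "(\<integral>\<^sup>+z. ennreal (g s z) \<partial>lborel) = ennreal (C * IU + s * TI)" if s: "\<bar>s\<bar> \<le> 1" for s
  proof -
    have g_eq: "g s = (\<lambda>z. C * ?u z + s * ?j z)" by (auto simp: g_def fun_eq_iff)
    have int: "integrable lborel (g s)" unfolding g_eq using int_u int_j
      by (intro Bochner_Integration.integrable_add integrable_mult_right)
    have "(\<integral>\<^sup>+z. ennreal (g s z) \<partial>lborel) = ennreal (\<integral>z. g s z \<partial>lborel)"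
      using int g_nonneg[OF s] by (intro nn_integral_eq_integral) auto
    also have "(\<integral>z. g s z \<partial>lborel) = C * IU + s * TI"
      unfolding g_eq using int_u int_j by (subst Bochner_Integration.integral_add) (auto simp only: IU_eq TI_def integral_mult_right_zero integrable_mult_right)
    finally show ?thesis .
  qed
  have key: "eventually (\<lambda>n. K * (C * IU + s * TI) - e < real n * c n * (C * f n + s * x n)) sequentially" if s: "\<bar>s\<bar> \<le> 1" and e: "e > 0" for s e
  proof (rule ennreal_le_liminf_eventually[OF _ pre(2)[OF s] e])
    have "ennreal (K * (C * IU + s * TI)) = ennreal K * (\<integral>\<^sup>+z. U_weight z * limit_int (\<Phi> s) z \<partial>lborel)"
      unfolding limit_eq'[OF s] g_int[OF s] using K_pos by (intro ennreal_mult') simp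
    also have "\<dots> \<le> liminf (pre_limit (\<Phi> s))" by (rule continuous_liminf(2)[OF \<Phi>_bounds[OF s] \<Phi>_cont])
    also have "\<dots> = liminf (\<lambda>n. ennreal (real n * c n * (C * f n + s * x n)))"
      by (rule Liminf_eq, rule eventually_mono[OF eventually_ge_at_top[of 1]]) (rule pre(1)[OF s])
    finally show "ennreal (K * (C * IU + s * TI)) \<le> liminf (\<lambda>n. ennreal (real n * c n * (C * f n + s * x n)))" .
  qed
  have f_lim: "(\<lambda>n. real n * c n * f n) \<longlonglongrightarrow> K * IU"
    unfolding f_def IU_def by (rule strict_min_limit(2)[OF \<theta>])
  have "(\<lambda>n. real n * c n * x n) \<longlonglongrightarrow> K * TI"
  proof (rule LIMSEQ_I)
    fix e :: real assume e: "e > 0"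
    have "(\<lambda>n. C * (real n * c n * f n)) \<longlonglongrightarrow> C * (K * IU)" by (intro tendsto_intros f_lim)
    then have ev: "eventually (\<lambda>n. \<bar>C * (real n * c n * f n) - C * (K * IU)\<bar> < e / 2) sequentially"
      using e by (auto dest!: tendstoD[where e="e / 2"] simp: dist_real_def)
    have s1: "\<bar>1 :: real\<bar> \<le> 1" and s2: "\<bar>- 1 :: real\<bar> \<le> 1" and e2: "e / 2 > 0" using e by auto
    have "eventually (\<lambda>n. norm (real n * c n * x n - K * TI) < e) sequentially"
      using ev key[OF s1 e2] key[OF s2 e2]
    proof eventually_elim
      case (elim n)
      have sandwich: "\<bar>A - a\<bar> < e / 2 \<Longrightarrow> (a + T) - e / 2 < A + X \<Longrightarrow> (a - T) - e / 2 < A - X \<Longrightarrow> \<bar>X - T\<bar> < e"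
        for A a X T :: real by linarith
      show ?case unfolding real_norm_def
        by (rule sandwich[OF elim(1)]) (use elim(2,3) in \<open>simp_all add: algebra_simps\<close>)
    qed
    then show "\<exists>n0. \<forall>n\<ge>n0. norm (real n * c n * x n - K * TI) < e" by (simp add: eventually_sequentially)
  qed
  then show ?thesis unfolding x_def TI_def .
qed

end

section \<open>The tilted law\<close>

lemma nn_integral_PiM_prod_first:
  fixes Q :: "'a measure" and f :: "nat \<Rightarrow> 'a \<Rightarrow> ennreal"
  assumes Q: "prob_space Q" and f: "\<And>i. f i \<in> borel_measurable Q"
  shows "(\<integral>\<^sup>+\<omega>. (\<Prod>i<n. f i (\<omega> i)) \<partial>(\<Pi>\<^sub>M i\<in>(UNIV :: nat set). Q)) = (\<Prod>i<n. \<integral>\<^sup>+p. f i p \<partial>Q)"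
proof -
  interpret Q: prob_space Q by fact
  interpret fin: product_sigma_finite "\<lambda>_ :: nat. Q" ..
  interpret QQ: product_prob_space "\<lambda>_ :: nat. Q" UNIV ..
  note [measurable] = f
  have "(\<integral>\<^sup>+\<omega>. (\<Prod>i<n. f i (\<omega> i)) \<partial>(\<Pi>\<^sub>M i\<in>(UNIV :: nat set). Q))
    = (\<integral>\<^sup>+\<omega>. (\<Prod>i<n. f i (restrict \<omega> {..<n} i)) \<partial>(\<Pi>\<^sub>M i\<in>(UNIV :: nat set). Q))"
    by (intro nn_integral_cong prod.cong) auto
  also have "\<dots> = (\<integral>\<^sup>+\<omega>. (\<Prod>i<n. f i (\<omega> i)) \<partial>distr (\<Pi>\<^sub>M i\<in>(UNIV :: nat set). Q) (\<Pi>\<^sub>M i\<in>{..<n}. Q) (\<lambda>\<omega>. restrict \<omega> {..<n}))"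
    by (rule nn_integral_distr[symmetric]) measurable
  also have "distr (\<Pi>\<^sub>M i\<in>(UNIV :: nat set). Q) (\<Pi>\<^sub>M i\<in>{..<n}. Q) (\<lambda>\<omega>. restrict \<omega> {..<n}) = (\<Pi>\<^sub>M i\<in>{..<n}. Q)"
    by (rule QQ.distr_PiM_restrict_finite) auto
  also have "(\<integral>\<^sup>+\<omega>. (\<Prod>i<n. f i (\<omega> i)) \<partial>(\<Pi>\<^sub>M i\<in>{..<n}. Q)) = (\<Prod>i<n. \<integral>\<^sup>+p. f i p \<partial>Q)"
    by (rule fin.product_nn_integral_prod) auto
  finally show ?thesis .
qed

lemma tilted_law_product:
  assumes Q: "prob_space Q" "sets Q = sets env" "log_mean \<in> borel_measurable Q" and P: "tilted_law Q \<kappa> P"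
  obtains N where "prob_space N" "sets N = sets env" "log_mean \<in> borel_measurable N" "P = (\<Pi>\<^sub>M i\<in>(UNIV :: nat set). N)"
proof -
  interpret Q: prob_space Q by fact
  interpret QQ: product_prob_space "\<lambda>_ :: nat. Q" UNIV ..
  note [measurable] = Q(3)
  have sets_QQ: "sets (\<Pi>\<^sub>M i\<in>(UNIV :: nat set). Q) = sets env_seq"
    unfolding env_seq_def by (intro sets_PiM_cong) (auto simp: Q(2))
  interpret P: prob_space P using P by (simp add: tilted_law_def)
  have sets_P: "sets P = sets env_seq" using P by (simp add: tilted_law_def)
  have space_Q: "space Q = UNIV"
    using sets_eq_imp_space_eq[OF Q(2)] by (simp add: env_def space_measure_of_conv)
  define \<gamma> where "\<gamma> = (\<integral>p. exp (\<kappa> * log_mean p) \<partial>Q)"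
  have tilt: "(\<integral>\<omega>. \<psi> (first_envs n \<omega>) \<partial>P) =
      (\<integral>\<omega>. \<psi> (first_envs n \<omega>) * exp (\<kappa> * (\<Sum>i<n. log_mean (\<omega> i))) \<partial>(\<Pi>\<^sub>M i\<in>UNIV. Q)) / \<gamma> ^ n"
    if "\<psi> \<in> borel_measurable (env_vec n)" "bounded (\<psi> ` space (env_vec n))" for \<psi> :: "(nat \<Rightarrow> nat pmf) \<Rightarrow> real" and n
    using P that unfolding tilted_law_def \<gamma>_def by blast
  have "\<gamma> \<noteq> 0"
  proof
    assume "\<gamma> = 0"
    moreover have "bounded ((\<lambda>_. 1 :: real) ` space (env_vec 1))" by (rule finite_imp_bounded) (rule finite_subset[of _ "{1}"], auto)
    ultimately have "(\<integral>\<omega>. 1 \<partial>P) = (0 :: real)" using tilt[of "\<lambda>_. 1" 1] by simp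
    then show False using P.prob_space by simp
  qed
  then have int: "integrable Q (\<lambda>p. exp (\<kappa> * log_mean p))" unfolding \<gamma>_def using not_integrable_integral_eq by blast
  have "\<gamma> \<ge> 0" unfolding \<gamma>_def by simp
  with \<open>\<gamma> \<noteq> 0\<close> have \<gamma>: "\<gamma> > 0" by simp
  define d where "d p = ennreal (exp (\<kappa> * log_mean p) / \<gamma>)" for p
  have d_meas [measurable]: "d \<in> borel_measurable Q" unfolding d_def by measurable
  define N where "N = density Q d"
  have sets_N: "sets N = sets Q" by (simp add: N_def)
  have "(\<integral>\<^sup>+p. d p \<partial>Q) = ennreal (\<integral>p. exp (\<kappa> * log_mean p) / \<gamma> \<partial>Q)"
    unfolding d_def using int \<gamma> by (intro nn_integral_eq_integral) auto
  also have "(\<integral>p. exp (\<kappa> * log_mean p) / \<gamma> \<partial>Q) = 1" using \<gamma> by (simp add: \<gamma>_def)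
  finally have d1: "(\<integral>\<^sup>+p. d p \<partial>Q) = 1" by simp
  have N: "prob_space N"
    by (rule prob_spaceI) (simp add: N_def emeasure_density d1 cong: nn_integral_cong)
  interpret N: prob_space N by (rule N)
  interpret NN: product_prob_space "\<lambda>_ :: nat. N" UNIV ..
  have "P = (\<Pi>\<^sub>M i\<in>(UNIV :: nat set). N)"
  proof (rule NN.PiM_eq)
    show "sets P = sets (\<Pi>\<^sub>M i\<in>(UNIV :: nat set). N)"
      unfolding sets_P sets_QQ[symmetric] by (intro sets_PiM_cong) (auto simp: sets_N)
    fix J :: "nat set" and F assume J: "finite J" "\<And>j. j \<in> J \<Longrightarrow> F j \<in> sets N"
    obtain n where n: "J \<subseteq> {..<n}" using finite_nat_iff_bounded[THEN iffD1, OF J(1)] by blast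
    define E where "E i = (if i \<in> J then F i else UNIV)" for i
    have E [measurable]: "E i \<in> sets Q" for i
      using J(2) sets.top[of Q] by (auto simp: E_def sets_N space_Q)
    define \<psi> where "\<psi> v = (\<Prod>i<n. indicator (E i) (v i) :: real)" for v :: "nat \<Rightarrow> nat pmf"
    have E_env: "E i \<in> sets env" for i using E Q(2) by simp
    have \<psi>_meas: "\<psi> \<in> borel_measurable (env_vec n)"
      unfolding \<psi>_def[abs_def] env_vec_def
    proof (rule borel_measurable_prod)
      fix i assume "i \<in> {..<n}"
      then have "(\<lambda>v. v i) \<in> measurable (\<Pi>\<^sub>M i\<in>{..<n}. env) env" by (rule measurable_component_singleton)
      from measurable_compose[OF this borel_measurable_indicator[OF E_env]]
      show "(\<lambda>v. indicator (E i) (v i) :: real) \<in> borel_measurable (\<Pi>\<^sub>M i\<in>{..<n}. env)" .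
    qed
    have \<psi>01: "0 \<le> \<psi> v \<and> \<psi> v \<le> 1" for v
      unfolding \<psi>_def by (auto intro!: prod_nonneg prod_le_1)
    have \<psi>_first: "\<psi> (first_envs n \<omega>) = \<psi> \<omega>" for \<omega>
      unfolding \<psi>_def first_envs_def by (intro prod.cong) auto
    have \<psi>_ind: "\<psi> \<omega> = indicator (prod_emb UNIV (\<lambda>_. N) J (Pi\<^sub>E J F)) \<omega>" for \<omega>
    proof -
      have "\<psi> \<omega> = (if \<forall>i<n. \<omega> i \<in> E i then 1 else 0)"
        unfolding \<psi>_def by (auto simp: indicator_def intro!: prod.neutral)
      moreover have "(\<forall>i<n. \<omega> i \<in> E i) \<longleftrightarrow> \<omega> \<in> prod_emb UNIV (\<lambda>_. N) J (Pi\<^sub>E J F)"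
        using n by (auto simp: E_def prod_emb_def PiE_def Pi_def N_def space_Q)
      ultimately show ?thesis by (simp add: indicator_def)
    qed
    let ?B = "prod_emb UNIV (\<lambda>_. N) J (Pi\<^sub>E J F)"
    have B_sets: "?B \<in> sets P"
    proof -
      have "?B \<in> sets (\<Pi>\<^sub>M i\<in>(UNIV :: nat set). N)" using J by (intro sets_PiM_I) auto
      also have "sets (\<Pi>\<^sub>M i\<in>(UNIV :: nat set). N) = sets P"
        unfolding sets_P sets_QQ[symmetric] by (intro sets_PiM_cong) (auto simp: sets_N)
      finally show ?thesis .
    qed
    have "measure P ?B = (\<integral>\<omega>. \<psi> \<omega> \<partial>P)"
      unfolding \<psi>_ind using B_sets by simp
    also have "\<dots> = (\<integral>\<omega>. \<psi> (first_envs n \<omega>) \<partial>P)" unfolding \<psi>_first ..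
    also have "\<dots> = (\<integral>\<omega>. \<psi> (first_envs n \<omega>) * exp (\<kappa> * (\<Sum>i<n. log_mean (\<omega> i))) \<partial>(\<Pi>\<^sub>M i\<in>UNIV. Q)) / \<gamma> ^ n"
      using \<psi>01 by (intro tilt \<psi>_meas boundedI[where B=1]) auto
    also have "\<dots> = (\<integral>\<omega>. (\<Prod>i<n. indicator (E i) (\<omega> i) * (exp (\<kappa> * log_mean (\<omega> i)) / \<gamma>)) \<partial>(\<Pi>\<^sub>M i\<in>UNIV. Q))"
      unfolding \<psi>_first unfolding \<psi>_def
      by (simp add: prod.distrib prod_dividef sum_distrib_left exp_sum flip: Bochner_Integration.integral_divide_zero)
    finally have meas: "measure P ?B = (\<integral>\<omega>. (\<Prod>i<n. indicator (E i) (\<omega> i) * (exp (\<kappa> * log_mean (\<omega> i)) / \<gamma>)) \<partial>(\<Pi>\<^sub>M i\<in>UNIV. Q))" .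
    let ?g = "\<lambda>i p. indicator (E i) p * (exp (\<kappa> * log_mean p) / \<gamma>) :: real"
    have g_nn: "0 \<le> ?g i p" for i p using \<gamma> by simp
    have nn: "(\<integral>\<^sup>+\<omega>. ennreal (\<Prod>i<n. ?g i (\<omega> i)) \<partial>(\<Pi>\<^sub>M i\<in>UNIV. Q)) = (\<Prod>i<n. emeasure N (E i))"
    proof -
      have "(\<integral>\<^sup>+\<omega>. ennreal (\<Prod>i<n. ?g i (\<omega> i)) \<partial>(\<Pi>\<^sub>M i\<in>UNIV. Q)) = (\<integral>\<^sup>+\<omega>. (\<Prod>i<n. ennreal (?g i (\<omega> i))) \<partial>(\<Pi>\<^sub>M i\<in>(UNIV :: nat set). Q))"
        by (intro nn_integral_cong prod_ennreal[symmetric] g_nn)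
      also have "\<dots> = (\<Prod>i<n. \<integral>\<^sup>+p. ennreal (?g i p) \<partial>Q)"
        by (rule nn_integral_PiM_prod_first[OF Q(1)]) measurable
      also have "\<dots> = (\<Prod>i<n. emeasure N (E i))"
      proof (rule prod.cong[OF refl])
        fix i
        have "(\<integral>\<^sup>+p. ennreal (?g i p) \<partial>Q) = (\<integral>\<^sup>+p. d p * indicator (E i) p \<partial>Q)"
          by (intro nn_integral_cong) (auto simp: d_def indicator_def)
        also have "\<dots> = emeasure N (E i)" unfolding N_def by (rule emeasure_density[symmetric]) measurable
        finally show "(\<integral>\<^sup>+p. ennreal (?g i p) \<partial>Q) = emeasure N (E i)" .
      qed
      finally show ?thesis .
    qed
    have "emeasure P ?B = ennreal (measure P ?B)" by (rule P.emeasure_eq_measure)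
    also have "\<dots> = (\<integral>\<^sup>+\<omega>. ennreal (\<Prod>i<n. ?g i (\<omega> i)) \<partial>(\<Pi>\<^sub>M i\<in>UNIV. Q))"
      unfolding meas
    proof (rule nn_integral_eq_integral[symmetric])
      show "integrable (\<Pi>\<^sub>M i\<in>UNIV. Q) (\<lambda>\<omega>. \<Prod>i<n. ?g i (\<omega> i))"
      proof (rule integrableI_nonneg)
        show "(\<integral>\<^sup>+\<omega>. ennreal (\<Prod>i<n. ?g i (\<omega> i)) \<partial>(\<Pi>\<^sub>M i\<in>UNIV. Q)) < \<infinity>"
          unfolding nn by (simp add: N.emeasure_eq_measure prod_ennreal)
        show "(\<lambda>\<omega>. \<Prod>i<n. ?g i (\<omega> i)) \<in> borel_measurable (\<Pi>\<^sub>M i\<in>UNIV. Q)" by measurable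
      qed (intro AE_I2 prod_nonneg g_nn)
    qed (intro AE_I2 prod_nonneg g_nn)
    also have "\<dots> = (\<Prod>i<n. emeasure N (E i))" by (rule nn)
    also have "\<dots> = (\<Prod>i\<in>J. emeasure N (E i))"
    proof (rule prod.mono_neutral_right)
      show "\<forall>i\<in>{..<n} - J. emeasure N (E i) = 1"
        using N.emeasure_space_1 by (auto simp: E_def N_def space_Q)
    qed (use n in auto)
    also have "\<dots> = (\<Prod>i\<in>J. emeasure N (F i))" by (intro prod.cong) (auto simp: E_def)
    finally show "emeasure P ?B = (\<Prod>i\<in>J. emeasure N (F i))" .
  qed
  moreover have "log_mean \<in> borel_measurable N" unfolding N_def by measurable
  ultimately show ?thesis using that[of N] N sets_N Q(2) by simp
qed

lemma centered_nonconstant_signs: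
  fixes X :: "'a \<Rightarrow> real"
  assumes "prob_space N" and int: "integrable N X" "(\<integral>p. X p \<partial>N) = 0" and nz: "\<not> (AE p in N. X p = 0)"
  shows "measure N {p \<in> space N. X p > 0} > 0" and "measure N {p \<in> space N. X p < 0} > 0"
proof -
  interpret prob_space N by fact
  note [measurable] = borel_measurable_integrable[OF int(1)]
  have *: "measure N {p \<in> space N. Y p > 0} > 0" if Y: "integrable N Y" "(\<integral>p. Y p \<partial>N) = 0" "\<not> (AE p in N. Y p = 0)" for Y :: "'a \<Rightarrow> real"
  proof (rule ccontr)
    note [measurable] = borel_measurable_integrable[OF Y(1)]
    assume "\<not> ?thesis"
    then have "measure N {p \<in> space N. Y p > 0} = 0" by (simp add: zero_less_measure_iff)
    then have "AE p in N. \<not> Y p > 0"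
      by (subst AE_iff_measurable[OF _ refl]) (auto simp: emeasure_eq_measure)
    then have "AE p in N. 0 \<le> - Y p" by auto
    moreover have "(\<integral>p. - Y p \<partial>N) = 0" using Y by simp
    ultimately have "AE p in N. - Y p = 0"
      using integral_nonneg_eq_0_iff_AE[of N "\<lambda>p. - Y p"] Y(1) by auto
    with Y(3) show False by auto
  qed
  show "measure N {p \<in> space N. X p > 0} > 0" by (rule *[OF int nz])
  have "measure N {p \<in> space N. - X p > 0} > 0" by (rule *) (use int nz in auto)
  then show "measure N {p \<in> space N. X p < 0} > 0" by simp
qed

theorem lemma9:
  fixes Q :: "nat pmf measure"
    and P :: "(nat \<Rightarrow> nat pmf) measure"
    and P_plus :: "real \<Rightarrow> (nat \<Rightarrow> nat pmf) measure"
    and P_minus :: "(nat \<Rightarrow> nat pmf) measure"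
    and \<kappa> \<alpha> K \<delta> \<theta> :: real
    and c :: "nat \<Rightarrow> real"
    and w :: "nat \<Rightarrow> (nat \<Rightarrow> nat pmf) \<Rightarrow> 'w :: polish_space"
    and t :: "nat \<Rightarrow> (nat \<Rightarrow> nat pmf) \<Rightarrow> 't :: polish_space"
    and W_inf :: "(nat \<Rightarrow> nat pmf) \<Rightarrow> 'w"
    and T_inf :: "(nat \<Rightarrow> nat pmf) \<Rightarrow> 't"
    and \<phi> :: "'w \<times> 't \<times> real \<Rightarrow> real"
  assumes Q: "prob_space Q" "sets Q = sets env"
    and geometric: "AE p in Q. geometric_gf p"
    and subcritical: "integrable Q log_mean" "(\<integral>p. log_mean p \<partial>Q) < 0"
    and \<kappa>: "0 < \<kappa>" "\<kappa> \<le> 1"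
      "integrable Q (\<lambda>p. log_mean p * exp (\<kappa> * log_mean p))"
      "(\<integral>p. log_mean p * exp (\<kappa> * log_mean p) \<partial>Q) = 0"
    and P: "tilted_law Q \<kappa> P"
    and centered: "integrable P (\<lambda>\<omega>. log_mean (\<omega> 0))" "(\<integral>\<omega>. log_mean (\<omega> 0) \<partial>P) = 0"
    and nonlattice: "nonlattice (distr P borel (\<lambda>\<omega>. log_mean (\<omega> 0)))"
    and \<alpha>: "1 < \<alpha>" "\<alpha> \<le> 2"
    and attraction: "attracted_to_stable P \<alpha> c"
    and P_plus: "\<And>x. x \<ge> 0 \<Longrightarrow> plus_law P x (P_plus x)"
    and P_minus: "minus_law P 0 P_minus"
    and K: "asymptotic_constant P c K"
    and \<delta>: "0 < \<delta>" "\<delta> < 1"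
    and w: "\<And>n. w n \<in> borel_measurable (env_vec (nat \<lfloor>\<delta> * real n\<rfloor>))"
    and t: "\<And>n. t n \<in> borel_measurable (env_vec (nat \<lfloor>\<delta> * real n\<rfloor>))"
    and W_inf: "W_inf \<in> borel_measurable env_seq"
    and T_inf: "T_inf \<in> borel_measurable env_seq"
    and W_lim: "\<And>x. x \<ge> 0 \<Longrightarrow>
      AE \<omega> in P_plus x. (\<lambda>n. w n (first_envs (nat \<lfloor>\<delta> * real n\<rfloor>) \<omega>)) \<longlonglongrightarrow> W_inf \<omega>"
    and T_lim:
      "AE \<omega> in P_minus. (\<lambda>n. t n (first_envs (nat \<lfloor>\<delta> * real n\<rfloor>) \<omega>)) \<longlonglongrightarrow> T_inf \<omega>"
    and \<phi>_cont: "continuous_on (UNIV \<times> UNIV \<times> {..0}) \<phi>"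
    and \<theta>: "\<theta> > 0"
    and \<phi>_bound:
      "bdd_above ((\<lambda>(u, v, z). \<bar>\<phi> (u, v, z)\<bar> * exp (- \<theta> * z)) ` (UNIV \<times> UNIV \<times> {..0}))"
  shows "(\<lambda>n. real n * c n *
            (\<integral>\<omega>. \<phi> (w n (first_envs (nat \<lfloor>\<delta> * real n\<rfloor>) \<omega>),
                    t n (last_envs_rev n (nat \<lfloor>\<delta> * real n\<rfloor>) \<omega>),
                    walk 0 \<omega> n)
                  * indicator {\<omega>. first_min 0 \<omega> n = n} \<omega> \<partial>P))
         \<longlonglongrightarrow>
         K * (LINT z:{0..}|lborel.
                (\<integral>v. (\<integral>u. \<phi> (u, v, - z) \<partial>distr (P_plus z) borel W_inf)
                   \<partial>distr P_minus borel T_inf) * renewal_U P z)"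
proof -
  have log_mean_Q: "log_mean \<in> borel_measurable Q" using subcritical(1) by (rule borel_measurable_integrable)
  obtain N where N: "prob_space N" "sets N = sets env" "log_mean \<in> borel_measurable N"
    and P_eq: "P = (\<Pi>\<^sub>M i\<in>(UNIV :: nat set). N)"
    by (rule tilted_law_product[OF Q log_mean_Q P])
  interpret N: prob_space N by (rule N)
  interpret iid: iid_env N
    by unfold_locales (use N in auto)
  have coord: "distr P N (\<lambda>\<omega>. \<omega> 0) = N"
    unfolding P_eq by (rule iid.PiM_component) simp
  note [measurable] = N(3)
  have coord_meas [measurable]: "(\<lambda>\<omega>. \<omega> 0) \<in> measurable P N" unfolding P_eq by measurable
  have int_N: "integrable N log_mean"
    using centered(1) by (subst coord[symmetric]) (simp add: integrable_distr_eq)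
  have mean_N: "(\<integral>p. log_mean p \<partial>N) = 0"
    using centered(2) by (subst coord[symmetric]) (simp add: integral_distr)
  have nz: "\<not> (AE p in N. log_mean p = 0)"
  proof
    assume "AE p in N. log_mean p = 0"
    then have "AE p in distr P N (\<lambda>\<omega>. \<omega> 0). log_mean p = 0" unfolding coord .
    then have "AE \<omega> in P. log_mean (\<omega> 0) = 0" by (rule AE_distrD[OF coord_meas])
    then have "AE y in distr P borel (\<lambda>\<omega>. log_mean (\<omega> 0)). y = 0" by (subst AE_distr_iff) auto
    then have "AE y in distr P borel (\<lambda>\<omega>. log_mean (\<omega> 0)). \<exists>k::int. y = 0 + 1 * of_int k"
      by (rule eventually_mono) (auto intro!: exI[of _ 0])
    moreover have "\<not> (AE y in distr P borel (\<lambda>\<omega>. log_mean (\<omega> 0)). \<exists>k::int. y = 0 + 1 * of_int k)"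
      using nonlattice unfolding nonlattice_def by (metis zero_less_one)
    ultimately show False by blast
  qed
  interpret lim: convergent_functionals N \<alpha> c K P_plus P_minus \<delta> \<theta> w t W_inf T_inf
  proof unfold_locales
    show "0 < measure N {p. 0 < log_mean p}" "0 < measure N {p. log_mean p < 0}"
      using centered_nonconstant_signs[OF N(1) int_N mean_N nz] by simp_all
    have sets_eq: "sets (\<Pi>\<^sub>M i\<in>(UNIV :: nat set). N) = sets env_seq" by (rule iid.sets_P)
    show "W_inf \<in> borel_measurable (\<Pi>\<^sub>M i\<in>UNIV. N)" "T_inf \<in> borel_measurable (\<Pi>\<^sub>M i\<in>UNIV. N)"
      using W_inf T_inf by (simp_all cong: measurable_cong_sets[OF sets_eq refl])
  qed (use \<alpha> attraction K P_plus P_minus \<delta> \<theta> w t W_lim T_lim in \<open>auto simp: P_eq\<close>)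
  obtain D where D: "\<And>y. y \<in> (\<lambda>(u, v, z). \<bar>\<phi> (u, v, z)\<bar> * exp (- \<theta> * z)) ` (UNIV \<times> UNIV \<times> {..0}) \<Longrightarrow> y \<le> D"
    using \<phi>_bound unfolding bdd_above_def by blast
  have \<phi>_le: "\<bar>\<phi> (u, v, z)\<bar> * exp (- \<theta> * z) \<le> D" if "z \<le> 0" for u v z
    by (rule D) (use that in \<open>auto intro!: image_eqI[where x="(u, v, z)"]\<close>)
  define J where "J z = (\<integral>\<omega>'. (\<integral>\<omega>. \<phi> (W_inf \<omega>, T_inf \<omega>', - z) \<partial>P_plus z) \<partial>P_minus)" for z
  have main: "(\<lambda>n. real n * c n * (\<integral>\<omega>. \<phi> (w n (first_envs (nat \<lfloor>\<delta> * real n\<rfloor>) \<omega>), t n (last_envs_rev n (nat \<lfloor>\<delta> * real n\<rfloor>) \<omega>), walk 0 \<omega> n)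
            * (if \<forall>i<n. walk 0 \<omega> n < walk 0 \<omega> i then 1 else 0) \<partial>P))
    \<longlonglongrightarrow> K * (\<integral>z. (if z \<ge> 0 then J z * renewal_U P z else 0) \<partial>lborel)"
    unfolding P_eq J_def by (rule lim.functional_limit[OF \<phi>_cont \<phi>_le])
  have ind: "indicator {\<omega>. first_min 0 \<omega> n = n} \<omega> = (if \<forall>i<n. walk 0 \<omega> n < walk 0 \<omega> i then 1 else 0 :: real)" for \<omega> n
    by (simp add: first_min_eq_iff indicator_def)
  have J_eq: "(\<integral>v. (\<integral>u. \<phi> (u, v, - z) \<partial>distr (P_plus z) borel W_inf) \<partial>distr P_minus borel T_inf) = J z" if z: "z \<ge> 0" for z
  proof -
    have W_meas [measurable]: "W_inf \<in> borel_measurable (P_plus z)"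
      using W_inf P_plus[OF z] by (simp add: plus_law_def cong: measurable_cong_sets)
    have T_meas [measurable]: "T_inf \<in> borel_measurable P_minus"
      using T_inf P_minus by (simp add: minus_law_def cong: measurable_cong_sets)
    have "continuous_on UNIV (\<lambda>p :: 'w \<times> 't. \<phi> (fst p, snd p, - z))"
      by (rule continuous_on_compose2[OF \<phi>_cont]) (use z in \<open>auto intro!: continuous_intros\<close>)
    then have \<phi>_meas: "(\<lambda>p. \<phi> (fst p, snd p, - z)) \<in> borel_measurable borel" by (rule borel_measurable_continuous_onI)
    have \<phi>_meas' [measurable (raw)]: "(\<lambda>x. \<phi> (f x, g x, - z)) \<in> borel_measurable M"
      if [measurable]: "f \<in> borel_measurable M" "g \<in> borel_measurable M" for f g M
      using measurable_compose[OF borel_measurable_Pair[OF that] \<phi>_meas] by simp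
    interpret plus: prob_space "P_plus z" using P_plus[OF z] by (simp add: plus_law_def)
    have "(\<integral>u. \<phi> (u, v, - z) \<partial>distr (P_plus z) borel W_inf) = (\<integral>\<omega>. \<phi> (W_inf \<omega>, v, - z) \<partial>P_plus z)" for v
      by (rule integral_distr) measurable
    then show ?thesis
      unfolding J_def by (simp add: integral_distr)
  qed
  have "(LINT z:{0..}|lborel. (\<integral>v. (\<integral>u. \<phi> (u, v, - z) \<partial>distr (P_plus z) borel W_inf) \<partial>distr P_minus borel T_inf) * renewal_U P z)
    = (\<integral>z. (if z \<ge> 0 then J z * renewal_U P z else 0) \<partial>lborel)"
    unfolding set_lebesgue_integral_def using J_eq by (intro Bochner_Integration.integral_cong) (auto simp: indicator_def)
  with main show ?thesis unfolding ind by simp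
qed


end
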